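(* Choose $x_0\in\mathrm{int}(P)$, fix $\gamma\in(0,1)$, and let $$\epsilon:=\min\left\{\frac{\lambda_0^2\rho_0^2}{2m^2},\ \frac{\lambda_0^2r_0^2}{8m^2L_{\mathrm{ctr}}^2},\ \frac{\lambda_0^2(1-q_0)^2}{2m^2L_0^2L_{\mathrm{ctr}}^2},\ \frac{\lambda_0^2(1-q_0)^2\log(1/\gamma)^2}{32m^2L_0^2L_{\mathrm{ctr}}^2},\ \frac{\lambda_0^2\log(1/\gamma)^2}{32m^2L_{\mathrm{vol}}^2}\right\}.$$ Then the inexact polarity process started at $x_0$ with tolerance $\epsilon$ is well-defined, and the ellipsoid $\mathcal E(x_{N_\gamma+1},E_{N_\gamma+1})$ is $\gamma$-maximal, where $$N_\gamma:=\left\lceil\frac{\log^+\bigl(2\delta_v(x_0)/\log(1/\gamma)\bigr)}{\log(1/q_0)}\right\rceil.$$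
   Context: $P=\{x\in\mathbb R^n: a_i^\top x\le 1,\ i=1,\dots,m\}$ is a full-dimensional (bounded) polytope. For $c\in\mathbb R^n$ and $Q$ symmetric positive definite, $\mathcal E(c,Q)=\{y:(y-c)^\top Q(y-c)\le 1\}$, with normalized volume $\mathrm{Vol}(\mathcal E(c,Q))=\det(Q)^{-1/2}$. $S^\circ=\{y: y^\top s\le1\ \forall s\in S\}$. $\mathrm{MinCE}(K)$ is the unique minimum-volume ellipsoid containing $K$; $\mathrm{MaxIE}(P)$ is the unique maximum-volume ellipsoid contained in $P$, with center $x^*$. An ellipsoid $\mathcal E\subseteq P$ is $\gamma$-maximal if $\mathrm{Vol}(\mathcal E)\ge\gamma\mathrm{Vol}(\mathrm{MaxIE}(P))$. For $x\in\mathrm{int}(P)$: $v(x)=\log\mathrm{Vol}(\mathrm{MinCE}((P-x)^\circ))$, $\delta_v(x)=v(x)-v(x^* )$. $\log^+(t)=\max\{0,\log t\}$ for $t>0$, $\log^+(0)=0$. Lifted problem at $x\in\mathrm{int}(P)$: with $\tilde a_i(x)=a_i/(1-a_i^\top x)$ and $h_i(x)=(\tilde a_i(x)^\top,1)^\top$, minimize $-\log\det\mathcal Q$ over symmetric positive definite $\mathcal Q\in\mathbb R^{(n+1)\times(n+1)}$ subject to $h_i(x)^\top\mathcal Qh_i(x)\le1$ for all $i\in[m]$. Its unique optimizer is $\mathcal Q(x)=\begin{bmatrix} G(x) & z(x) \\ z(x)^\top & s(x) \end{bmatrix}$. Put $\beta(x)=1-s(x)+z(x)^\top G(x)^{-1}z(x)$,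 $$\mathcal K(x)=x+\frac{z(x)}{1-s(x)},\quad E(x)=(1-s(x))\Bigl(G(x)^{-1}-\frac{G(x)^{-1}z(x)z(x)^\top G(x)^{-1}}{\beta(x)}\Bigr)$$ (the exact polarity update). For any feasible $\widehat{\mathcal Q}(x)$ with blocks $\widehat G(x),\widehat z(x),\widehat s(x)$ define $\widehat\beta(x),\widehat{\mathcal K}(x),\widehat E(x)$ by the same formulas with hats. Inexact polarity process with tolerance $\epsilon\ge0$: for $k=0,1,\dots$ an oracle returns any feasible point $\widehat{\mathcal Q}(x_k)$ of the lifted problem at $x_k$ with $-\log\det\widehat{\mathcal Q}(x_k)\le-\log\det\mathcal Q(x_k)+\epsilon$; set $x_{k+1}=\widehat{\mathcal K}(x_k)$, $E_{k+1}=\widehat E(x_k)$. Constants (depending on $P$ and $x_0$). Let $\mathcal L=\{x\in\mathrm{int}(P):v(x)\le v(x_0)+1\}$, which is compact. - $q_0\in(0,1)$ is such that $\delta_v(\mathcal K(x))\le q_0\delta_v(x)$ for all $x\in\mathcal L$ (such $q_0$ exists). - $\lambda_0=\min_{x\in\mathcal L}\lambda_{\min}\bigl(\sum_{i=1}^mh_i(x)h_i(x)^\top\bigr)>0$. - $\theta_0,\mu_0,\sigma_0,\beta_0$ are the (positive) minima over $x\in\mathcal L$ of $\lambda_{\min}(\mathcal Q(x))$, $\lambda_{\min}(G(x))$, $1-s(x)$, $\beta(x)$, respectively. $\rho_0>0$ is such that for all $x\in\mathcal L$ and all feasible $\widehat{\mathcal Q}(x)$ with $\|\widehat{\mathcal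 Q}(x)-\mathcal Q(x)\|_F\le\rho_0$: $\lambda_{\min}(\widehat{\mathcal Q}(x))\ge\theta_0/2$, $\lambda_{\min}(\widehat G(x))\ge\mu_0/2$, $1-\widehat s(x)\ge\sigma_0/2$, $\widehat\beta(x)\ge\beta_0/2$; and $L_{\mathrm{ctr}},L_{\mathrm{vol}}>0$ are such that for all such $x,\widehat{\mathcal Q}(x)$: $\|\widehat{\mathcal K}(x)-\mathcal K(x)\|\le L_{\mathrm{ctr}}\|\widehat{\mathcal Q}(x)-\mathcal Q(x)\|_F$ and $|\log\mathrm{Vol}(\mathcal E(\widehat{\mathcal K}(x),\widehat E(x)))-\log\mathrm{Vol}(\mathcal E(\mathcal K(x),E(x)))|\le L_{\mathrm{vol}}\|\widehat{\mathcal Q}(x)-\mathcal Q(x)\|_F$ (such constants exist). - $r_0=\mathrm{dist}(\mathcal K(\mathcal L),\partial P)>0$, $\mathcal V_0=\{y\in\mathbb R^n:\mathrm{dist}(y,\mathcal K(\mathcal L))\le r_0/2\}$, $L_0=\max_{y\in\mathcal V_0}\|\nabla\delta_v(y)\|\in(0,\infty)$. *)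

theory Defs
  imports "HOL-Analysis.Analysis"
begin

section \<open>Matrices\<close>

definition pos_def :: "real ^ 'k ^ 'k \<Rightarrow> bool" where
  "pos_def A \<longleftrightarrow> transpose A = A \<and> (\<forall>v. v \<noteq> 0 \<longrightarrow> v \<bullet> (A *v v) > 0)"

text \<open>Only applied to symmetric matrices, for which a least real eigenvalue exists.\<close>
definition lambda_min :: "real ^ 'k ^ 'k \<Rightarrow> real" where
  "lambda_min A = (LEAST l. \<exists>v. v \<noteq> 0 \<and> A *v v = l *\<^sub>R v)"

definition outer :: "real ^ 'k \<Rightarrow> real ^ 'k \<Rightarrow> real ^ 'k ^ 'k" where
  "outer u v = (\<chi> i j. u $ i * v $ j)"

text \<open>The value used where the gradient does not exist is irrelevant.\<close>
definition gradient :: "('v::real_inner \<Rightarrow> real) \<Rightarrow> 'v \<Rightarrow> 'v" where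
  "gradient f x = (THE g. GDERIV f x :> g)"

definition log_plus :: "real \<Rightarrow> real" where
  "log_plus t = (if t = 0 then 0 else max 0 (ln t))"


section \<open>Ellipsoids\<close>

definition ellipsoid :: "real ^ 'n \<Rightarrow> real ^ 'n ^ 'n \<Rightarrow> (real ^ 'n) set" where
  "ellipsoid c Q = {y. (y - c) \<bullet> (Q *v (y - c)) \<le> 1}"

definition is_ellipsoid :: "(real ^ 'n) set \<Rightarrow> bool" where
  "is_ellipsoid S \<longleftrightarrow> (\<exists>c Q. pos_def Q \<and> S = ellipsoid c Q)"

text \<open>An ellipsoid determines its parameters (c, Q), so both descriptions below are
  unambiguous on ellipsoids. The volume is normalized so that the unit ball has volume 1.\<close>
definition Vol :: "(real ^ 'n) set \<Rightarrow> real" where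
  "Vol S = (THE r. \<exists>c Q. pos_def Q \<and> S = ellipsoid c Q \<and> r = det Q powr (- 1 / 2))"

definition ell_center :: "(real ^ 'n) set \<Rightarrow> real ^ 'n" where
  "ell_center S = (THE c. \<exists>Q. pos_def Q \<and> S = ellipsoid c Q)"

definition polar_set :: "(real ^ 'n) set \<Rightarrow> (real ^ 'n) set" where
  "polar_set S = {y. \<forall>s\<in>S. y \<bullet> s \<le> 1}"

definition MinCE :: "(real ^ 'n) set \<Rightarrow> (real ^ 'n) set" where
  "MinCE K = (THE S. is_ellipsoid S \<and> K \<subseteq> S \<and>
                (\<forall>T. is_ellipsoid T \<and> K \<subseteq> T \<longrightarrow> Vol S \<le> Vol T))"

definition MaxIE :: "(real ^ 'n) set \<Rightarrow> (real ^ 'n) set" where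
  "MaxIE K = (THE S. is_ellipsoid S \<and> S \<subseteq> K \<and>
                (\<forall>T. is_ellipsoid T \<and> T \<subseteq> K \<longrightarrow> Vol T \<le> Vol S))"

definition gamma_maximal :: "(real ^ 'n) set \<Rightarrow> real \<Rightarrow> (real ^ 'n) set \<Rightarrow> bool" where
  "gamma_maximal K \<gamma> S \<longleftrightarrow> is_ellipsoid S \<and> S \<subseteq> K \<and> Vol S \<ge> \<gamma> * Vol (MaxIE K)"


section \<open>The polytope and the potential\<close>

text \<open>The m constraints are indexed by a finite type, so m is its cardinality. The origin is
  an interior point, hence the set is always full-dimensional.\<close>
definition hpoly :: "('m::finite \<Rightarrow> real ^ 'n) \<Rightarrow> (real ^ 'n) set" where
  "hpoly a = {x. \<forall>i. a i \<bullet> x \<le> 1}"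

definition vpot :: "('m::finite \<Rightarrow> real ^ 'n) \<Rightarrow> real ^ 'n \<Rightarrow> real" where
  "vpot a x = ln (Vol (MinCE (polar_set ((\<lambda>p. p - x) ` hpoly a))))"

definition delta_v :: "('m::finite \<Rightarrow> real ^ 'n) \<Rightarrow> real ^ 'n \<Rightarrow> real" where
  "delta_v a x = vpot a x - vpot a (ell_center (MaxIE (hpoly a)))"


section \<open>The lifted problem\<close>

text \<open>Matrices of order n + 1 are indexed by the sum type \<open>'n + unit\<close>: \<open>Inl\<close> gives the first
  n coordinates and \<open>Inr ()\<close> the last one.\<close>
type_synonym 'n lmat = "real ^ ('n + unit) ^ ('n + unit)"

definition a_tilde :: "('m::finite \<Rightarrow> real ^ 'n) \<Rightarrow> real ^ 'n \<Rightarrow> 'm \<Rightarrow> real ^ 'n" where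
  "a_tilde a x i = (1 / (1 - a i \<bullet> x)) *\<^sub>R a i"

definition hvec :: "('m::finite \<Rightarrow> real ^ 'n) \<Rightarrow> real ^ 'n \<Rightarrow> 'm \<Rightarrow> real ^ ('n + unit)" where
  "hvec a x i = (\<chi> k. case k of Inl j \<Rightarrow> a_tilde a x i $ j | Inr _ \<Rightarrow> 1)"

definition lifted_feasible :: "('m::finite \<Rightarrow> real ^ 'n) \<Rightarrow> real ^ 'n \<Rightarrow> 'n::finite lmat \<Rightarrow> bool" where
  "lifted_feasible a x Q \<longleftrightarrow> pos_def Q \<and> (\<forall>i. hvec a x i \<bullet> (Q *v hvec a x i) \<le> 1)"

definition is_lifted_opt :: "('m::finite \<Rightarrow> real ^ 'n) \<Rightarrow> real ^ 'n \<Rightarrow> 'n::finite lmat \<Rightarrow> bool" where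
  "is_lifted_opt a x Q \<longleftrightarrow> lifted_feasible a x Q \<and>
     (\<forall>Q'. lifted_feasible a x Q' \<longrightarrow> - ln (det Q) \<le> - ln (det Q'))"

definition lifted_opt :: "('m::finite \<Rightarrow> real ^ 'n) \<Rightarrow> real ^ 'n \<Rightarrow> 'n::finite lmat" where
  "lifted_opt a x = (THE Q. is_lifted_opt a x Q)"

definition blk_G :: "'n::finite lmat \<Rightarrow> real ^ 'n ^ 'n" where
  "blk_G Q = (\<chi> i j. Q $ Inl i $ Inl j)"

definition blk_z :: "'n::finite lmat \<Rightarrow> real ^ 'n" where
  "blk_z Q = (\<chi> i. Q $ Inl i $ Inr ())"

definition blk_s :: "'n::finite lmat \<Rightarrow> real" where
  "blk_s Q = Q $ Inr () $ Inr ()"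

definition beta :: "'n::finite lmat \<Rightarrow> real" where
  "beta Q = 1 - blk_s Q + blk_z Q \<bullet> (matrix_inv (blk_G Q) *v blk_z Q)"

text \<open>The updates as functions of an arbitrary lifted matrix; the exact update at x uses
  \<open>lifted_opt a x\<close>, the inexact one uses an oracle answer.\<close>
definition K_upd :: "real ^ 'n \<Rightarrow> 'n::finite lmat \<Rightarrow> real ^ 'n" where
  "K_upd x Q = x + (1 / (1 - blk_s Q)) *\<^sub>R blk_z Q"

definition E_upd :: "'n::finite lmat \<Rightarrow> real ^ 'n ^ 'n" where
  "E_upd Q = (1 - blk_s Q) *\<^sub>R (matrix_inv (blk_G Q) -
     (1 / beta Q) *\<^sub>R
       (matrix_inv (blk_G Q) ** outer (blk_z Q) (blk_z Q) ** matrix_inv (blk_G Q)))"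

definition K_exact :: "('m::finite \<Rightarrow> real ^ 'n) \<Rightarrow> real ^ 'n \<Rightarrow> real ^ 'n" where
  "K_exact a x = K_upd x (lifted_opt a x)"

definition E_exact :: "('m::finite \<Rightarrow> real ^ 'n) \<Rightarrow> real ^ 'n \<Rightarrow> real ^ 'n ^ 'n" where
  "E_exact a x = E_upd (lifted_opt a x)"


section \<open>The inexact polarity process\<close>

definition oracle_answer ::
    "('m::finite \<Rightarrow> real ^ 'n) \<Rightarrow> real \<Rightarrow> real ^ 'n \<Rightarrow> 'n::finite lmat \<Rightarrow> bool" where
  "oracle_answer a \<epsilon> x Q \<longleftrightarrow> lifted_feasible a x Q \<and>
     - ln (det Q) \<le> - ln (det (lifted_opt a x)) + \<epsilon>"

text \<open>A run consists of oracle answers \<open>Qh k\<close>, iterates \<open>x k\<close> and shape matrices \<open>E k\<close>, with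
  \<open>E 0\<close> unused. The lifted problem makes sense only at interior points, so the oracle is
  constrained only there; that iterates stay in the interior is part of well-definedness and
  must not be built into the notion of a run.\<close>
definition inexact_process ::
    "('m::finite \<Rightarrow> real ^ 'n) \<Rightarrow> real \<Rightarrow> real ^ 'n \<Rightarrow>
     (nat \<Rightarrow> 'n::finite lmat) \<Rightarrow> (nat \<Rightarrow> real ^ 'n) \<Rightarrow> (nat \<Rightarrow> real ^ 'n ^ 'n) \<Rightarrow> bool" where
  "inexact_process a \<epsilon> x0 Qh x E \<longleftrightarrow> x 0 = x0 \<and>
     (\<forall>k. (x k \<in> interior (hpoly a) \<longrightarrow> oracle_answer a \<epsilon> (x k) (Qh k)) \<and>
          x (Suc k) = K_upd (x k) (Qh k) \<and> E (Suc k) = E_upd (Qh k))"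

text \<open>A run exists, and whatever the oracle answers: every iterate is interior, the lifted
  problem there has a unique optimizer, the update formulas only invert invertible quantities,
  and the resulting shape matrices define ellipsoids.\<close>
definition process_well_defined ::
    "('m::finite \<Rightarrow> real ^ 'n) \<Rightarrow> real \<Rightarrow> real ^ 'n \<Rightarrow> bool" where
  "process_well_defined a \<epsilon> x0 \<longleftrightarrow>
     (\<exists>Qh x E. inexact_process a \<epsilon> x0 Qh x E) \<and>
     (\<forall>Qh x E. inexact_process a \<epsilon> x0 Qh x E \<longrightarrow>
        (\<forall>k. x k \<in> interior (hpoly a) \<and>
             (\<exists>!Q. is_lifted_opt a (x k) Q) \<and>
             invertible (blk_G (Qh k)) \<and> 1 - blk_s (Qh k) \<noteq> 0 \<and> beta (Qh k) \<noteq> 0 \<and>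
             pos_def (E (Suc k))))"


section \<open>Constants\<close>

definition Lset :: "('m::finite \<Rightarrow> real ^ 'n) \<Rightarrow> real ^ 'n \<Rightarrow> (real ^ 'n) set" where
  "Lset a x0 = {x \<in> interior (hpoly a). vpot a x \<le> vpot a x0 + 1}"

text \<open>All infima and suprema below are attained, because \<open>Lset a x0\<close> is compact.\<close>

definition lambda0 :: "('m::finite \<Rightarrow> real ^ 'n) \<Rightarrow> real ^ 'n \<Rightarrow> real" where
  "lambda0 a x0 = (INF x\<in>Lset a x0. lambda_min (\<Sum>i\<in>UNIV. outer (hvec a x i) (hvec a x i)))"

definition theta0 :: "('m::finite \<Rightarrow> real ^ 'n) \<Rightarrow> real ^ 'n \<Rightarrow> real" where
  "theta0 a x0 = (INF x\<in>Lset a x0. lambda_min (lifted_opt a x))"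

definition mu0 :: "('m::finite \<Rightarrow> real ^ 'n) \<Rightarrow> real ^ 'n \<Rightarrow> real" where
  "mu0 a x0 = (INF x\<in>Lset a x0. lambda_min (blk_G (lifted_opt a x)))"

definition sigma0 :: "('m::finite \<Rightarrow> real ^ 'n) \<Rightarrow> real ^ 'n \<Rightarrow> real" where
  "sigma0 a x0 = (INF x\<in>Lset a x0. 1 - blk_s (lifted_opt a x))"

definition beta0 :: "('m::finite \<Rightarrow> real ^ 'n) \<Rightarrow> real ^ 'n \<Rightarrow> real" where
  "beta0 a x0 = (INF x\<in>Lset a x0. beta (lifted_opt a x))"

definition r0 :: "('m::finite \<Rightarrow> real ^ 'n) \<Rightarrow> real ^ 'n \<Rightarrow> real" where
  "r0 a x0 = setdist (K_exact a ` Lset a x0) (frontier (hpoly a))"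

definition V0 :: "('m::finite \<Rightarrow> real ^ 'n) \<Rightarrow> real ^ 'n \<Rightarrow> (real ^ 'n) set" where
  "V0 a x0 = {y. infdist y (K_exact a ` Lset a x0) \<le> r0 a x0 / 2}"

definition L0 :: "('m::finite \<Rightarrow> real ^ 'n) \<Rightarrow> real ^ 'n \<Rightarrow> real" where
  "L0 a x0 = (SUP y\<in>V0 a x0. norm (gradient (delta_v a) y))"

text \<open>The norm of type \<open>'n lmat\<close> is the Frobenius norm.\<close>
definition near_opt ::
    "('m::finite \<Rightarrow> real ^ 'n) \<Rightarrow> real \<Rightarrow> real ^ 'n \<Rightarrow> 'n::finite lmat \<Rightarrow> bool" where
  "near_opt a \<rho> x Q \<longleftrightarrow> lifted_feasible a x Q \<and> norm (Q - lifted_opt a x) \<le> \<rho>"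

end

theory Submission
  imports Defs
begin

text \<open>The volume of the minimal ellipsoid containing the polar of the polytope about \<open>x\<close> is a
  function of the lifted optimum at \<open>x\<close>, and the updated ellipsoid is the polar of that minimal
  ellipsoid, hence inscribed in the polytope, with log-volume at least \<open>- v x\<close>. Conversely, every
  inscribed ellipsoid bounds \<open>v\<close> from above at its interior points; it follows that the minimum of
  \<open>v\<close> is minus the log-volume of the maximal inscribed ellipsoid, and that \<open>v\<close> is differentiable
  with a continuous gradient, so \<open>L0\<close> is a genuine Lipschitz constant. Strong convexity of
  \<open>- ln det\<close> on the feasible set, whose elements have norm at most \<open>m / lambda0\<close>, turns the
  oracle tolerance \<open>\<epsilon>\<close> into a distance to the exact optimum; the update then perturbs the
  contraction \<open>\<delta> \<mapsto> q0 * \<delta>\<close> by at most \<open>(1 - q0) * min 1 (ln (1 / \<gamma>) / 4)\<close>, which keeps the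
  iterates in the sublevel set and drives \<open>\<delta>\<close> below \<open>3 / 4 * ln (1 / \<gamma>)\<close> in \<open>N\<close> steps. If one
  of the constants in the formula for \<open>\<epsilon>\<close> vanishes, then \<open>\<epsilon> = 0\<close> (as \<open>t / 0 = 0\<close>) and the oracle
  is exact.\<close>

section \<open>Symmetric matrices\<close>

text \<open>The lifted problem meets ellipsoids through two facts:
  \<open>det Q = (1 - beta Q) * det (blk_G Q)\<close>, and the constraints place all points
  \<open>a_tilde a x i\<close> in an ellipsoid whose shape matrix is \<open>blk_G Q\<close> divided
  by \<open>b = beta Q\<close>. So \<open>det Q\<close> is the determinant of that shape times
  \<open>(1 - b) * b ^ n\<close>, and the maximum of this factor is the same for all ellipsoids;
  maximizing one determinant maximizes the other. \<open>Vol\<close>, \<open>MinCE\<close>,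
  \<open>MaxIE\<close> and \<open>lifted_opt\<close> are definite descriptions, so each of them is
  opaque until existence and uniqueness are proved; this accounts for much of the length. The
  gradient of the potential is found without differentiating the optimizer. The ellipsoid that is
  optimal at \<open>x\<close> remains a competitor at nearby points and gives a one-sided quadratic
  estimate; exchanging the two points gives the other side. For this the optimizer only has to be
  continuous, and the constants uniform near \<open>x\<close>.\<close>

declare transpose_matrix_vector [simp del]

lemma inner_matrix_vector_transpose:
  fixes A :: "real ^ 'k ^ 'l"
  shows "(A *v x) \<bullet> y = x \<bullet> (transpose A *v y)"
  by (metis dot_lmul_matrix inner_commute transpose_matrix_vector)

lemma inner_matrix_vector_symmetric:
  fixes A :: "real ^ 'k ^ 'k"
  assumes "transpose A = A"
  shows "x \<bullet> (A *v y) = (A *v x) \<bullet> y"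
  by (simp add: inner_matrix_vector_transpose assms)

text \<open>The first-order condition at a minimum of a quadratic form, without derivatives. At
  \<open>t = - b / d\<close>, for any \<open>d\<close> that is positive and exceeds
  \<open>c\<close>, the expression would be negative.\<close>

lemma nonneg_quadratic_imp_linear_zero:
  fixes b c :: real
  assumes "\<And>t. 0 \<le> t * b + t\<^sup>2 * c"
  shows "b = 0"
proof (rule ccontr)
  assume b: "b \<noteq> 0"
  define d where "d = \<bar>c\<bar> + 1"
  have d: "d > 0" "c < d" unfolding d_def by linarith+
  have "(- b / d) * b + (- b / d)\<^sup>2 * c = (b\<^sup>2 / d) * (c / d - 1)"
    using d by (simp add: field_simps power2_eq_square)
  moreover have "(b\<^sup>2 / d) * (c / d - 1) < 0"
    using d b by (intro mult_pos_neg) (auto simp: field_simps)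
  ultimately show False using assms[of "- b / d"] by linarith
qed

text \<open>A minimizer \<open>u\<close> of the form on the unit sphere of \<open>S\<close> is an
  eigenvector: the first variation vanishes in all directions of \<open>S\<close> orthogonal to
  \<open>u\<close>, and the residual \<open>f u - l *\<^sub>R u\<close> is itself such a direction
  because \<open>S\<close> is invariant. Invariant subspaces let the spectral theorem recurse;
  \<open>S = UNIV\<close> gives the least eigenvalue.\<close>

lemma rayleigh_minimizer:
  fixes f :: "'a::euclidean_space \<Rightarrow> 'a"
  assumes f: "linear f" and sym: "\<And>x y. x \<bullet> f y = f x \<bullet> y"
    and S: "subspace S" and inv: "f ` S \<subseteq> S" and nz: "S \<noteq> {0}"
  obtains u where "u \<in> S" "norm u = 1" "f u = (u \<bullet> f u) *\<^sub>R u"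
    "\<And>x. x \<in> S \<Longrightarrow> (u \<bullet> f u) * (norm x)\<^sup>2 \<le> x \<bullet> f x"
proof -
  have 0: "0 \<in> S" using S by (rule subspace_0)
  then obtain w where w: "w \<in> S" "w \<noteq> 0" using nz by auto
  have "compact (S \<inter> sphere 0 1)"
    by (simp add: closed_Int_compact closed_subspace S)
  moreover have "w /\<^sub>R norm w \<in> S \<inter> sphere 0 1"
    using w S by (auto intro: subspace_scale)
  hence "S \<inter> sphere 0 1 \<noteq> {}" by blast
  moreover have "continuous_on (S \<inter> sphere 0 1) (\<lambda>x. x \<bullet> f x)"
    by (intro continuous_intros linear_continuous_on_compose[OF _ f])
  ultimately obtain u where u: "u \<in> S \<inter> sphere 0 1"
    and min: "\<And>x. x \<in> S \<inter> sphere 0 1 \<Longrightarrow> u \<bullet> f u \<le> x \<bullet> f x"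
    using continuous_attains_inf[of "S \<inter> sphere 0 1" "\<lambda>x. x \<bullet> f x"] by blast
  define l where "l = u \<bullet> f u"
  have uS: "u \<in> S" and nu: "norm u = 1" using u by auto
  have ray: "l * (norm x)\<^sup>2 \<le> x \<bullet> f x" if "x \<in> S" for x
  proof (cases "x = 0")
    case False
    have "x /\<^sub>R norm x \<in> S \<inter> sphere 0 1"
      using False that S by (auto intro: subspace_scale)
    from min[OF this] have "l \<le> (x \<bullet> f x) / (norm x)\<^sup>2"
      by (simp add: l_def linear_scale[OF f] power2_eq_square divide_inverse mult_ac)
    then show ?thesis using False by (simp add: pos_le_divide_eq)
  qed (simp add: linear_0[OF f])
  have orth: "w \<bullet> f u = 0" if "w \<in> S" "w \<bullet> u = 0" for w
  proof -
    have "0 \<le> t * (2 * (w \<bullet> f u)) + t\<^sup>2 * (w \<bullet> f w - l * (w \<bullet> w))" for t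
    proof -
      have "u + t *\<^sub>R w \<in> S" using S uS that by (intro subspace_add subspace_scale)
      from ray[OF this] have "l * ((u + t *\<^sub>R w) \<bullet> (u + t *\<^sub>R w)) \<le> (u + t *\<^sub>R w) \<bullet> f (u + t *\<^sub>R w)"
        by (simp add: power2_norm_eq_inner)
      moreover have "u \<bullet> u = 1" using nu by (simp add: norm_eq_1)
      moreover have "u \<bullet> f w = w \<bullet> f u" using sym[of u w] by (simp add: inner_commute)
      ultimately show ?thesis using that
        by (simp add: linear_add[OF f] linear_scale[OF f] inner_simps inner_commute[of u w]
            l_def[symmetric] power2_eq_square algebra_simps)
    qed
    from nonneg_quadratic_imp_linear_zero[OF this] show ?thesis by simp
  qed
  define w where "w = f u - l *\<^sub>R u"
  have wS: "w \<in> S" unfolding w_def using S uS inv by (intro subspace_diff subspace_scale) auto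
  have "u \<bullet> u = 1" using nu by (simp add: norm_eq_1)
  then have wu: "w \<bullet> u = 0" by (simp add: w_def inner_diff l_def inner_commute)
  have "w \<bullet> w = w \<bullet> f u - l * (w \<bullet> u)" by (simp add: w_def inner_simps)
  with orth[OF wS wu] wu have "w \<bullet> w = 0" by simp
  then have "f u = l *\<^sub>R u" by (simp add: w_def)
  with uS nu ray that show thesis unfolding l_def by blast
qed

text \<open>Induction on the dimension: symmetry of \<open>f\<close> makes the orthogonal complement
  of an eigenvector invariant, so \<open>rayleigh_minimizer\<close> applies there again.\<close>

lemma symmetric_eigenbasis:
  fixes f :: "'a::euclidean_space \<Rightarrow> 'a"
  assumes f: "linear f" and sym: "\<And>x y. x \<bullet> f y = f x \<bullet> y"
    and S: "subspace S" and inv: "f ` S \<subseteq> S"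
  shows "\<exists>B. B \<subseteq> S \<and> pairwise orthogonal B \<and> (\<forall>b\<in>B. norm b = 1 \<and> (\<exists>l. f b = l *\<^sub>R b)) \<and> span B = S"
  using S inv
proof (induction "dim S" arbitrary: S rule: less_induct)
  case less
  show ?case
  proof (cases "S = {0}")
    case True
    then show ?thesis by (intro exI[of _ "{}"]) auto
  next
    case False
    from rayleigh_minimizer[OF f sym less.prems False] obtain u where
      u: "u \<in> S" "norm u = 1" "f u = (u \<bullet> f u) *\<^sub>R u" by metis
    have uu: "u \<bullet> u = 1" using u by (simp add: norm_eq_1)
    define T where "T = S \<inter> {x. u \<bullet> x = 0}"
    have subT: "subspace T" unfolding T_def
      by (intro subspace_inter less.prems subspace_hyperplane)
    have invT: "f ` T \<subseteq> T"
    proof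
      fix y assume "y \<in> f ` T"
      then obtain x where x: "x \<in> S" "u \<bullet> x = 0" "y = f x" by (auto simp: T_def)
      have "u \<bullet> f x = f u \<bullet> x" by (rule sym)
      also have "\<dots> = 0" using x by (subst u(3)) simp
      finally show "y \<in> T" using x less.prems by (auto simp: T_def)
    qed
    have "u \<notin> T" using uu by (simp add: T_def)
    moreover have "T \<subseteq> S" by (simp add: T_def)
    ultimately have "T \<subset> S" using u by blast
    then have "dim T < dim S"
      using subT less.prems(1) dim_psubset[of T S] by (metis span_eq_iff)
    from less.hyps[OF this subT invT] obtain B where
      B: "B \<subseteq> T" "pairwise orthogonal B" "\<forall>b\<in>B. norm b = 1 \<and> (\<exists>l. f b = l *\<^sub>R b)" "span B = T"
      by blast
    have "span (insert u B) = S"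
    proof
      show "span (insert u B) \<subseteq> S"
        using u B \<open>T \<subseteq> S\<close> less.prems by (intro span_minimal) auto
      show "S \<subseteq> span (insert u B)"
      proof
        fix x assume x: "x \<in> S"
        have "x - (u \<bullet> x) *\<^sub>R u \<in> T"
          using x u less.prems uu by (auto simp: T_def inner_simps intro: subspace_diff subspace_scale)
        then have "x - (u \<bullet> x) *\<^sub>R u \<in> span B" using B by simp
        then show "x \<in> span (insert u B)" unfolding span_insert by blast
      qed
    qed
    moreover have "pairwise orthogonal (insert u B)"
      using B by (auto simp: pairwise_insert orthogonal_def T_def inner_commute)
    ultimately show ?thesis using B u \<open>T \<subseteq> S\<close>
      by (intro exI[of _ "insert u B"]) auto
  qed
qed

section \<open>Diagonal matrices and diagonalization\<close>

definition dmat :: "('k \<Rightarrow> real) \<Rightarrow> real ^ 'k ^ 'k" where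
  "dmat d = (\<chi> i j. if i = j then d i else 0)"

lemma det_dmat: "det (dmat d) = prod d UNIV"
  by (subst det_diagonal) (simp_all add: dmat_def)

lemma transpose_dmat [simp]: "transpose (dmat d) = dmat d"
  by (simp add: dmat_def transpose_def vec_eq_iff)

lemma dmat_mult_vector: "dmat d *v x = (\<chi> i. d i * x $ i)"
  by (simp add: dmat_def matrix_vector_mult_def vec_eq_iff if_distrib[of "\<lambda>t. t * _"] sum.delta cong: if_cong)

lemma dmat_mult: "dmat c ** dmat d = dmat (\<lambda>i. c i * d i)"
  by (simp add: dmat_def matrix_matrix_mult_def vec_eq_iff if_distrib[of "\<lambda>t. t * _"] sum.delta cong: if_cong)

lemma dmat_1: "dmat (\<lambda>i. 1) = mat 1"
  by (simp add: dmat_def vec_eq_iff mat_def)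

lemma symmetric_diagonalization:
  fixes C :: "real ^ 'k ^ 'k"
  assumes "transpose C = C"
  obtains U :: "real ^ 'k ^ 'k" and d where "orthogonal_matrix U" "C = transpose U ** dmat d ** U"
proof -
  have "linear ((*v) C)" by simp
  from symmetric_eigenbasis[OF this inner_matrix_vector_symmetric[OF assms] subspace_UNIV]
  obtain B where B: "pairwise orthogonal B" "\<And>b. b \<in> B \<Longrightarrow> norm b = 1"
    "\<And>b. b \<in> B \<Longrightarrow> \<exists>l. C *v b = l *\<^sub>R b" "span B = UNIV"
    by (metis subset_UNIV)
  have "0 \<notin> B" using B(2) by force
  with B have ind: "independent B" by (simp add: pairwise_orthogonal_independent)
  then have "finite B" by (rule independent_imp_finite)
  have "card B = dim (span B)" using ind by (simp add: dim_eq_card_independent)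
  with B have "card B = CARD('k)" by simp
  then obtain h :: "'k \<Rightarrow> real ^ 'k" where h: "bij_betw h UNIV B"
    using \<open>finite B\<close> finite_same_card_bij[of "UNIV :: 'k set" B] by auto
  have hB: "h i \<in> B" for i using h by (auto simp: bij_betw_def)
  define U where "U = (\<chi> i. h i)"
  obtain d where d: "\<And>i. C *v h i = d i *\<^sub>R h i"
    using B(3)[OF hB] by metis
  have orth: "orthogonal_matrix U"
    unfolding orthogonal_matrix_orthonormal_rows
  proof (intro conjI allI impI)
    show "norm (row i U) = 1" for i using B(2)[OF hB] by (simp add: U_def row_def)
    fix i j :: 'k assume "i \<noteq> j"
    then have "h i \<noteq> h j" using h by (auto simp: bij_betw_def inj_on_def)
    then show "orthogonal (row i U) (row j U)"
      using B(1) hB by (simp add: U_def row_def pairwise_def)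
  qed
  have "C ** transpose U = transpose U ** dmat d"
  proof -
    have "(C ** transpose U) $ i $ j = (transpose U ** dmat d) $ i $ j" for i j
    proof -
      have "(C ** transpose U) $ i $ j = (C *v h j) $ i"
        by (simp add: matrix_matrix_mult_def matrix_vector_mult_def transpose_def U_def)
      also have "\<dots> = (transpose U ** dmat d) $ i $ j"
        by (simp add: d matrix_matrix_mult_def transpose_def U_def dmat_def if_distrib[of "\<lambda>t. _ * t"] sum.delta cong: if_cong)
      finally show ?thesis .
    qed
    then show ?thesis by (simp add: vec_eq_iff)
  qed
  then have "(C ** transpose U) ** U = transpose U ** dmat d ** U" by simp
  moreover have "(C ** transpose U) ** U = C"
    using orth by (simp add: orthogonal_matrix matrix_mul_assoc[symmetric])
  ultimately show thesis using that orth by metis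
qed

lemma pos_defD:
  assumes "pos_def A"
  shows "transpose A = A" "v \<noteq> 0 \<Longrightarrow> v \<bullet> (A *v v) > 0" "v \<bullet> (A *v v) \<ge> 0"
proof -
  show "transpose A = A" and pos: "v \<noteq> 0 \<Longrightarrow> v \<bullet> (A *v v) > 0"
    using assms by (auto simp: pos_def_def)
  show "v \<bullet> (A *v v) \<ge> 0"
    using pos by (cases "v = 0") (auto intro: less_imp_le)
qed

lemma pos_def_invertible: "pos_def A \<Longrightarrow> invertible A"
  unfolding invertible_left_inverse matrix_left_invertible_ker
  using pos_defD(2) by fastforce

lemma pos_def_congruence:
  fixes A :: "real ^ 'l ^ 'l" and R :: "real ^ 'k ^ 'l"
  assumes "pos_def A" "invertible R"
  shows "pos_def (transpose R ** A ** R)"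
  unfolding pos_def_def
proof (intro conjI allI impI)
  show "transpose (transpose R ** A ** R) = transpose R ** A ** R"
    using pos_defD(1)[OF assms(1)] by (simp add: matrix_transpose_mul matrix_mul_assoc)
  fix v :: "real ^ 'k" assume "v \<noteq> 0"
  obtain S where "S ** R = mat 1" using assms(2) by (auto simp: invertible_def)
  then have "R *v v \<noteq> 0"
    using \<open>v \<noteq> 0\<close> matrix_left_invertible_ker[of R] by blast
  then show "0 < v \<bullet> ((transpose R ** A ** R) *v v)"
    using pos_defD(2)[OF assms(1) \<open>R *v v \<noteq> 0\<close>]
    by (simp only: matrix_vector_mul_assoc[symmetric] inner_matrix_vector_transpose)
qed

text \<open>Factor \<open>A\<close> as \<open>transpose R0 ** R0\<close>, diagonalize
  \<open>C\<close> in the coordinates given by \<open>R0\<close>, and compose with the orthogonal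
  matrix found. Determinants involving both matrices thereby become products over diagonal
  entries.\<close>

lemma simultaneous_diagonalization:
  fixes A C :: "real ^ 'k ^ 'k"
  assumes A: "pos_def A" and C: "transpose C = C"
  obtains R :: "real ^ 'k ^ 'k" and d where "invertible R" "A = transpose R ** R" "C = transpose R ** dmat d ** R"
proof -
  obtain U a where U: "orthogonal_matrix U" and AU: "A = transpose U ** dmat a ** U"
    using symmetric_diagonalization[OF pos_defD(1)[OF A]] .
  have UU: "transpose U ** U = mat 1" "U ** transpose U = mat 1"
    using U by (auto simp: orthogonal_matrix_def)
  have a: "a i > 0" for i
  proof -
    let ?v = "transpose U *v axis i 1"
    have Uv: "U *v ?v = axis i 1" by (simp add: matrix_vector_mul_assoc UU)
    have "?v \<noteq> 0"
    proof
      assume "?v = 0"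
      with Uv have "axis i (1::real) = 0" by simp
      then show False by simp
    qed
    then have "0 < ?v \<bullet> (A *v ?v)" using A by (simp add: pos_def_def)
    also have "A *v ?v = transpose U *v (dmat a *v axis i 1)"
      by (simp add: AU matrix_vector_mul_assoc[symmetric] Uv del: transpose_matrix_vector)
    also have "?v \<bullet> \<dots> = axis i 1 \<bullet> (dmat a *v axis i 1)"
      by (simp only: inner_matrix_vector_transpose[symmetric] Uv)
    also have "\<dots> = a i" by (simp add: dmat_mult_vector inner_axis')
    finally show ?thesis .
  qed
  define R0 where "R0 = dmat (\<lambda>i. sqrt (a i)) ** U"
  have "det R0 \<noteq> 0"
    using det_orthogonal_matrix[OF U] a by (auto simp: R0_def det_mul det_dmat less_imp_neq[symmetric])
  then have R0: "invertible R0" by (simp add: invertible_det_nz)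
  have AR0: "A = transpose R0 ** R0"
  proof -
    have "transpose R0 ** R0 = transpose U ** (dmat (\<lambda>i. sqrt (a i)) ** dmat (\<lambda>i. sqrt (a i))) ** U"
      by (simp add: R0_def matrix_transpose_mul matrix_mul_assoc)
    also have "\<dots> = A" using a by (simp add: dmat_mult AU less_imp_le)
    finally show ?thesis by simp
  qed
  obtain S where S: "R0 ** S = mat 1" "S ** R0 = mat 1" using R0 by (auto simp: invertible_def)
  define C' where "C' = transpose S ** C ** S"
  have "transpose C' = C'" by (simp add: C'_def matrix_transpose_mul C matrix_mul_assoc)
  from symmetric_diagonalization[OF this] obtain V d where
    V: "orthogonal_matrix V" and CV: "C' = transpose V ** dmat d ** V" .
  have VV: "transpose V ** V = mat 1" using V by (auto simp: orthogonal_matrix_def)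
  have SR: "transpose R0 ** transpose S = mat 1" using S by (metis matrix_transpose_mul transpose_mat)
  show thesis
  proof
    show "invertible (V ** R0)"
      using V R0 det_orthogonal_matrix[OF V] by (auto simp: invertible_det_nz det_mul)
    show "A = transpose (V ** R0) ** (V ** R0)"
    proof -
      have "transpose (V ** R0) ** (V ** R0) = transpose R0 ** (transpose V ** V) ** R0"
        by (simp add: matrix_transpose_mul matrix_mul_assoc)
      then show ?thesis by (simp add: VV AR0)
    qed
    have "transpose (V ** R0) ** dmat d ** (V ** R0) = transpose R0 ** C' ** R0"
      by (simp add: CV matrix_transpose_mul matrix_mul_assoc)
    also have "\<dots> = (transpose R0 ** transpose S) ** C ** (S ** R0)"
      by (simp add: C'_def matrix_mul_assoc)
    also have "\<dots> = C" by (simp add: SR S)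
    finally show "C = transpose (V ** R0) ** dmat d ** (V ** R0)" by simp
  qed
qed

lemma pos_def_factor:
  fixes A :: "real ^ 'k ^ 'k"
  assumes "pos_def A"
  obtains R :: "real ^ 'k ^ 'k" where "invertible R" "A = transpose R ** R"
  by (rule simultaneous_diagonalization[OF assms pos_defD(1)[OF assms]]) (rule that)

lemma pos_def_det_pos:
  fixes A :: "real ^ 'k ^ 'k"
  shows "pos_def A \<Longrightarrow> det A > 0"
proof -
  assume "pos_def A"
  then obtain R :: "real ^ 'k ^ 'k" where "invertible R" "A = transpose R ** R" by (rule pos_def_factor)
  then show ?thesis by (simp add: det_mul invertible_det_nz zero_less_mult_iff) linarith
qed

text \<open>Maxima of \<open>det\<close> are found on closed sets that contain singular matrices;
  this recovers definiteness. A vector \<open>v\<close> on which the form vanishes minimizes it, and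
  the first variation in direction \<open>A *v v\<close> forces \<open>A *v v = 0\<close>.\<close>

lemma pos_semidef_det_nonzero_imp_pos_def:
  fixes A :: "real ^ 'k ^ 'k"
  assumes sym: "transpose A = A" and psd: "\<And>v. v \<bullet> (A *v v) \<ge> 0" and "det A \<noteq> 0"
  shows "pos_def A"
  unfolding pos_def_def
proof (intro conjI allI impI sym)
  fix v :: "real ^ 'k" assume v: "v \<noteq> 0"
  have "A *v v \<noteq> 0" using v assms(3)
    by (metis invertible_det_nz invertible_left_inverse matrix_left_invertible_ker)
  show "v \<bullet> (A *v v) > 0"
  proof (rule ccontr)
    assume "\<not> ?thesis"
    with psd[of v] have 0: "v \<bullet> (A *v v) = 0" by simp
    let ?w = "A *v v"
    have "0 \<le> t * (2 * (?w \<bullet> ?w)) + t\<^sup>2 * (?w \<bullet> (A *v ?w))" for t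
      using psd[of "v + t *\<^sub>R ?w"] 0 inner_matrix_vector_symmetric[OF sym, of v ?w]
      by (simp add: matrix_vector_right_distrib matrix_vector_mult_scaleR inner_simps power2_eq_square algebra_simps)
    from nonneg_quadratic_imp_linear_zero[OF this] \<open>A *v v \<noteq> 0\<close> show False by simp
  qed
qed

text \<open>\<open>LEAST\<close> on the reals carries no information until a least eigenvalue is
  exhibited; the value at the Rayleigh minimizer is one.\<close>

lemma lambda_min_attained:
  fixes A :: "real ^ 'k ^ 'k"
  assumes sym: "transpose A = A"
  obtains u where "norm u = 1" "lambda_min A = u \<bullet> (A *v u)"
    "\<And>v. lambda_min A * (norm v)\<^sup>2 \<le> v \<bullet> (A *v v)"
proof -
  have ne: "(UNIV :: (real ^ 'k) set) \<noteq> {0}"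
    by (metis UNIV_I axis_eq_0_iff singletonD zero_neq_one)
  obtain u where u: "norm u = 1" "A *v u = (u \<bullet> (A *v u)) *\<^sub>R u"
    "\<And>v. (u \<bullet> (A *v u)) * (norm v)\<^sup>2 \<le> v \<bullet> (A *v v)"
    using rayleigh_minimizer[OF _ inner_matrix_vector_symmetric[OF sym] subspace_UNIV _ ne] by auto
  have "lambda_min A = u \<bullet> (A *v u)"
    unfolding lambda_min_def
  proof (rule Least_equality)
    show "\<exists>v. v \<noteq> 0 \<and> A *v v = (u \<bullet> (A *v u)) *\<^sub>R v"
      using u by (intro exI[of _ u]) auto
  next
    fix l assume "\<exists>v. v \<noteq> 0 \<and> A *v v = l *\<^sub>R v"
    then obtain v where v: "v \<noteq> 0" "A *v v = l *\<^sub>R v" by blast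
    have "(u \<bullet> (A *v u)) * (norm v)\<^sup>2 \<le> l * (norm v)\<^sup>2"
      using u(3)[of v] v by (simp add: power2_norm_eq_inner)
    then show "u \<bullet> (A *v u) \<le> l" using v by simp
  qed
  with u that show thesis by metis
qed

section \<open>The Frobenius norm\<close>

lemma norm_vec_power2: "(norm (x :: 'a::real_inner ^ 'k))\<^sup>2 = (\<Sum>i\<in>UNIV. (norm (x $ i))\<^sup>2)"
  by (simp add: power2_norm_eq_inner inner_vec_def)

lemma norm_matrix_vector_le:
  fixes A :: "real ^ 'k ^ 'l"
  shows "norm (A *v x) \<le> norm A * norm x"
proof (rule power2_le_imp_le)
  have "(norm (A *v x))\<^sup>2 = (\<Sum>i\<in>UNIV. (A $ i \<bullet> x)\<^sup>2)"
    by (simp add: norm_vec_power2 matrix_vector_mul_component)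
  also have "\<dots> \<le> (\<Sum>i\<in>UNIV. (norm (A $ i))\<^sup>2 * (norm x)\<^sup>2)"
    by (intro sum_mono) (metis Cauchy_Schwarz_ineq power2_norm_eq_inner)
  also have "\<dots> = (norm A * norm x)\<^sup>2"
    by (simp add: norm_vec_power2[of A] power_mult_distrib sum_distrib_right)
  finally show "(norm (A *v x))\<^sup>2 \<le> (norm A * norm x)\<^sup>2" .
qed simp

lemma norm_transpose: "norm (transpose A :: real ^ 'k ^ 'l) = norm A"
proof -
  have "(norm (transpose A))\<^sup>2 = (norm A)\<^sup>2"
    unfolding norm_vec_power2 by (subst sum.swap) (simp add: transpose_def)
  then show ?thesis by (simp add: power2_eq_iff_nonneg)
qed

lemma norm_matrix_mult_le:
  fixes A :: "real ^ 'k ^ 'l" and B :: "real ^ 'j ^ 'k"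
  shows "norm (A ** B) \<le> norm A * norm B"
proof (rule power2_le_imp_le)
  have row: "(A ** B) $ i = transpose B *v (A $ i)" for i
    by (simp add: matrix_matrix_mult_def matrix_vector_mult_def transpose_def vec_eq_iff mult.commute)
  have "(norm (A ** B))\<^sup>2 = (\<Sum>i\<in>UNIV. (norm (transpose B *v (A $ i)))\<^sup>2)"
    by (simp add: norm_vec_power2[of "A ** B"] row)
  also have "\<dots> \<le> (\<Sum>i\<in>UNIV. (norm B * norm (A $ i))\<^sup>2)"
    by (intro sum_mono power_mono) (metis norm_matrix_vector_le norm_transpose, simp)
  also have "\<dots> = (norm A * norm B)\<^sup>2"
    by (simp add: norm_vec_power2[of A] power_mult_distrib sum_distrib_left mult.commute)
  finally show "(norm (A ** B))\<^sup>2 \<le> (norm A * norm B)\<^sup>2" .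
qed simp

lemma abs_quadratic_form_le:
  fixes A :: "real ^ 'k ^ 'k"
  shows "\<bar>v \<bullet> (A *v w)\<bar> \<le> norm A * norm v * norm w"
proof -
  have "\<bar>v \<bullet> (A *v w)\<bar> \<le> norm v * norm (A *v w)" by (rule Cauchy_Schwarz_ineq2)
  also have "\<dots> \<le> norm v * (norm A * norm w)" by (intro mult_left_mono norm_matrix_vector_le) simp
  finally show ?thesis by (simp add: mult_ac)
qed

section \<open>Inverses of positive definite matrices\<close>

lemma invertible_matrix_inv:
  fixes A :: "real ^ 'k ^ 'k"
  assumes "invertible A"
  shows "A ** matrix_inv A = mat 1" "matrix_inv A ** A = mat 1"
  using someI_ex[of "\<lambda>B. A ** B = mat 1 \<and> B ** A = mat 1"] assms
  unfolding matrix_inv_def invertible_def by auto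

lemma matrix_inv_eqI:
  fixes A :: "real ^ 'k ^ 'k"
  assumes "A ** B = mat 1"
  shows "matrix_inv A = B"
proof -
  have "invertible A" using assms by (simp add: invertible_right_inverse) blast
  then have "matrix_inv A ** (A ** B) = B"
    by (simp add: matrix_mul_assoc invertible_matrix_inv)
  then show ?thesis by (simp add: assms)
qed

lemma
  fixes A :: "real ^ 'k ^ 'k"
  assumes A: "pos_def A"
  shows pos_def_mult_matrix_inv: "A *v (matrix_inv A *v v) = v"
    and pos_def_matrix_inv_mult: "matrix_inv A *v (A *v v) = v"
    and pos_def_matrix_inv: "pos_def (matrix_inv A)"
    and det_matrix_inv: "det (matrix_inv A) = 1 / det A"
    and matrix_inv_matrix_inv: "matrix_inv (matrix_inv A) = A"
proof -
  note inv = invertible_matrix_inv[OF pos_def_invertible[OF A]]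
  show 1: "A *v (matrix_inv A *v v) = v" for v by (simp add: matrix_vector_mul_assoc inv)
  show "matrix_inv A *v (A *v v) = v" by (simp add: matrix_vector_mul_assoc inv)
  have "transpose (matrix_inv A) ** A = transpose (A ** matrix_inv A)"
    by (simp add: matrix_transpose_mul pos_defD(1)[OF A])
  then have "(transpose (matrix_inv A) ** A) ** matrix_inv A = matrix_inv A" by (simp add: inv)
  then have sym: "transpose (matrix_inv A) = matrix_inv A"
    by (simp only: matrix_mul_assoc[symmetric] inv matrix_mul_rid)
  show "pos_def (matrix_inv A)" unfolding pos_def_def
  proof (intro conjI allI impI sym)
    fix v :: "real ^ 'k" assume "v \<noteq> 0"
    then have "matrix_inv A *v v \<noteq> 0" using 1[of v] by auto
    from pos_defD(2)[OF A this] show "v \<bullet> (matrix_inv A *v v) > 0"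
      by (simp add: 1 inner_commute)
  qed
  have "det A * det (matrix_inv A) = 1" by (metis det_mul inv(1) det_I)
  then show "det (matrix_inv A) = 1 / det A" using pos_def_det_pos[OF A] by (simp add: field_simps)
  show "matrix_inv (matrix_inv A) = A" using inv by (intro matrix_inv_eqI)
qed

lemma transpose_outer [simp]: "transpose (outer u u) = outer u u"
  by (simp add: outer_def transpose_def vec_eq_iff mult.commute)

lemma outer_mult_vector: "outer u w *v v = (w \<bullet> v) *\<^sub>R u"
  by (simp add: outer_def matrix_vector_mult_def vec_eq_iff inner_vec_def sum_distrib_left mult_ac)

lemma pos_def_scaleR: "pos_def A \<Longrightarrow> r > 0 \<Longrightarrow> pos_def (r *\<^sub>R A)"
  by (auto simp: pos_def_def transpose_scalar scaleR_matrix_vector_assoc[symmetric])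

lemma transpose_add: "transpose (A + B) = transpose A + transpose (B :: real ^ 'k ^ 'l)"
  by (simp add: transpose_def vec_eq_iff)

lemma det_scaleR: "det (r *\<^sub>R A :: real ^ 'k ^ 'k) = r ^ CARD('k) * det A"
proof -
  have "r *\<^sub>R A = dmat (\<lambda>_. r) ** A"
    by (simp add: matrix_eq scaleR_matrix_vector_assoc[symmetric] matrix_vector_mul_assoc[symmetric] dmat_mult_vector vec_eq_iff)
  then show ?thesis by (simp add: det_mul det_dmat)
qed

section \<open>Block matrices\<close>

lemma sum_UNIV_plus_unit: "(\<Sum>k\<in>(UNIV :: ('n::finite + unit) set). f k) = (\<Sum>i\<in>UNIV. f (Inl i)) + f (Inr ())"
  by (simp add: UNIV_Plus_UNIV[symmetric] sum.Plus UNIV_unit del: UNIV_Plus_UNIV)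

lemma prod_UNIV_plus_unit: "(\<Prod>k\<in>(UNIV :: ('n::finite + unit) set). f k) = (\<Prod>i\<in>UNIV. f (Inl i)) * f (Inr ())"
  by (simp add: UNIV_Plus_UNIV[symmetric] prod.Plus UNIV_unit del: UNIV_Plus_UNIV)

definition lvec :: "real ^ 'n \<Rightarrow> real \<Rightarrow> real ^ ('n + unit)" where
  "lvec v t = (\<chi> k. case k of Inl j \<Rightarrow> v $ j | Inr _ \<Rightarrow> t)"

text \<open>The off-diagonal blocks are independent, so that triangular shears have the same form as
  symmetric lifted matrices.\<close>

definition blkm :: "real ^ 'n ^ 'n \<Rightarrow> real ^ 'n \<Rightarrow> real ^ 'n \<Rightarrow> real \<Rightarrow> 'n::finite lmat" where
  "blkm G z y s = (\<chi> p q. case p of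
      Inl i \<Rightarrow> (case q of Inl j \<Rightarrow> G $ i $ j | Inr _ \<Rightarrow> z $ i)
    | Inr _ \<Rightarrow> (case q of Inl j \<Rightarrow> y $ j | Inr _ \<Rightarrow> s))"

lemma forall_plus_unit: "(\<forall>k :: 'n + unit. P k) \<longleftrightarrow> (\<forall>i. P (Inl i)) \<and> P (Inr ())"
  by (metis old.sum.exhaust unit.exhaust)

lemma lvec_exhaust: obtains v t where "x = lvec v t"
proof
  show "x = lvec (\<chi> i. x $ Inl i) (x $ Inr ())"
    by (simp add: lvec_def vec_eq_iff forall_plus_unit)
qed

lemma lvec_eq_iff [simp]: "lvec v t = lvec w u \<longleftrightarrow> v = w \<and> t = u"
  by (simp add: lvec_def vec_eq_iff forall_plus_unit)

lemma lvec_zero: "lvec 0 0 = 0"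
  by (simp add: lvec_def vec_eq_iff forall_plus_unit)

lemma lvec_eq_0_iff [simp]: "lvec v t = 0 \<longleftrightarrow> v = 0 \<and> t = 0"
  by (metis lvec_eq_iff lvec_zero)

lemma inner_lvec [simp]: "lvec v t \<bullet> lvec w u = v \<bullet> w + t * u"
  by (simp add: lvec_def inner_vec_def sum_UNIV_plus_unit)

lemma blkm_mult_lvec [simp]:
  "blkm G z y s *v lvec v t = lvec (G *v v + t *\<^sub>R z) (y \<bullet> v + s * t)"
  by (simp add: lvec_def blkm_def vec_eq_iff forall_plus_unit matrix_vector_mult_def
      sum_UNIV_plus_unit inner_vec_def mult.commute)

lemma blk_blkm [simp]:
  "blk_G (blkm G z y s) = G" "blk_z (blkm G z y s) = z" "blk_s (blkm G z y s) = s"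
  by (simp_all add: blk_G_def blk_z_def blk_s_def blkm_def vec_eq_iff)

lemma symmetric_eq_blkm:
  assumes "transpose Q = Q"
  shows "Q = blkm (blk_G Q) (blk_z Q) (blk_z Q) (blk_s Q)"
proof -
  have "Q $ p $ q = Q $ q $ p" for p q
    using arg_cong[OF assms, of "\<lambda>A. A $ p $ q"] by (simp add: transpose_def)
  then show ?thesis
    by (simp add: blk_G_def blk_z_def blk_s_def blkm_def vec_eq_iff forall_plus_unit)
qed

lemma transpose_blkm [simp]: "transpose (blkm G z y s) = blkm (transpose G) y z s"
  by (simp add: blkm_def transpose_def vec_eq_iff forall_plus_unit)

text \<open>Block identities are checked on vectors \<open>lvec v t\<close>, which spares a formula
  for products of block matrices.\<close>

lemma lmat_eqI:
  fixes A B :: "'n::finite lmat"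
  assumes "\<And>v t. A *v lvec v t = B *v lvec v t"
  shows "A = B"
  unfolding matrix_eq by (metis assms lvec_exhaust)

text \<open>Diagonalizing \<open>G\<close> reduces the claim to diagonal matrices, whose determinant
  over the sum type is a plain product, in place of an expansion over permutations.\<close>

lemma det_blkm_diag:
  assumes "transpose G = G"
  shows "det (blkm G 0 0 s) = s * det G"
proof -
  obtain U d where U: "orthogonal_matrix U" and G: "G = transpose U ** dmat d ** U"
    using symmetric_diagonalization[OF assms] .
  have UU: "transpose U ** U = mat 1" using U by (simp add: orthogonal_matrix)
  have "blkm G 0 0 s = transpose (blkm U 0 0 1) ** blkm (dmat d) 0 0 s ** blkm U 0 0 1"
    by (intro lmat_eqI) (simp add: matrix_vector_mul_assoc[symmetric] G)
  then have "det (blkm G 0 0 s) = det (transpose (blkm U 0 0 1) ** blkm U 0 0 1) * det (blkm (dmat d) 0 0 s)"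
    by (simp add: det_mul del: transpose_blkm)
  also have "transpose (blkm U 0 0 1) ** blkm U 0 0 1 = mat 1"
    by (intro lmat_eqI) (simp add: matrix_vector_mul_assoc[symmetric], simp add: matrix_vector_mul_assoc UU)
  also have "blkm (dmat d) 0 0 s = dmat (case_sum d (\<lambda>_. s))"
    by (simp add: dmat_def blkm_def vec_eq_iff forall_plus_unit)
  finally have "det (blkm G 0 0 s) = s * prod d UNIV"
    by (simp add: det_dmat prod_UNIV_plus_unit)
  moreover have "det G = det (transpose U ** U) * prod d UNIV"
    by (simp add: G det_mul det_dmat)
  ultimately show ?thesis by (simp add: UU)
qed

text \<open>The reflection \<open>?S\<close> conjugates the shear by \<open>w\<close> into the shear
  by \<open>- w\<close>, its inverse, so the two determinants agree and multiply to 1. The square is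
  the useful quantity because shears enter together with their transposes.\<close>

lemma det_shear_square: "det (blkm (mat 1) 0 w 1) * det (blkm (mat 1) 0 w 1) = 1"
proof -
  let ?S = "blkm (mat 1) 0 0 (-1) :: 'a lmat" and ?L = "\<lambda>w. blkm (mat 1) 0 w 1 :: 'a lmat"
  have "?S ** ?S = mat 1" "?L w ** ?L (- w) = mat 1" "?L (- w) = ?S ** ?L w ** ?S"
    by (intro lmat_eqI; simp add: matrix_vector_mul_assoc[symmetric])+
  then have "det ?S * det ?S = 1" "det (?L w) * det (?L (- w)) = 1"
    "det (?L (- w)) = (det ?S * det ?S) * det (?L w)"
    by (metis det_I det_mul, metis det_I det_mul, simp add: det_mul mult_ac)
  then show ?thesis by simp
qed

text \<open>With the off-diagonal block written as \<open>G *v w\<close>, block elimination is a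
  shear by \<open>w\<close> and its transpose around a block diagonal matrix, and no inverse of
  \<open>G\<close> appears.\<close>

lemma det_blkm_schur:
  assumes "transpose G = G"
  shows "det (blkm G (G *v w) (G *v w) s) = (s - w \<bullet> (G *v w)) * det G"
proof -
  let ?L = "blkm (mat 1) 0 w 1"
  have "blkm G (G *v w) (G *v w) s = ?L ** blkm G 0 0 (s - w \<bullet> (G *v w)) ** transpose ?L"
    by (intro lmat_eqI)
      (simp add: matrix_vector_mul_assoc[symmetric] matrix_vector_right_distrib
        matrix_vector_mult_scaleR inner_simps inner_matrix_vector_symmetric[OF assms] algebra_simps)
  then have "det (blkm G (G *v w) (G *v w) s)
      = (det ?L * det ?L) * det (blkm G 0 0 (s - w \<bullet> (G *v w)))"
    by (simp add: det_mul del: transpose_blkm)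
  then show ?thesis by (simp add: det_shear_square det_blkm_diag assms)
qed

text \<open>Both sides come from one block determinant with corner \<open>s = - 1 / r\<close>:
  eliminating the block \<open>A\<close> leaves the Schur complement \<open>s - w . A w\<close>,
  eliminating the corner leaves the updated matrix.\<close>

lemma det_rank_one_update:
  assumes A: "transpose A = A"
  shows "det (A + r *\<^sub>R outer (A *v w) (A *v w)) = (1 + r * (w \<bullet> (A *v w))) * det A"
proof (cases "r = 0")
  case False
  define s where "s = - 1 / r"
  define u where "u = (1 / s) *\<^sub>R (A *v w)"
  let ?M = "A + r *\<^sub>R outer (A *v w) (A *v w)" and ?L = "blkm (mat 1) 0 u 1"
  have s: "s \<noteq> 0" "r * s = - 1" using False by (auto simp: s_def)
  have r: "r = - 1 / s" using s by (simp add: s_def)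
  have "blkm A (A *v w) (A *v w) s = transpose ?L ** blkm ?M 0 0 s ** ?L"
    by (intro lmat_eqI) (use s in \<open>simp add: matrix_vector_mul_assoc[symmetric] r
        matrix_vector_mult_add_rdistrib scaleR_matrix_vector_assoc[symmetric] outer_mult_vector u_def
        algebra_simps\<close>)
  then have "det (blkm A (A *v w) (A *v w) s) = (det ?L * det ?L) * det (blkm ?M 0 0 s)"
    by (simp add: det_mul del: transpose_blkm)
  also have "\<dots> = s * det ?M"
    by (simp add: det_shear_square det_blkm_diag transpose_add transpose_scalar A)
  finally have "s * det ?M = (s - w \<bullet> (A *v w)) * det A" by (simp add: det_blkm_schur A)
  then have "det ?M = (s - w \<bullet> (A *v w)) / s * det A" using s by (simp add: field_simps)
  also have "(s - w \<bullet> (A *v w)) / s = 1 + r * (w \<bullet> (A *v w))" unfolding r using s(1) by (simp add: field_simps)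
  finally show ?thesis .
qed simp

lemma blkm_quadratic:
  "lvec v t \<bullet> (blkm G z z s *v lvec v t) = v \<bullet> (G *v v) + 2 * t * (z \<bullet> v) + s * t\<^sup>2"
  by (simp add: inner_simps inner_commute power2_eq_square algebra_simps)

lemma pos_def_blkm_iff:
  "pos_def (blkm G (G *v w) (G *v w) s) \<longleftrightarrow> pos_def G \<and> w \<bullet> (G *v w) < s"
proof
  assume Q: "pos_def (blkm G (G *v w) (G *v w) s)"
  have "transpose G = G"
    using arg_cong[OF pos_defD(1)[OF Q], of blk_G] by simp
  moreover have "v \<bullet> (G *v v) > 0" if "v \<noteq> 0" for v
    using pos_defD(2)[OF Q, of "lvec v 0"] that by (simp add: blkm_quadratic del: blkm_mult_lvec)
  ultimately have G: "pos_def G" by (simp add: pos_def_def)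
  moreover have "w \<bullet> (G *v w) < s"
    using pos_defD(2)[OF Q, of "lvec (- w) 1"]
    by (simp add: blkm_quadratic del: blkm_mult_lvec)
       (simp add: linear_neg[OF matrix_vector_mul_linear] inner_commute)
  ultimately show "pos_def G \<and> w \<bullet> (G *v w) < s" ..
next
  assume *: "pos_def G \<and> w \<bullet> (G *v w) < s"
  then have sym: "transpose G = G" by (simp add: pos_def_def)
  show "pos_def (blkm G (G *v w) (G *v w) s)"
    unfolding pos_def_def
  proof (intro conjI allI impI)
    show "transpose (blkm G (G *v w) (G *v w) s) = blkm G (G *v w) (G *v w) s" by (simp add: sym)
    fix x :: "real ^ ('a + unit)" assume "x \<noteq> 0"
    obtain v t where x: "x = lvec v t" by (rule lvec_exhaust)
    \<comment> \<open>Completing the square in \<open>v + t *\<^sub>R w\<close>.\<close>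
    have eq: "x \<bullet> (blkm G (G *v w) (G *v w) s *v x)
        = (v + t *\<^sub>R w) \<bullet> (G *v (v + t *\<^sub>R w)) + (s - w \<bullet> (G *v w)) * t\<^sup>2"
      unfolding x blkm_quadratic
      using inner_matrix_vector_symmetric[OF sym, of v w]
      by (simp add: matrix_vector_right_distrib matrix_vector_mult_scaleR inner_simps inner_commute
          power2_eq_square algebra_simps)
    show "x \<bullet> (blkm G (G *v w) (G *v w) s *v x) > 0"
    proof (cases "t = 0")
      case True
      then have "v \<noteq> 0" using \<open>x \<noteq> 0\<close> x by simp
      then show ?thesis unfolding eq using True * by (simp add: pos_def_def)
    next
      case False
      then have "(s - w \<bullet> (G *v w)) * t\<^sup>2 > 0" using * by simp
      then show ?thesis unfolding eq using * pos_defD(3)[of G] by (smt (verit))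
    qed
  qed
qed

section \<open>Ellipsoids\<close>

lemma ellipsoid_factor_norm:
  fixes R :: "real ^ 'k ^ 'k"
  shows "y \<in> ellipsoid c (transpose R ** R) \<longleftrightarrow> norm (R *v (y - c)) \<le> 1"
proof -
  have "(y - c) \<bullet> ((transpose R ** R) *v (y - c)) = (norm (R *v (y - c)))\<^sup>2"
    by (simp only: matrix_vector_mul_assoc[symmetric] inner_matrix_vector_transpose[symmetric] power2_norm_eq_inner)
  then show ?thesis by (simp add: ellipsoid_def power_le_one_iff)
qed

lemma convex_ellipsoid:
  fixes E :: "real ^ 'k ^ 'k"
  shows "pos_def E \<Longrightarrow> convex (ellipsoid c E)"
proof -
  assume "pos_def E"
  then obtain R :: "real ^ 'k ^ 'k" where "invertible R" and R: "E = transpose R ** R" by (rule pos_def_factor)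
  have "ellipsoid c E = (\<lambda>y. R *v y) -` cball (R *v c) 1"
    by (auto simp: R ellipsoid_factor_norm matrix_vector_mult_diff_distrib dist_norm norm_minus_commute)
  then show ?thesis by (simp add: convex_linear_vimage)
qed

lemma closed_ellipsoid: "closed (ellipsoid c E)"
  unfolding ellipsoid_def
  by (intro closed_Collect_le continuous_intros linear_continuous_on_compose[OF _ matrix_vector_mul_linear])

lemma pos_def_quadratic_form_inject:
  fixes A B :: "real ^ 'k ^ 'k"
  assumes A: "transpose A = A" and B: "transpose B = B" and eq: "\<And>v. v \<bullet> (A *v v) = v \<bullet> (B *v v)"
  shows "A = B"
proof -
  have bil: "v \<bullet> (A *v w) = v \<bullet> (B *v w)" for v w
    using eq[of "v + w"] eq[of v] eq[of w]
      inner_matrix_vector_symmetric[OF A, of v w] inner_matrix_vector_symmetric[OF B, of v w]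
    by (simp add: matrix_vector_right_distrib inner_simps inner_commute)
  then have "A *v w = B *v w" for w by (metis vector_eq_rdot inner_commute)
  then show ?thesis by (simp add: matrix_eq)
qed

text \<open>The point reflections in both centers preserve the common set; if the centers differed,
  alternating them would translate by \<open>2 *\<^sub>R (c - d)\<close> beyond any bound. Once the
  centers agree, homogeneity recovers the form from its unit sublevel set.\<close>

lemma ellipsoid_inject:
  assumes A: "pos_def A" and B: "pos_def B" and eq: "ellipsoid c A = ellipsoid d B"
  shows "c = d \<and> A = B"
proof
  have refl_in: "2 *\<^sub>R c - y \<in> ellipsoid c A" if "y \<in> ellipsoid c A" for y c A
  proof -
    have *: "2 *\<^sub>R c - y - c = - (y - c)" by (simp add: algebra_simps scaleR_2)
    show ?thesis using that
      by (simp only: ellipsoid_def mem_Collect_eq * linear_neg[OF matrix_vector_mul_linear]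
          inner_minus_left inner_minus_right minus_minus)
  qed
  have "d + (2 * real n) *\<^sub>R (c - d) \<in> ellipsoid d B" for n
  proof (induction n)
    case 0
    show ?case by (simp add: ellipsoid_def)
  next
    case (Suc n)
    from refl_in[OF this] have "2 *\<^sub>R d - (d + (2 * real n) *\<^sub>R (c - d)) \<in> ellipsoid c A" by (simp add: eq)
    from refl_in[OF this] have "2 *\<^sub>R c - (2 *\<^sub>R d - (d + (2 * real n) *\<^sub>R (c - d))) \<in> ellipsoid d B" by (simp add: eq)
    then show ?case by (simp add: algebra_simps scaleR_2)
  qed
  then have *: "(2 * real n)\<^sup>2 * ((c - d) \<bullet> (B *v (c - d))) \<le> 1" for n
    by (simp add: ellipsoid_def matrix_vector_mult_scaleR power2_eq_square mult_ac)
  show cd: "c = d"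
  proof (rule ccontr)
    assume "c \<noteq> d"
    then have pos: "(c - d) \<bullet> (B *v (c - d)) > 0" using B by (simp add: pos_def_def)
    then obtain n :: nat where n: "1 < real n * ((c - d) \<bullet> (B *v (c - d)))"
      using reals_Archimedean3 by blast
    have "real n \<le> real n * real n" by (cases n) auto
    then have "real n \<le> (2 * real n)\<^sup>2" by (simp add: power2_eq_square)
    then have "real n * ((c - d) \<bullet> (B *v (c - d))) \<le> (2 * real n)\<^sup>2 * ((c - d) \<bullet> (B *v (c - d)))"
      using pos by (intro mult_right_mono) auto
    with n *[of n] show False by linarith
  qed
  have iff: "v \<bullet> (A *v v) \<le> 1 \<longleftrightarrow> v \<bullet> (B *v v) \<le> 1" for v
    using eqset_imp_iff[OF eq, of "c + v"] by (simp add: ellipsoid_def cd)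
  have le: "v \<bullet> (B *v v) \<le> v \<bullet> (A *v v)"
    if A: "pos_def A" and iff: "\<And>v. v \<bullet> (A *v v) \<le> 1 \<longleftrightarrow> v \<bullet> (B *v v) \<le> 1" for A B :: "real ^ 'a ^ 'a" and v
  proof (cases "v = 0")
    case False
    define r where "r = v \<bullet> (A *v v)"
    have r: "r > 0" using False A by (simp add: r_def pos_def_def)
    have sc: "((1 / sqrt r) *\<^sub>R v) \<bullet> (C *v ((1 / sqrt r) *\<^sub>R v)) = (v \<bullet> (C *v v)) / r" for C :: "real ^ 'a ^ 'a"
      using r by (simp add: matrix_vector_mult_scaleR)
    have "(v \<bullet> (B *v v)) / r \<le> 1" using iff[of "(1 / sqrt r) *\<^sub>R v"] r unfolding sc by (simp add: r_def)
    then show ?thesis using r by (simp add: r_def)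
  qed simp
  show "A = B"
  proof (rule pos_def_quadratic_form_inject[OF pos_defD(1)[OF A] pos_defD(1)[OF B]])
    fix v
    show "v \<bullet> (A *v v) = v \<bullet> (B *v v)"
      using le[OF A iff, of v] le[OF B iff[symmetric], of v] by (rule antisym[rotated])
  qed
qed

lemma Vol_ellipsoid: "pos_def E \<Longrightarrow> Vol (ellipsoid c E) = det E powr (- 1 / 2)"
  unfolding Vol_def by (rule the_equality) (auto dest: ellipsoid_inject)

lemma ell_center_ellipsoid: "pos_def E \<Longrightarrow> ell_center (ellipsoid c E) = c"
  unfolding ell_center_def by (rule the_equality) (auto dest: ellipsoid_inject)

lemma ln_Vol_ellipsoid: "pos_def E \<Longrightarrow> ln (Vol (ellipsoid c E)) = - ln (det E) / 2"
  using pos_def_det_pos[of E] by (simp add: Vol_ellipsoid ln_powr)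

text \<open>Cauchy-Schwarz for the inner product defined by \<open>E\<close>, with \<open>b\<close>
  written as \<open>E *v u\<close>.\<close>

lemma pos_def_Cauchy_Schwarz:
  fixes E :: "real ^ 'k ^ 'k"
  assumes E: "pos_def E"
  shows "(b \<bullet> w)\<^sup>2 \<le> (b \<bullet> (matrix_inv E *v b)) * (w \<bullet> (E *v w))"
proof -
  obtain R :: "real ^ 'k ^ 'k" where R: "invertible R" "E = transpose R ** R" using E by (rule pos_def_factor)
  define u where "u = matrix_inv E *v b"
  have b: "b = E *v u" by (simp add: u_def pos_def_mult_matrix_inv[OF E])
  have form: "x \<bullet> (E *v y) = (R *v x) \<bullet> (R *v y)" for x y
    by (simp only: R(2) matrix_vector_mul_assoc[symmetric] inner_matrix_vector_transpose[symmetric])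
  have "(b \<bullet> w)\<^sup>2 = ((R *v w) \<bullet> (R *v u))\<^sup>2" by (simp only: b inner_commute[of "E *v u"] form)
  also have "\<dots> \<le> ((R *v w) \<bullet> (R *v w)) * ((R *v u) \<bullet> (R *v u))" by (rule Cauchy_Schwarz_ineq)
  also have "\<dots> = (b \<bullet> u) * (w \<bullet> (E *v w))"
    by (simp only: b inner_commute[of "E *v u"] form mult.commute)
  finally show ?thesis by (simp only: u_def)
qed

text \<open>The left-hand side of the inequality is the support function of the ellipsoid in
  direction \<open>a i\<close>.\<close>

lemma ellipsoid_subset_hpoly_iff:
  assumes E: "pos_def E"
  shows "ellipsoid c E \<subseteq> hpoly a \<longleftrightarrow> (\<forall>i. a i \<bullet> c + sqrt (a i \<bullet> (matrix_inv E *v a i)) \<le> 1)"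
proof
  assume sub: "ellipsoid c E \<subseteq> hpoly a"
  show "\<forall>i. a i \<bullet> c + sqrt (a i \<bullet> (matrix_inv E *v a i)) \<le> 1"
  proof
    fix i
    define r where "r = a i \<bullet> (matrix_inv E *v a i)"
    have r: "r \<ge> 0" unfolding r_def by (rule pos_defD(3)[OF pos_def_matrix_inv[OF E]])
    \<comment> \<open>The point of the ellipsoid where \<open>a i\<close> is largest. If
      \<open>a i = 0\<close>, then \<open>r = 0\<close>, and \<open>1 / 0 = 0\<close> makes
      \<open>y\<close> the center.\<close>
    define y where "y = c + (1 / sqrt r) *\<^sub>R (matrix_inv E *v a i)"
    have "y \<in> ellipsoid c E"
      using r by (auto simp: ellipsoid_def y_def matrix_vector_mult_scaleR pos_def_mult_matrix_inv[OF E]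
          inner_commute r_def[symmetric])
    with sub have "a i \<bullet> y \<le> 1" by (auto simp: hpoly_def)
    moreover have "a i \<bullet> y = a i \<bullet> c + sqrt r"
      using r by (simp add: y_def inner_simps r_def[symmetric] real_div_sqrt)
    ultimately show "a i \<bullet> c + sqrt (a i \<bullet> (matrix_inv E *v a i)) \<le> 1" by (simp add: r_def)
  qed
next
  assume le: "\<forall>i. a i \<bullet> c + sqrt (a i \<bullet> (matrix_inv E *v a i)) \<le> 1"
  show "ellipsoid c E \<subseteq> hpoly a"
    unfolding hpoly_def
  proof (intro subsetI CollectI allI)
    fix y i assume y: "y \<in> ellipsoid c E"
    have "(a i \<bullet> (y - c))\<^sup>2 \<le> (a i \<bullet> (matrix_inv E *v a i)) * ((y - c) \<bullet> (E *v (y - c)))"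
      by (rule pos_def_Cauchy_Schwarz[OF E])
    also have "\<dots> \<le> (a i \<bullet> (matrix_inv E *v a i)) * 1"
      using y by (intro mult_left_mono pos_defD(3)[OF pos_def_matrix_inv[OF E]]) (simp add: ellipsoid_def)
    finally have "a i \<bullet> (y - c) \<le> sqrt (a i \<bullet> (matrix_inv E *v a i))"
      using real_le_rsqrt by auto
    with le[rule_format, of i] show "a i \<bullet> y \<le> 1" by (simp add: inner_simps)
  qed
qed

section \<open>The polytope\<close>

lemma interior_hpoly: "interior (hpoly a) = {x. \<forall>i. a i \<bullet> x < 1}"
proof
  have "{x. \<forall>i. a i \<bullet> x < 1} = (\<Inter>i. {x. a i \<bullet> x < 1})" by auto
  moreover have "open (\<Inter>i. {x. a i \<bullet> x < 1})"
    by (intro open_INT ballI open_Collect_less continuous_intros) simp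
  ultimately show "{x. \<forall>i. a i \<bullet> x < 1} \<subseteq> interior (hpoly a)"
    by (intro interior_maximal) (auto simp: hpoly_def intro: less_imp_le)
  show "interior (hpoly a) \<subseteq> {x. \<forall>i. a i \<bullet> x < 1}"
  proof (intro subsetI CollectI allI)
    fix x i assume "x \<in> interior (hpoly a)"
    then obtain e where e: "e > 0" "ball x e \<subseteq> hpoly a" by (auto simp: mem_interior)
    show "a i \<bullet> x < 1"
    proof (cases "a i = 0")
      case False
      define d where "d = e / (2 * norm (a i))"
      have d: "d > 0" using e False by (simp add: d_def)
      have "x + d *\<^sub>R a i \<in> ball x e" using e False by (simp add: dist_norm d_def)
      with e have "a i \<bullet> (x + d *\<^sub>R a i) \<le> 1" by (auto simp: hpoly_def)
      moreover have "d * (a i \<bullet> a i) > 0" using d False by simp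
      ultimately show ?thesis by (simp add: inner_simps)
    qed simp
  qed
qed

text \<open>The origin is feasible, so a direction along which no constraint grows carries a whole
  ray inside the bounded polytope.\<close>

lemma bounded_hpoly_recession:
  assumes bd: "bounded (hpoly a)" and w: "\<And>i. a i \<bullet> w \<le> 0"
  shows "w = 0"
proof (rule ccontr)
  assume "w \<noteq> 0"
  obtain B where B: "\<And>x. x \<in> hpoly a \<Longrightarrow> norm x \<le> B" using bd by (auto simp: bounded_iff)
  have "r *\<^sub>R w \<in> hpoly a" if "r \<ge> 0" for r
    using w that by (auto simp: hpoly_def intro: order_trans[OF mult_nonneg_nonpos])
  from B[OF this, of "(\<bar>B\<bar> + 1) / norm w"] \<open>w \<noteq> 0\<close> show False by simp
qed

lemma a_tilde_inner:
  "x \<in> interior (hpoly a) \<Longrightarrow> (a_tilde a x i \<bullet> w \<le> r) \<longleftrightarrow> a i \<bullet> w \<le> r * (1 - a i \<bullet> x)"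
  by (auto simp: interior_hpoly a_tilde_def pos_divide_le_eq)

text \<open>The polar about \<open>x\<close> is the convex hull of the points
  \<open>a_tilde a x i\<close>. The hull itself is avoided: a hyperplane separating a point
  \<open>p\<close> of the polar from \<open>T\<close> yields a point of the polytope that
  contradicts polarity of \<open>p\<close>.\<close>

lemma polar_subset_iff:
  assumes bd: "bounded (hpoly a)" and x: "x \<in> interior (hpoly a)" and T: "closed T" "convex T"
  shows "polar_set ((\<lambda>p. p - x) ` hpoly a) \<subseteq> T \<longleftrightarrow> (\<forall>i. a_tilde a x i \<in> T)"
proof
  assume "polar_set ((\<lambda>p. p - x) ` hpoly a) \<subseteq> T"
  moreover have "a_tilde a x i \<in> polar_set ((\<lambda>p. p - x) ` hpoly a)" for i
    unfolding polar_set_def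
  proof (intro CollectI ballI)
    fix s assume "s \<in> (\<lambda>p. p - x) ` hpoly a"
    then obtain p where "p \<in> hpoly a" "s = p - x" by blast
    then show "a_tilde a x i \<bullet> s \<le> 1"
      unfolding a_tilde_inner[OF x] by (simp add: hpoly_def inner_diff_right)
  qed
  ultimately show "\<forall>i. a_tilde a x i \<in> T" by blast
next
  assume at: "\<forall>i. a_tilde a x i \<in> T"
  show "polar_set ((\<lambda>p. p - x) ` hpoly a) \<subseteq> T"
  proof (rule subsetI, rule ccontr)
    fix p assume p: "p \<in> polar_set ((\<lambda>p. p - x) ` hpoly a)" and "p \<notin> T"
    then obtain w b where wb: "w \<bullet> p < b" "\<And>y. y \<in> T \<Longrightarrow> b < w \<bullet> y"
      using separating_hyperplane_closed_point[OF T(2,1)] by blast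
    have at': "a i \<bullet> w > b * (1 - a i \<bullet> x)" for i
      using wb(2)[of "a_tilde a x i"] at a_tilde_inner[OF x, of i w b] by (auto simp: inner_commute)
    have px: "1 - a i \<bullet> x > 0" for i using x by (simp add: interior_hpoly)
    have "w \<noteq> 0" using wb(1) wb(2) at by (metis inner_zero_left less_asym)
    \<comment> \<open>Otherwise \<open>- w\<close> would be a recession direction. The negative sign
      makes \<open>x + (1 / b) *\<^sub>R w\<close> feasible below.\<close>
    have "b < 0"
    proof (rule ccontr)
      assume "\<not> b < 0"
      then have "a i \<bullet> (- w) \<le> 0" for i using at'[of i] px[of i]
        by (smt (verit) inner_minus_right mult_nonneg_nonneg)
      from bounded_hpoly_recession[OF bd this] \<open>w \<noteq> 0\<close> show False by simp
    qed
    have "x + (1 / b) *\<^sub>R w \<in> hpoly a"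
      unfolding hpoly_def
    proof (intro CollectI allI)
      fix i
      have "(a i \<bullet> w) / b \<le> 1 - a i \<bullet> x" using at'[of i] \<open>b < 0\<close> by (simp add: neg_divide_le_eq mult.commute)
      then show "a i \<bullet> (x + (1 / b) *\<^sub>R w) \<le> 1" by (simp add: inner_simps)
    qed
    then have "p \<bullet> (x + (1 / b) *\<^sub>R w - x) \<le> 1" using p unfolding polar_set_def by blast
    then have "(w \<bullet> p) / b \<le> 1" by (simp add: inner_commute)
    then show False using wb(1) \<open>b < 0\<close> by (simp add: neg_divide_le_eq)
  qed
qed

section \<open>Determinant maximization\<close>

lemma pos_semidef_factor:
  fixes A :: "real ^ 'k ^ 'k"
  assumes sym: "transpose A = A" and psd: "\<And>v. v \<bullet> (A *v v) \<ge> 0"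
  obtains R :: "real ^ 'k ^ 'k" where "A = transpose R ** R"
proof -
  obtain U :: "real ^ 'k ^ 'k" and a where U: "orthogonal_matrix U" and AU: "A = transpose U ** dmat a ** U"
    using symmetric_diagonalization[OF sym] .
  have UU: "U ** transpose U = mat 1" using U by (auto simp: orthogonal_matrix_def)
  have a: "a i \<ge> 0" for i
  proof -
    let ?v = "transpose U *v axis i 1"
    have Uv: "U *v ?v = axis i 1" by (simp add: matrix_vector_mul_assoc UU)
    have "0 \<le> ?v \<bullet> (A *v ?v)" by (rule psd)
    also have "A *v ?v = transpose U *v (dmat a *v axis i 1)"
      by (simp only: AU matrix_vector_mul_assoc[symmetric] Uv)
    also have "?v \<bullet> \<dots> = axis i 1 \<bullet> (dmat a *v axis i 1)"
      by (simp only: inner_matrix_vector_transpose[symmetric] Uv)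
    also have "\<dots> = a i" by (simp add: dmat_mult_vector inner_axis')
    finally show ?thesis .
  qed
  let ?D = "dmat (\<lambda>i. sqrt (a i))"
  have "transpose (?D ** U) ** (?D ** U) = transpose U ** (?D ** ?D) ** U"
    by (simp add: matrix_transpose_mul matrix_mul_assoc)
  also have "\<dots> = A" using a by (simp add: dmat_mult AU)
  finally show thesis using that[of "?D ** U"] by simp
qed

lemma quadratic_form_factor:
  fixes R :: "real ^ 'k ^ 'l"
  shows "v \<bullet> ((transpose R ** R) *v v) = (norm (R *v v))\<^sup>2"
  by (simp only: matrix_vector_mul_assoc[symmetric] inner_matrix_vector_transpose[symmetric] power2_norm_eq_inner)

text \<open>The lower bound on the Gram form is applied to every row of \<open>R\<close>; summed
  over the rows, the right-hand sides regroup into the quantities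
  \<open>(norm (R *v h i))\<^sup>2\<close>, one for each of the \<open>m\<close>
  constraints.\<close>

lemma norm_factor_bound:
  fixes R :: "real ^ 'k ^ 'k" and h :: "'m::finite \<Rightarrow> real ^ 'k"
  assumes h: "\<And>v. l * (norm v)\<^sup>2 \<le> (\<Sum>i\<in>UNIV. (h i \<bullet> v)\<^sup>2)"
    and R: "\<And>i. norm (R *v h i) \<le> 1"
  shows "l * (norm R)\<^sup>2 \<le> real CARD('m)"
proof -
  have "l * (norm R)\<^sup>2 = (\<Sum>j\<in>UNIV. l * (norm (R $ j))\<^sup>2)"
    by (simp add: norm_vec_power2[of R] sum_distrib_left)
  also have "\<dots> \<le> (\<Sum>j\<in>UNIV. \<Sum>i\<in>UNIV. (h i \<bullet> R $ j)\<^sup>2)" by (intro sum_mono h)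
  also have "\<dots> = (\<Sum>i\<in>UNIV. (norm (R *v h i))\<^sup>2)"
    by (subst sum.swap) (simp add: norm_vec_power2 matrix_vector_mul_component inner_commute)
  also have "\<dots> \<le> (\<Sum>i\<in>(UNIV::'m set). 1)" by (intro sum_mono) (simp add: R power_le_one_iff)
  finally show ?thesis by simp
qed

text \<open>Stated for semidefinite \<open>Q\<close>, since it also has to bound the closed sets on
  which determinants are maximized.\<close>

lemma feasible_norm_bound:
  fixes Q :: "real ^ 'k ^ 'k" and h :: "'m::finite \<Rightarrow> real ^ 'k"
  assumes h: "\<And>v. l * (norm v)\<^sup>2 \<le> (\<Sum>i\<in>UNIV. (h i \<bullet> v)\<^sup>2)" and l: "l > 0"
    and sym: "transpose Q = Q" and psd: "\<And>v. v \<bullet> (Q *v v) \<ge> 0"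
    and Q: "\<And>i. h i \<bullet> (Q *v h i) \<le> 1"
  shows "norm Q \<le> real CARD('m) / l"
proof -
  obtain R :: "real ^ 'k ^ 'k" where R: "Q = transpose R ** R"
    using pos_semidef_factor[OF sym psd] by blast
  have "norm (R *v h i) \<le> 1" for i
    using Q[of i] unfolding R quadratic_form_factor by (simp add: power_le_one_iff)
  from norm_factor_bound[OF h this] have "l * (norm R)\<^sup>2 \<le> real CARD('m)" .
  moreover have "norm Q \<le> (norm R)\<^sup>2"
    using norm_matrix_mult_le[of "transpose R" R] by (simp add: R norm_transpose power2_eq_square)
  ultimately show ?thesis using l
    by (simp add: pos_le_divide_eq mult.commute) (smt (verit) mult_left_mono)
qed

lemma continuous_on_det: "continuous_on S (\<lambda>A :: real ^ 'k ^ 'k. det A)"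
  unfolding det_def by (intro continuous_intros)

lemma linear_matrix_entry_form: "linear (\<lambda>A :: real ^ 'k ^ 'l. v \<bullet> (A *v w))"
  by (intro linearI) (simp_all add: matrix_vector_mult_add_rdistrib scaleR_matrix_vector_assoc[symmetric] inner_simps)

lemma continuous_on_matrix_form: "continuous_on S (\<lambda>A :: real ^ 'k ^ 'l. v \<bullet> (A *v w))"
  by (intro linear_continuous_on linear_conv_bounded_linear[THEN iffD1] linear_matrix_entry_form)

lemma closed_symmetric: "closed {A :: real ^ 'k ^ 'k. transpose A = A}"
proof -
  have "{A :: real ^ 'k ^ 'k. transpose A = A} = (\<Inter>i. \<Inter>j. {A. A $ i $ j = A $ j $ i})"
    by (auto simp: transpose_def vec_eq_iff)
  also have "closed \<dots>" by (intro closed_INT ballI closed_Collect_eq continuous_intros)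
  finally show ?thesis .
qed

lemma det_maximizer_exists:
  fixes h :: "'m::finite \<Rightarrow> real ^ 'k"
  assumes h: "\<And>v. l * (norm v)\<^sup>2 \<le> (\<Sum>i\<in>UNIV. (h i \<bullet> v)\<^sup>2)" and l: "l > 0"
  obtains Q where "pos_def Q" "\<And>i. h i \<bullet> (Q *v h i) \<le> 1"
    "\<And>Q'. pos_def Q' \<Longrightarrow> (\<And>i. h i \<bullet> (Q' *v h i) \<le> 1) \<Longrightarrow> det Q' \<le> det Q"
proof -
  define S where "S = {Q :: real ^ 'k ^ 'k. transpose Q = Q} \<inter> (\<Inter>v. {Q. v \<bullet> (Q *v v) \<ge> 0})
    \<inter> (\<Inter>i. {Q. h i \<bullet> (Q *v h i) \<le> 1})"
  have "closed S" unfolding S_def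
    by (intro closed_Int closed_symmetric closed_INT ballI closed_Collect_le continuous_on_matrix_form
        continuous_on_const)
  moreover have "bounded S" unfolding bounded_iff
    by (intro exI[of _ "real CARD('m) / l"]) (auto simp: S_def intro!: feasible_norm_bound[OF h l])
  ultimately have "compact S" by (simp add: compact_eq_bounded_closed)
  define c where "c = 1 / (1 + (\<Sum>i\<in>UNIV. (norm (h i))\<^sup>2))"
  have c0: "1 + (\<Sum>i\<in>UNIV. (norm (h i))\<^sup>2) > 0" by (intro add_pos_nonneg sum_nonneg) auto
  then have c: "c > 0" by (simp add: c_def)
  have I: "pos_def (c *\<^sub>R mat 1 :: real ^ 'k ^ 'k)"
    using c by (intro pos_def_scaleR) (auto simp: pos_def_def)
  have "(norm (h i))\<^sup>2 \<le> (\<Sum>i\<in>UNIV. (norm (h i))\<^sup>2)" for i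
    by (rule member_le_sum) auto
  then have "h i \<bullet> ((c *\<^sub>R mat 1) *v h i) \<le> 1" for i
    using c0 by (simp add: scaleR_matrix_vector_assoc[symmetric] power2_norm_eq_inner[symmetric] c_def
        pos_divide_le_eq add_increasing)
  with I have inS: "c *\<^sub>R mat 1 \<in> S" by (auto simp: S_def pos_defD)
  obtain Q where Q: "Q \<in> S" and max: "\<And>Q'. Q' \<in> S \<Longrightarrow> det Q' \<le> det Q"
    using continuous_attains_sup[OF \<open>compact S\<close> _ continuous_on_det] inS by blast
  have "det Q > 0" using max[OF inS] pos_def_det_pos[OF I] by linarith
  then have "pos_def Q" using Q by (intro pos_semidef_det_nonzero_imp_pos_def) (auto simp: S_def)
  moreover have "det Q' \<le> det Q" if "pos_def Q'" "\<And>i. h i \<bullet> (Q' *v h i) \<le> 1" for Q'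
    using that by (intro max) (auto simp: S_def pos_defD)
  ultimately show thesis using Q that[of Q] by (auto simp: S_def)
qed

section \<open>Strong concavity of the log-determinant\<close>

lemma pos_def_dmat_iff: "pos_def (dmat d) \<longleftrightarrow> (\<forall>i. d i > 0)"
proof
  assume "pos_def (dmat d)"
  then have "axis i (1::real) \<bullet> (dmat d *v axis i 1) > 0" for i by (intro pos_defD(2)) auto
  then show "\<forall>i. d i > 0" by (simp add: dmat_mult_vector inner_axis')
next
  assume d: "\<forall>i. d i > 0"
  have "v \<bullet> (dmat d *v v) > 0" if v: "v \<noteq> 0" for v
  proof -
    obtain i where "v $ i \<noteq> 0" using v by (auto simp: vec_eq_iff)
    then have "0 < (\<Sum>i\<in>UNIV. d i * (v $ i)\<^sup>2)"
      using d by (intro sum_pos2[of _ i]) (auto simp: less_imp_le)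
    then show ?thesis by (simp add: dmat_mult_vector inner_vec_def power2_eq_square mult_ac)
  qed
  then show "pos_def (dmat d)" by (simp add: pos_def_def)
qed

text \<open>A maximum at the left endpoint gives only the one-sided condition
  \<open>f' 0 \<le> 0\<close>; integrating the bound on \<open>f''\<close> twice from there yields
  the loss \<open>c / 2\<close>.\<close>

lemma second_derivative_bound:
  fixes f f' f'' :: "real \<Rightarrow> real"
  assumes f: "\<And>t. 0 \<le> t \<Longrightarrow> t \<le> 1 \<Longrightarrow> (f has_real_derivative f' t) (at t)"
    and f': "\<And>t. 0 \<le> t \<Longrightarrow> t \<le> 1 \<Longrightarrow> (f' has_real_derivative f'' t) (at t)"
    and c: "\<And>t. 0 \<le> t \<Longrightarrow> t \<le> 1 \<Longrightarrow> f'' t \<le> - c"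
    and max: "\<And>t. 0 \<le> t \<Longrightarrow> t \<le> 1 \<Longrightarrow> f t \<le> f 0"
  shows "f 1 \<le> f 0 - c / 2"
proof -
  have "f' 0 \<le> 0"
  proof (rule ccontr)
    assume "\<not> ?thesis"
    then obtain d where d: "d > 0" "\<And>h. h > 0 \<Longrightarrow> h < d \<Longrightarrow> f 0 < f (0 + h)"
      using DERIV_pos_inc_right[OF f[of 0]] by auto
    define e where "e = min (d / 2) 1"
    have "e > 0" "e < d" "e \<le> 1" using d(1) by (auto simp: e_def min_less_iff_disj)
    with d(2)[of e] max[of e] show False by simp
  qed
  have f'_le: "f' t \<le> - c * t" if "0 \<le> t" "t \<le> 1" for t
  proof -
    have "f' t + c * t \<le> f' 0 + c * 0"
    proof (rule DERIV_nonpos_imp_nonincreasing[OF that(1), where f = "\<lambda>s. f' s + c * s"])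
      fix s assume "0 \<le> s" "s \<le> t"
      then have "((\<lambda>s. f' s + c * s) has_real_derivative f'' s + c) (at s)"
        using that by (auto intro!: derivative_eq_intros f')
      then show "\<exists>y. ((\<lambda>s. f' s + c * s) has_real_derivative y) (at s) \<and> y \<le> 0"
        using c[of s] \<open>0 \<le> s\<close> \<open>s \<le> t\<close> that by (intro exI conjI) auto
    qed
    with \<open>f' 0 \<le> 0\<close> show ?thesis by simp
  qed
  have "f 1 + c / 2 * 1\<^sup>2 \<le> f 0 + c / 2 * 0\<^sup>2"
  proof (rule DERIV_nonpos_imp_nonincreasing[where f = "\<lambda>s. f s + c / 2 * s\<^sup>2"])
    fix s :: real assume s: "0 \<le> s" "s \<le> 1"
    then have "((\<lambda>s. f s + c / 2 * s\<^sup>2) has_real_derivative f' s + c * s) (at s)"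
      by (auto intro!: derivative_eq_intros f)
    then show "\<exists>y. ((\<lambda>s. f s + c / 2 * s\<^sup>2) has_real_derivative y) (at s) \<and> y \<le> 0"
      using f'_le[OF s] by (intro exI conjI) auto
  qed simp
  then show ?thesis by simp
qed

lemma norm_dmat_power2: "(norm (dmat d))\<^sup>2 = (\<Sum>i\<in>UNIV. (d i)\<^sup>2)"
proof -
  have "(norm (dmat d $ i))\<^sup>2 = (d i)\<^sup>2" for i
  proof -
    have "(norm (dmat d $ i))\<^sup>2 = (\<Sum>j\<in>UNIV. (if i = j then d i else 0)\<^sup>2)"
      by (simp add: norm_vec_power2 dmat_def)
    also have "\<dots> = (\<Sum>j\<in>UNIV. if i = j then (d i)\<^sup>2 else 0)" by (intro sum.cong) auto
    finally show ?thesis by simp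
  qed
  then show ?thesis by (simp add: norm_vec_power2[of "dmat d"])
qed

text \<open>Along the segment from the maximizer, with \<open>Q' - Q\<close> diagonalized relative to \<open>Q\<close>, the
  function \<open>ln det\<close> has second derivative at most \<open>- (l * norm (Q' - Q) / m)\<^sup>2\<close>, because every
  feasible matrix \<open>transpose R ** R\<close> has \<open>(norm R)\<^sup>2 \<le> m / l\<close>.\<close>
lemma det_maximizer_gap:
  fixes Q Q' :: "real ^ 'k ^ 'k" and h :: "'m::finite \<Rightarrow> real ^ 'k"
  assumes h: "\<And>v. l * (norm v)\<^sup>2 \<le> (\<Sum>i\<in>UNIV. (h i \<bullet> v)\<^sup>2)" and l: "l > 0"
    and Q: "pos_def Q" "\<And>i. h i \<bullet> (Q *v h i) \<le> 1"
    and max: "\<And>Q'. pos_def Q' \<Longrightarrow> (\<And>i. h i \<bullet> (Q' *v h i) \<le> 1) \<Longrightarrow> det Q' \<le> det Q"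
    and Q': "pos_def Q'" "\<And>i. h i \<bullet> (Q' *v h i) \<le> 1"
    and gap: "ln (det Q) - \<epsilon> \<le> ln (det Q')"
  shows "l\<^sup>2 * (norm (Q' - Q))\<^sup>2 \<le> 2 * (real CARD('m))\<^sup>2 * \<epsilon>"
proof -
  let ?\<Delta> = "Q' - Q" and ?m = "real CARD('m)"
  have "transpose ?\<Delta> = ?\<Delta>"
    using pos_defD(1)[OF Q(1)] pos_defD(1)[OF Q'(1)] by (simp add: transpose_def vec_eq_iff)
  from simultaneous_diagonalization[OF Q(1) this] obtain R :: "real ^ 'k ^ 'k" and d
    where R: "invertible R" and QR: "Q = transpose R ** R" and DR: "?\<Delta> = transpose R ** dmat d ** R" .
  define D where "D t = transpose R ** dmat (\<lambda>i. 1 + t * d i) ** R" for t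
  have D_vec: "D t *v v = Q *v v + t *\<^sub>R (?\<Delta> *v v)" for t v
  proof -
    have "dmat (\<lambda>i. 1 + t * d i) *v w = w + t *\<^sub>R (dmat d *v w)" for w
      by (simp add: dmat_mult_vector vec_eq_iff algebra_simps)
    moreover have "?\<Delta> *v v = transpose R *v (dmat d *v (R *v v))" "Q *v v = transpose R *v (R *v v)"
      by (simp only: DR matrix_vector_mul_assoc matrix_mul_assoc) (simp only: QR matrix_vector_mul_assoc)
    ultimately show ?thesis
      by (simp only: D_def matrix_vector_mul_assoc[symmetric] matrix_vector_right_distrib matrix_vector_mult_scaleR)
  qed
  have D1: "D 1 = Q'" by (simp add: matrix_eq D_vec matrix_vector_mult_diff_rdistrib)
  have d1: "1 + d i > 0" for i
  proof -
    obtain S where S: "R ** S = mat 1" "S ** R = mat 1" using R by (auto simp: invertible_def)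
    have "transpose S ** Q' ** S = transpose (R ** S) ** dmat (\<lambda>i. 1 + 1 * d i) ** (R ** S)"
      by (simp add: D1[symmetric] D_def matrix_transpose_mul matrix_mul_assoc)
    then have "transpose S ** Q' ** S = dmat (\<lambda>i. 1 + d i)" by (simp add: S)
    moreover have "pos_def (transpose S ** Q' ** S)"
      using S by (intro pos_def_congruence Q') (auto simp: invertible_def)
    ultimately show ?thesis by (simp add: pos_def_dmat_iff)
  qed
  have pos: "1 + t * d i > 0" if "0 \<le> t" "t \<le> 1" for t i
  proof (cases "d i \<ge> 0")
    case False
    then have "1 * d i \<le> t * d i" using that by (intro mult_right_mono_neg) auto
    then show ?thesis using d1[of i] by simp
  qed (use that in \<open>simp add: add_pos_nonneg\<close>)
  have pdD: "pos_def (D t)" if "0 \<le> t" "t \<le> 1" for t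
    unfolding D_def using pos that R by (intro pos_def_congruence) (auto simp: pos_def_dmat_iff)
  have feasD: "h i \<bullet> (D t *v h i) \<le> 1" if "0 \<le> t" "t \<le> 1" for t i
  proof -
    have "h i \<bullet> (D t *v h i) = (1 - t) * (h i \<bullet> (Q *v h i)) + t * (h i \<bullet> (Q' *v h i))"
      by (simp add: D_vec inner_simps matrix_vector_mult_diff_rdistrib algebra_simps)
    also have "\<dots> \<le> (1 - t) * 1 + t * 1"
      using that Q Q' by (intro add_mono mult_left_mono) auto
    finally show ?thesis by simp
  qed
  have detR: "det R \<noteq> 0" using R by (simp add: invertible_det_nz)
  define f where "f t = (\<Sum>i\<in>UNIV. ln (1 + t * d i))" for t
  have lndet: "ln (det (D t)) = ln ((det R)\<^sup>2) + f t" if "0 \<le> t" "t \<le> 1" for t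
  proof -
    have "det (D t) = (det R)\<^sup>2 * (\<Prod>i\<in>UNIV. 1 + t * d i)"
      by (simp add: D_def det_mul det_dmat power2_eq_square mult_ac)
    moreover have "(\<Prod>i\<in>UNIV. 1 + t * d i) > 0" using pos[OF that] by (intro prod_pos) auto
    ultimately show ?thesis using detR pos[OF that] less_imp_neq[OF pos[OF that], symmetric]
      by (simp add: ln_mult f_def ln_prod)
  qed
  have D0: "D 0 = Q" by (simp add: matrix_eq D_vec)
  define c where "c = (l * norm ?\<Delta> / ?m)\<^sup>2"
  have "f 1 \<le> f 0 - c / 2"
  proof (rule second_derivative_bound)
    fix t :: real assume t: "0 \<le> t" "t \<le> 1"
    show "(f has_real_derivative (\<Sum>i\<in>UNIV. d i / (1 + t * d i))) (at t)"
      unfolding f_def using pos[OF t] by (auto intro!: derivative_eq_intros sum.cong simp: field_simps)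
    show "((\<lambda>t. \<Sum>i\<in>UNIV. d i / (1 + t * d i)) has_real_derivative
        (\<Sum>i\<in>UNIV. - (d i / (1 + t * d i))\<^sup>2)) (at t)"
    proof (rule DERIV_sum)
      fix i
      show "((\<lambda>t. d i / (1 + t * d i)) has_real_derivative - (d i / (1 + t * d i))\<^sup>2) (at t)"
        using pos[OF t, of i] by (auto intro!: derivative_eq_intros simp: power2_eq_square)
    qed
    show "f t \<le> f 0"
    proof -
      have "det (D t) \<le> det (D 0)" unfolding D0 by (intro max pdD feasD t)
      then have "ln (det (D t)) \<le> ln (det (D 0))" using pos_def_det_pos[OF pdD[OF t]] by simp
      then show ?thesis using lndet[OF t] lndet[of 0] by simp
    qed
    \<comment> \<open>\<open>Rt\<close> factors the intermediate matrix \<open>D t\<close>, and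
      \<open>e\<close> is the diagonal of the difference in its coordinates. The second derivative
      is \<open>- (norm (dmat e))\<^sup>2\<close>, while \<open>norm ?\<Delta>\<close> is at most
      \<open>(norm Rt)\<^sup>2 * norm (dmat e)\<close>, so the bound on \<open>Rt\<close> turns into
      curvature.\<close>
    define Rt where "Rt = dmat (\<lambda>i. sqrt (1 + t * d i)) ** R"
    define e where "e i = d i / (1 + t * d i)" for i
    have "D t = transpose Rt ** Rt"
    proof -
      have "transpose Rt ** Rt = transpose R ** (dmat (\<lambda>i. sqrt (1 + t * d i)) ** dmat (\<lambda>i. sqrt (1 + t * d i))) ** R"
        by (simp add: Rt_def matrix_transpose_mul matrix_mul_assoc)
      then show ?thesis using pos[OF t] by (simp add: dmat_mult D_def less_imp_le)
    qed
    then have "norm (Rt *v h i) \<le> 1" for i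
      using feasD[OF t, of i] by (simp add: quadratic_form_factor power_le_one_iff)
    from norm_factor_bound[OF h this] have Rt: "l * (norm Rt)\<^sup>2 \<le> ?m" .
    have "?\<Delta> = transpose Rt ** dmat e ** Rt"
    proof -
      have sq: "sqrt (1 + t * d i) * e i * sqrt (1 + t * d i) = d i" for i
      proof -
        have "sqrt (1 + t * d i) * e i * sqrt (1 + t * d i) = (sqrt (1 + t * d i) * sqrt (1 + t * d i)) * e i"
          by (simp only: mult_ac)
        also have "\<dots> = d i" using pos[OF t, of i] by (simp add: e_def)
        finally show ?thesis .
      qed
      have "transpose Rt ** dmat e ** Rt
          = transpose R ** (dmat (\<lambda>i. sqrt (1 + t * d i)) ** dmat e ** dmat (\<lambda>i. sqrt (1 + t * d i))) ** R"
        by (simp add: Rt_def matrix_transpose_mul matrix_mul_assoc)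
      then show ?thesis by (simp only: dmat_mult sq DR)
    qed
    then have "norm ?\<Delta> \<le> norm (transpose Rt ** dmat e) * norm Rt" by (simp only: norm_matrix_mult_le)
    also have "\<dots> \<le> (norm Rt * norm (dmat e)) * norm Rt"
      using norm_matrix_mult_le[of "transpose Rt" "dmat e"] by (intro mult_right_mono) (simp_all add: norm_transpose)
    finally have "l * norm ?\<Delta> \<le> (l * (norm Rt)\<^sup>2) * norm (dmat e)"
      using l by (simp add: power2_eq_square mult_ac)
    also have "\<dots> \<le> ?m * norm (dmat e)" using Rt by (intro mult_right_mono) auto
    finally have "l * norm ?\<Delta> / ?m \<le> norm (dmat e)" by (simp add: pos_divide_le_eq mult.commute)
    then have "c \<le> (norm (dmat e))\<^sup>2" unfolding c_def using l by (intro power_mono) auto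
    then show "(\<Sum>i\<in>UNIV. - (d i / (1 + t * d i))\<^sup>2) \<le> - c"
      by (simp add: norm_dmat_power2 e_def sum_negf)
  qed
  moreover have "f 1 - f 0 \<ge> - \<epsilon>" using gap lndet[of 1] lndet[of 0] by (simp add: D0 D1)
  ultimately have "c \<le> 2 * \<epsilon>" by linarith
  then have "c * ?m\<^sup>2 \<le> 2 * \<epsilon> * ?m\<^sup>2" by (intro mult_right_mono) auto
  then show ?thesis by (simp add: c_def power_mult_distrib power_divide mult_ac)
qed

section \<open>The lifted problem\<close>

lemma gram_matrix_form:
  "v \<bullet> ((\<Sum>i\<in>A. outer (h i) (h i)) *v v) = (\<Sum>i\<in>A. (h i \<bullet> v)\<^sup>2)"
  by (subst linear_sum[OF linear_matrix_entry_form])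
     (simp add: outer_mult_vector inner_commute power2_eq_square)

lemma gram_lambda_min:
  fixes h :: "'m::finite \<Rightarrow> real ^ 'k"
  shows "lambda_min (\<Sum>i\<in>UNIV. outer (h i) (h i)) * (norm v)\<^sup>2 \<le> (\<Sum>i\<in>UNIV. (h i \<bullet> v)\<^sup>2)"
    and "lambda_min (\<Sum>i\<in>UNIV. outer (h i) (h i)) \<ge> 0"
    and "(\<And>v. (\<And>i. h i \<bullet> v = 0) \<Longrightarrow> v = 0) \<Longrightarrow> lambda_min (\<Sum>i\<in>UNIV. outer (h i) (h i)) > 0"
proof -
  let ?H = "\<Sum>i\<in>UNIV. outer (h i) (h i)"
  have "transpose ?H = ?H"
    by (simp add: transpose_def vec_eq_iff outer_def mult.commute)
  from lambda_min_attained[OF this] obtain u where u: "norm u = 1" "lambda_min ?H = u \<bullet> (?H *v u)"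
    "\<forall>v. lambda_min ?H * (norm v)\<^sup>2 \<le> v \<bullet> (?H *v v)" by blast
  show "lambda_min ?H * (norm v)\<^sup>2 \<le> (\<Sum>i\<in>UNIV. (h i \<bullet> v)\<^sup>2)"
    using u(3)[rule_format, of v] by (simp only: gram_matrix_form)
  have l: "lambda_min ?H = (\<Sum>i\<in>UNIV. (h i \<bullet> u)\<^sup>2)" using u(2) by (simp only: gram_matrix_form)
  then show "lambda_min ?H \<ge> 0" by (simp add: sum_nonneg)
  assume *: "\<And>v. (\<And>i. h i \<bullet> v = 0) \<Longrightarrow> v = 0"
  show "lambda_min ?H > 0"
  proof (rule ccontr)
    assume "\<not> ?thesis"
    then have "(\<Sum>i\<in>UNIV. (h i \<bullet> u)\<^sup>2) = 0" using l sum_nonneg[of UNIV "\<lambda>i. (h i \<bullet> u)\<^sup>2"] by simp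
    then have "h i \<bullet> u = 0" for i by (subst (asm) sum_nonneg_eq_0_iff) auto
    then have "u = 0" by (rule *)
    with u(1) show False by simp
  qed
qed

lemma hvec_eq_lvec: "hvec a x i = lvec (a_tilde a x i) 1"
  by (simp add: hvec_def lvec_def)

text \<open>\<open>1 - beta Q\<close> is the Schur complement of \<open>blk_G Q\<close>; this is why
  it is positive and enters the determinant as a factor.\<close>

lemma pos_def_lmat:
  assumes Q: "pos_def Q"
  defines "w \<equiv> matrix_inv (blk_G Q) *v blk_z Q"
  shows "pos_def (blk_G Q)" "blk_G Q *v w = blk_z Q"
    "Q = blkm (blk_G Q) (blk_z Q) (blk_z Q) (blk_s Q)"
    "beta Q = 1 - blk_s Q + blk_z Q \<bullet> w" "blk_z Q \<bullet> w \<ge> 0"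
    "beta Q < 1" "det Q = (1 - beta Q) * det (blk_G Q)"
proof -
  show eq: "Q = blkm (blk_G Q) (blk_z Q) (blk_z Q) (blk_s Q)"
    by (rule symmetric_eq_blkm[OF pos_defD(1)[OF Q]])
  have "transpose (blk_G Q) = blk_G Q"
    using arg_cong[OF pos_defD(1)[OF Q], of blk_G] by (simp add: blk_G_def transpose_def)
  moreover have "v \<bullet> (blk_G Q *v v) > 0" if "v \<noteq> 0" for v
  proof -
    have "lvec v 0 \<bullet> (blkm (blk_G Q) (blk_z Q) (blk_z Q) (blk_s Q) *v lvec v 0) > 0"
      unfolding eq[symmetric] using that by (intro pos_defD(2)[OF Q]) simp
    then show ?thesis by simp
  qed
  ultimately show G: "pos_def (blk_G Q)" by (simp add: pos_def_def)
  show Gw: "blk_G Q *v w = blk_z Q" by (simp add: w_def pos_def_mult_matrix_inv[OF G])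
  show b: "beta Q = 1 - blk_s Q + blk_z Q \<bullet> w" by (simp add: beta_def w_def)
  show "blk_z Q \<bullet> w \<ge> 0" using pos_defD(3)[OF G, of w] by (simp add: Gw inner_commute)
  have eq': "Q = blkm (blk_G Q) (blk_G Q *v w) (blk_G Q *v w) (blk_s Q)" using eq by (simp add: Gw)
  have "w \<bullet> (blk_G Q *v w) < blk_s Q" using Q eq' pos_def_blkm_iff by metis
  then show "beta Q < 1" by (simp add: b Gw inner_commute)
  have "det Q = (blk_s Q - w \<bullet> (blk_G Q *v w)) * det (blk_G Q)"
    by (subst eq') (rule det_blkm_schur[OF pos_defD(1)[OF G]])
  then show "det Q = (1 - beta Q) * det (blk_G Q)" by (simp add: b Gw inner_commute)
qed

text \<open>Feasibility puts all \<open>a_tilde a x i\<close> into one sublevel set of a quadratic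
  function in the original dimension, the ellipsoid of \<open>quadratic_ellipsoid_iff\<close> once
  \<open>beta Q > 0\<close>.\<close>

lemma lifted_feasible_iff:
  "lifted_feasible a x Q \<longleftrightarrow> pos_def Q \<and> (\<forall>i. a_tilde a x i \<bullet> (blk_G Q *v a_tilde a x i)
     + 2 * (blk_z Q \<bullet> a_tilde a x i) \<le> 1 - blk_s Q)"
proof (cases "pos_def Q")
  case True
  have "hvec a x i \<bullet> (Q *v hvec a x i) = a_tilde a x i \<bullet> (blk_G Q *v a_tilde a x i)
     + 2 * (blk_z Q \<bullet> a_tilde a x i) + blk_s Q" for i
    by (subst pos_def_lmat(3)[OF True]) (simp add: hvec_eq_lvec blkm_quadratic del: blkm_mult_lvec)
  then show ?thesis unfolding lifted_feasible_def using True by (simp add: algebra_simps)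
qed (simp add: lifted_feasible_def)

lemma is_lifted_opt_iff:
  "is_lifted_opt a x Q \<longleftrightarrow> lifted_feasible a x Q \<and> (\<forall>Q'. lifted_feasible a x Q' \<longrightarrow> det Q' \<le> det Q)"
  unfolding is_lifted_opt_def
  by (meson lifted_feasible_def ln_le_cancel_iff neg_le_iff_le pos_def_det_pos)

lemma a_tilde_scale:
  "x \<in> interior (hpoly a) \<Longrightarrow> a i = (1 - a i \<bullet> x) *\<^sub>R a_tilde a x i"
  by (auto simp: interior_hpoly a_tilde_def less_imp_neq)

lemma ellipsoid_center_interior:
  assumes E: "pos_def E" and sub: "ellipsoid c E \<subseteq> hpoly a"
  shows "c \<in> interior (hpoly a)"
  unfolding interior_hpoly
proof (intro CollectI allI)
  fix i
  have le: "a i \<bullet> c + sqrt (a i \<bullet> (matrix_inv E *v a i)) \<le> 1"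
    using sub by (simp add: ellipsoid_subset_hpoly_iff[OF E])
  show "a i \<bullet> c < 1"
  proof (cases "a i = 0")
    case False
    then have "a i \<bullet> (matrix_inv E *v a i) > 0" by (intro pos_defD(2)[OF pos_def_matrix_inv[OF E]])
    then have "sqrt (a i \<bullet> (matrix_inv E *v a i)) > 0" by simp
    with le show ?thesis by linarith
  qed simp
qed

lemma quadratic_ellipsoid_iff:
  fixes G :: "real ^ 'n ^ 'n"
  assumes G: "pos_def G" and b: "b = \<sigma> + z \<bullet> (matrix_inv G *v z)" "b > 0"
  shows "p \<in> ellipsoid (- (matrix_inv G *v z)) ((1 / b) *\<^sub>R G) \<longleftrightarrow> p \<bullet> (G *v p) + 2 * (z \<bullet> p) \<le> \<sigma>"
proof -
  let ?w = "matrix_inv G *v z"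
  have Gw: "G *v ?w = z" by (rule pos_def_mult_matrix_inv[OF G])
  have "(p + ?w) \<bullet> (G *v (p + ?w)) = p \<bullet> (G *v p) + 2 * (z \<bullet> p) + z \<bullet> ?w"
    using inner_matrix_vector_symmetric[OF pos_defD(1)[OF G], of ?w p]
    by (simp add: matrix_vector_right_distrib inner_simps Gw inner_commute)
  then have "(p - - ?w) \<bullet> (((1 / b) *\<^sub>R G) *v (p - - ?w)) = (p \<bullet> (G *v p) + 2 * (z \<bullet> p) + z \<bullet> ?w) / b"
    by (simp add: scaleR_matrix_vector_assoc[symmetric])
  then show ?thesis unfolding ellipsoid_def using b by (simp add: pos_divide_le_eq algebra_simps)
qed

text \<open>The largest value of \<open>(1 - b) * b ^ n\<close> on the unit interval, attained at \<open>b = n / (n + 1)\<close>.\<close>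
definition kap :: "nat \<Rightarrow> real" where
  "kap n = real n ^ n / real (n + 1) ^ (n + 1)"

lemma kap_pos: "n > 0 \<Longrightarrow> kap n > 0"
  by (simp add: kap_def)

text \<open>Weighted AM-GM through \<open>ln x \<le> x - 1\<close>: \<open>u\<close> and
  \<open>v\<close> are scaled to equal 1 at \<open>b = n / (n + 1)\<close>, and then the linear
  bounds cancel exactly.\<close>

lemma power_le_kap:
  assumes "0 < b" "b < 1" "n > 0"
  shows "(1 - b) * b ^ n \<le> kap n"
proof -
  define u v where "u = b * real (n + 1) / real n" and "v = (1 - b) * real (n + 1)"
  have uv: "u > 0" "v > 0" using assms by (auto simp: u_def v_def)
  have "ln (u ^ n * v) = real n * ln u + ln v" using uv by (simp add: ln_mult ln_realpow)
  also have "\<dots> \<le> real n * (u - 1) + (v - 1)"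
    using uv assms by (intro add_mono mult_left_mono ln_le_minus_one) auto
  also have "\<dots> = 0" using assms by (simp add: u_def v_def field_simps)
  finally have "u ^ n * v \<le> 1" using uv by (simp add: ln_le_zero_iff)
  moreover have "u ^ n * v = ((1 - b) * b ^ n) / kap n"
    by (simp add: u_def v_def kap_def power_mult_distrib power_divide mult_ac)
  ultimately show ?thesis using kap_pos[OF assms(3)] by (simp add: pos_divide_le_eq)
qed

text \<open>Scaling \<open>G\<close>, \<open>z\<close> and \<open>\<sigma>\<close> by
  \<open>k\<close> leaves the quadratic sublevel set unchanged but turns \<open>b\<close> into
  \<open>k * b\<close>. The chosen \<open>k\<close> gives \<open>k * b = n / (n + 1)\<close>, where
  \<open>(1 - b) * b ^ n\<close> is largest, so this is the best lift of the given
  ellipsoid.\<close>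

lemma lift_quadratic:
  fixes a :: "'m::finite \<Rightarrow> real ^ 'n" and G :: "real ^ 'n ^ 'n"
  assumes G: "pos_def G" and b: "b = \<sigma> + z \<bullet> (matrix_inv G *v z)" "b > 0"
    and le: "\<And>i. a_tilde a x i \<bullet> (G *v a_tilde a x i) + 2 * (z \<bullet> a_tilde a x i) \<le> \<sigma>"
  defines "k \<equiv> real CARD('n) / (real (CARD('n) + 1) * b)"
  defines "Q \<equiv> blkm (k *\<^sub>R G) (k *\<^sub>R z) (k *\<^sub>R z) (1 - k * \<sigma>)"
  shows "lifted_feasible a x Q" "det Q = kap CARD('n) * (det G / b ^ CARD('n))"
proof -
  let ?n = "CARD('n)" and ?w = "matrix_inv G *v z"
  have k: "k > 0" using b by (simp add: k_def)
  have "k * b = real ?n / real (?n + 1)" using b(2) by (simp add: k_def)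
  then have kb: "1 - k * b = 1 / real (?n + 1)" by (simp add: field_simps)
  have Gw: "G *v ?w = z" by (rule pos_def_mult_matrix_inv[OF G])
  have kG: "pos_def (k *\<^sub>R G)" using G k by (rule pos_def_scaleR)
  have Q: "Q = blkm (k *\<^sub>R G) ((k *\<^sub>R G) *v ?w) ((k *\<^sub>R G) *v ?w) (1 - k * \<sigma>)"
    by (simp add: Q_def scaleR_matrix_vector_assoc[symmetric] Gw)
  have schur: "1 - k * \<sigma> - ?w \<bullet> ((k *\<^sub>R G) *v ?w) = 1 / real (?n + 1)"
    unfolding kb[symmetric] by (simp add: scaleR_matrix_vector_assoc[symmetric] Gw b(1) inner_commute algebra_simps)
  have "1 / real (?n + 1) > 0" by simp
  then have "?w \<bullet> ((k *\<^sub>R G) *v ?w) < 1 - k * \<sigma>" using schur by linarith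
  then have "pos_def Q" unfolding Q pos_def_blkm_iff using kG by blast
  moreover have "a_tilde a x i \<bullet> ((k *\<^sub>R G) *v a_tilde a x i) + 2 * ((k *\<^sub>R z) \<bullet> a_tilde a x i) \<le> k * \<sigma>" for i
    using mult_left_mono[OF le[of i], of k] k by (simp add: scaleR_matrix_vector_assoc[symmetric] algebra_simps)
  ultimately show "lifted_feasible a x Q" by (simp add: lifted_feasible_iff Q_def)
  have "det Q = 1 / real (?n + 1) * (k ^ ?n * det G)"
    unfolding Q by (simp only: det_blkm_schur[OF pos_defD(1)[OF kG]] schur det_scaleR)
  then show "det Q = kap ?n * (det G / b ^ ?n)"
    by (simp add: kap_def k_def power_mult_distrib power_divide mult_ac)
qed

text \<open>Brings an ellipsoid to the normalization \<open>b = 1\<close>, in which its shape matrix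
  is \<open>G\<close> itself.\<close>

lemma is_ellipsoid_quadratic:
  fixes T :: "(real ^ 'n) set"
  assumes "is_ellipsoid T"
  obtains G \<sigma> z where "pos_def G" "1 = \<sigma> + z \<bullet> (matrix_inv G *v z)"
    "T = {p. p \<bullet> (G *v p) + 2 * (z \<bullet> p) \<le> \<sigma>}" "Vol T = det G powr (- 1 / 2)"
proof -
  obtain c G where G: "pos_def G" and T: "T = ellipsoid c G" using assms by (auto simp: is_ellipsoid_def)
  define z \<sigma> where "z = - (G *v c)" and "\<sigma> = 1 - z \<bullet> (matrix_inv G *v z)"
  have "matrix_inv G *v z = - c"
    by (simp add: z_def linear_neg[OF matrix_vector_mul_linear] pos_def_matrix_inv_mult[OF G])
  then have T': "T = {p. p \<bullet> (G *v p) + 2 * (z \<bullet> p) \<le> \<sigma>}"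
    using quadratic_ellipsoid_iff[OF G, of 1 \<sigma> z] by (auto simp: T \<sigma>_def)
  have "Vol T = det G powr (- 1 / 2)" unfolding T by (rule Vol_ellipsoid[OF G])
  with G T' show thesis by (intro that[of G \<sigma> z]) (simp_all add: \<sigma>_def)
qed

context
  fixes a :: "'m::finite \<Rightarrow> real ^ 'n"
  assumes bd: "bounded (hpoly a)"
begin

section \<open>Existence and uniqueness of the lifted optimizer\<close>

lemma a_tilde_recession:
  assumes x: "x \<in> interior (hpoly a)" and w: "\<And>i. a_tilde a x i \<bullet> w \<le> 0"
  shows "w = 0"
  using w by (intro bounded_hpoly_recession[OF bd]) (simp add: a_tilde_inner[OF x])

text \<open>If \<open>lvec w t\<close> is orthogonal to all \<open>hvec a x i\<close>, then every
  \<open>a_tilde a x i\<close> has the same inner product \<open>- t\<close> with \<open>w\<close>,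
  so \<open>w\<close> or \<open>- w\<close> is a recession direction.\<close>

lemma hvec_span:
  assumes x: "x \<in> interior (hpoly a)" and v: "\<And>i. hvec a x i \<bullet> v = 0"
  shows "v = 0"
proof -
  obtain w t where vw: "v = lvec w t" by (rule lvec_exhaust)
  have *: "a_tilde a x i \<bullet> w = - t" for i using v[of i] by (simp add: vw hvec_eq_lvec)
  have "w = 0"
  proof (cases "t \<ge> 0")
    case True
    then show ?thesis using * by (intro a_tilde_recession[OF x]) auto
  next
    case False
    then have "- w = 0" using * by (intro a_tilde_recession[OF x]) auto
    then show ?thesis by simp
  qed
  with * show ?thesis by (simp add: vw)
qed

lemma hvec_gram_pos:
  "x \<in> interior (hpoly a) \<Longrightarrow> lambda_min (\<Sum>i\<in>UNIV. outer (hvec a x i) (hvec a x i)) > 0"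
  by (intro gram_lambda_min(3) hvec_span)

lemma lifted_opt_exists:
  assumes x: "x \<in> interior (hpoly a)"
  obtains Q where "is_lifted_opt a x Q"
  using det_maximizer_exists[OF gram_lambda_min(1) hvec_gram_pos[OF x]]
  unfolding is_lifted_opt_iff lifted_feasible_def by metis

lemma is_lifted_opt_gap:
  assumes l: "l > 0" "\<And>v. l * (norm v)\<^sup>2 \<le> (\<Sum>i\<in>UNIV. (hvec a x i \<bullet> v)\<^sup>2)"
    and Q: "is_lifted_opt a x Q" and Q': "lifted_feasible a x Q'"
    and gap: "- ln (det Q') \<le> - ln (det Q) + \<epsilon>"
  shows "l\<^sup>2 * (norm (Q' - Q))\<^sup>2 \<le> 2 * (real CARD('m))\<^sup>2 * \<epsilon>"
  using Q Q' gap unfolding is_lifted_opt_iff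
  by (intro det_maximizer_gap[OF l(2,1), of Q Q']) (auto simp: lifted_feasible_def)

text \<open>Between two optimizers the gap is 0, and the gap estimate then leaves no distance
  between them.\<close>

lemma lifted_opt_unique:
  assumes x: "x \<in> interior (hpoly a)"
  shows "\<exists>!Q. is_lifted_opt a x Q"
proof -
  obtain Q where Q: "is_lifted_opt a x Q" using lifted_opt_exists[OF x] .
  moreover have "Q' = Q" if Q': "is_lifted_opt a x Q'" for Q'
  proof -
    let ?l = "lambda_min (\<Sum>i\<in>UNIV. outer (hvec a x i) (hvec a x i))"
    have "?l\<^sup>2 * (norm (Q' - Q))\<^sup>2 \<le> 2 * (real CARD('m))\<^sup>2 * 0"
      using Q Q' by (intro is_lifted_opt_gap[OF hvec_gram_pos[OF x] gram_lambda_min(1) Q]) (auto simp: is_lifted_opt_def)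
    then have "(norm (Q' - Q))\<^sup>2 \<le> 0" using hvec_gram_pos[OF x] by (simp add: mult_le_0_iff)
    then show ?thesis by simp
  qed
  ultimately show ?thesis by blast
qed

lemma lifted_opt_is_opt: "x \<in> interior (hpoly a) \<Longrightarrow> is_lifted_opt a x (lifted_opt a x)"
  unfolding lifted_opt_def by (rule theI'[OF lifted_opt_unique])

lemma lifted_opt_eqI: "x \<in> interior (hpoly a) \<Longrightarrow> is_lifted_opt a x Q \<Longrightarrow> Q = lifted_opt a x"
  using lifted_opt_unique lifted_opt_is_opt by blast

section \<open>Geometry of the update\<close>

lemma lifted_feasible_s_less_1:
  assumes x: "x \<in> interior (hpoly a)" and Q: "lifted_feasible a x Q"
  shows "blk_s Q < 1"
proof (rule ccontr)
  assume s: "\<not> ?thesis"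
  have pd: "pos_def (blk_G Q)" using Q by (intro pos_def_lmat) (simp add: lifted_feasible_def)
  \<comment> \<open>With \<open>blk_s Q \<ge> 1\<close> these inequalities make
    \<open>blk_z Q\<close> a recession direction, hence 0; then every \<open>a_tilde a x i\<close>
    vanishes and the polytope would be the whole space.\<close>
  have le: "a_tilde a x i \<bullet> (blk_G Q *v a_tilde a x i) + 2 * (blk_z Q \<bullet> a_tilde a x i) \<le> 0" for i
    using Q s unfolding lifted_feasible_iff by (smt (verit))
  have "blk_z Q = 0"
    using le pos_defD(3)[OF pd] by (intro a_tilde_recession[OF x]) (smt (verit) inner_commute)
  then have at: "a_tilde a x i = 0" for i using le[of i] pos_defD(2)[OF pd, of "a_tilde a x i"] by force
  have "axis undefined 1 = (0 :: real ^ 'n)" by (rule a_tilde_recession[OF x]) (simp add: at)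
  then show False by simp
qed

lemma lifted_feasible_beta_pos:
  assumes x: "x \<in> interior (hpoly a)" and Q: "lifted_feasible a x Q"
  shows "0 < 1 - blk_s Q" "1 - blk_s Q \<le> beta Q" "beta Q > 0"
proof -
  show s: "0 < 1 - blk_s Q" using lifted_feasible_s_less_1[OF assms] by simp
  have "pos_def Q" using Q by (simp add: lifted_feasible_def)
  then show "1 - blk_s Q \<le> beta Q" using pos_def_lmat(4,5) by fastforce
  with s show "beta Q > 0" by simp
qed

text \<open>The inverse is the simpler object: a scaled rank-one update of \<open>blk_G Q\<close>,
  with \<open>E_upd\<close> its Sherman-Morrison inverse. Support functions need the inverse, and
  the rank-one determinant formula gives the volume.\<close>

lemma E_upd_eq:
  fixes Q :: "'n lmat"
  assumes x: "x \<in> interior (hpoly a)" and Q: "lifted_feasible a x Q"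
  shows "pos_def (E_upd Q)"
    and "matrix_inv (E_upd Q) = (1 / (1 - blk_s Q)) *\<^sub>R
      (blk_G Q + (1 / (1 - blk_s Q)) *\<^sub>R outer (blk_z Q) (blk_z Q))"
    and "det (E_upd Q) = (1 - blk_s Q) ^ (CARD('n) + 1) / (beta Q * det (blk_G Q))"
proof -
  define G z \<sigma> b w where "G = blk_G Q" and "z = blk_z Q" and "\<sigma> = 1 - blk_s Q" and "b = beta Q"
    and "w = matrix_inv G *v z"
  note defs = G_def z_def \<sigma>_def b_def w_def
  have pd: "pos_def Q" using Q by (simp add: lifted_feasible_def)
  have G: "pos_def G" and Gw: "G *v w = z" and b: "b = \<sigma> + z \<bullet> w"
    using pos_def_lmat(1,2,4)[OF pd] by (auto simp: defs)
  have pos: "\<sigma> > 0" "b > 0" using lifted_feasible_beta_pos[OF assms] by (auto simp: defs)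
  define A where "A = G + (1 / \<sigma>) *\<^sub>R outer z z"
  have A_vec: "A *v v = G *v v + ((z \<bullet> v) / \<sigma>) *\<^sub>R z" for v
    by (simp add: A_def matrix_vector_mult_add_rdistrib scaleR_matrix_vector_assoc[symmetric] outer_mult_vector)
  have A: "pos_def A" unfolding pos_def_def
  proof (intro conjI allI impI)
    show "transpose A = A" by (simp add: A_def transpose_add transpose_scalar pos_defD(1)[OF G])
    fix v :: "real ^ 'n" assume "v \<noteq> 0"
    then have "v \<bullet> (G *v v) + (z \<bullet> v)\<^sup>2 / \<sigma> > 0" using pos by (intro add_pos_nonneg pos_defD(2)[OF G]) auto
    then show "v \<bullet> (A *v v) > 0" by (simp add: A_vec inner_simps inner_commute power2_eq_square)
  qed
  define M where "M = matrix_inv G - (1 / b) *\<^sub>R (matrix_inv G ** outer z z ** matrix_inv G)"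
  have EM: "E_upd Q = \<sigma> *\<^sub>R M" by (simp add: E_upd_def M_def defs)
  have "A ** M = mat 1"
    unfolding matrix_eq
  proof
    fix v
    define q where "q = z \<bullet> (matrix_inv G *v v)"
    have Mv: "M *v v = matrix_inv G *v v - (q / b) *\<^sub>R w"
      by (simp add: M_def matrix_vector_mult_diff_rdistrib scaleR_matrix_vector_assoc[symmetric]
          matrix_vector_mul_assoc[symmetric] outer_mult_vector matrix_vector_mult_scaleR w_def q_def)
    have "A *v (M *v v) = v + ((q - q / b * (z \<bullet> w)) / \<sigma> - q / b) *\<^sub>R z"
      unfolding A_vec Mv
      by (simp add: matrix_vector_mult_diff_distrib matrix_vector_mult_scaleR pos_def_mult_matrix_inv[OF G]
          Gw inner_simps q_def algebra_simps)
    also have "(q - q / b * (z \<bullet> w)) / \<sigma> - q / b = 0"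
    proof -
      have zw: "z \<bullet> w = b - \<sigma>" using b by simp
      show ?thesis using pos by (simp only: zw) (simp add: field_simps)
    qed
    finally show "(A ** M) *v v = mat 1 *v v" by (simp add: matrix_vector_mul_assoc[symmetric])
  qed
  then have M: "M = matrix_inv A" by (simp add: matrix_inv_eqI)
  show "pos_def (E_upd Q)" unfolding EM M by (intro pos_def_scaleR pos_def_matrix_inv A pos)
  have "matrix_inv (\<sigma> *\<^sub>R matrix_inv A) = (1 / \<sigma>) *\<^sub>R A"
    using pos invertible_matrix_inv(2)[OF pos_def_invertible[OF A]]
    by (intro matrix_inv_eqI)
      (simp add: matrix_eq scaleR_matrix_vector_assoc[symmetric] matrix_vector_mul_assoc[symmetric]
        matrix_vector_mult_scaleR pos_def_matrix_inv_mult[OF A])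
  then show "matrix_inv (E_upd Q) = (1 / (1 - blk_s Q)) *\<^sub>R
      (blk_G Q + (1 / (1 - blk_s Q)) *\<^sub>R outer (blk_z Q) (blk_z Q))"
    unfolding EM M by (simp add: A_def defs)
  have "det A = (1 + 1 / \<sigma> * (w \<bullet> (G *v w))) * det G"
    unfolding A_def Gw[symmetric] by (rule det_rank_one_update[OF pos_defD(1)[OF G]])
  also have "1 + 1 / \<sigma> * (w \<bullet> (G *v w)) = b / \<sigma>"
    using pos by (simp add: Gw b inner_commute field_simps)
  finally have "det (E_upd Q) = \<sigma> ^ CARD('n) / (b / \<sigma> * det G)"
    by (simp add: EM M det_scaleR det_matrix_inv[OF A])
  then show "det (E_upd Q) = (1 - blk_s Q) ^ (CARD('n) + 1) / (beta Q * det (blk_G Q))"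
    using pos by (simp add: defs mult_ac)
qed

text \<open>Let \<open>g\<close> be the form \<open>blk_G Q\<close> at \<open>a_tilde a x i\<close>.
  The lifted constraint \<open>g / \<sigma> + 2 * q \<le> 1\<close> rearranges to
  \<open>g / \<sigma> + q\<^sup>2 \<le> (1 - q)\<^sup>2\<close>, which is the support inequality for
  \<open>a i\<close> divided by \<open>p\<close> and squared. Since feasibility is what drives this,
  inexact answers produce inscribed ellipsoids as well.\<close>

lemma update_ellipsoid_subset:
  assumes x: "x \<in> interior (hpoly a)" and Q: "lifted_feasible a x Q"
  shows "ellipsoid (K_upd x Q) (E_upd Q) \<subseteq> hpoly a"
  unfolding ellipsoid_subset_hpoly_iff[OF E_upd_eq(1)[OF x Q]]
proof
  fix i
  define \<sigma> where "\<sigma> = 1 - blk_s Q"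
  define p where "p = 1 - a i \<bullet> x"
  define q where "q = (a_tilde a x i \<bullet> blk_z Q) / \<sigma>"
  have \<sigma>: "\<sigma> > 0" using lifted_feasible_beta_pos(1)[OF x Q] by (simp add: \<sigma>_def)
  have p: "p > 0" using x by (simp add: p_def interior_hpoly)
  have ai: "a i = p *\<^sub>R a_tilde a x i" using a_tilde_scale[OF x, of i] by (simp add: p_def)
  have "pos_def (blk_G Q)" using Q by (intro pos_def_lmat) (simp add: lifted_feasible_def)
  then have g: "a_tilde a x i \<bullet> (blk_G Q *v a_tilde a x i) \<ge> 0" by (rule pos_defD)
  have "a_tilde a x i \<bullet> (blk_G Q *v a_tilde a x i) + 2 * (blk_z Q \<bullet> a_tilde a x i) \<le> \<sigma>"
    using Q by (simp add: lifted_feasible_iff \<sigma>_def)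
  then have "(a_tilde a x i \<bullet> (blk_G Q *v a_tilde a x i)) / \<sigma> + 2 * q \<le> 1"
    using \<sigma> by (simp add: q_def inner_commute field_simps)
  moreover have "(a_tilde a x i \<bullet> (blk_G Q *v a_tilde a x i)) / \<sigma> \<ge> 0" using g \<sigma> by simp
  ultimately have q: "q \<le> 1" "(a_tilde a x i \<bullet> (blk_G Q *v a_tilde a x i)) / \<sigma> + q\<^sup>2 \<le> (1 - q)\<^sup>2"
    by (auto simp: power2_eq_square algebra_simps)
  have "a i \<bullet> (matrix_inv (E_upd Q) *v a i) = p\<^sup>2 * ((a_tilde a x i \<bullet> (blk_G Q *v a_tilde a x i)) / \<sigma> + q\<^sup>2)"
    unfolding E_upd_eq(2)[OF x Q] \<sigma>_def[symmetric] ai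
    by (simp add: scaleR_matrix_vector_assoc[symmetric] matrix_vector_mult_add_rdistrib outer_mult_vector
        matrix_vector_mult_scaleR inner_simps inner_commute q_def power2_eq_square algebra_simps)
  also have "\<dots> \<le> p\<^sup>2 * (1 - q)\<^sup>2" using q by (intro mult_left_mono) auto
  finally have "sqrt (a i \<bullet> (matrix_inv (E_upd Q) *v a i)) \<le> p * (1 - q)"
    using p q by (intro real_le_lsqrt) (auto simp: power_mult_distrib)
  moreover have "a i \<bullet> K_upd x Q = 1 - p + p * q"
    by (simp add: K_upd_def inner_simps \<sigma>_def[symmetric] p_def[symmetric] q_def)
       (subst ai, simp add: p_def)
  ultimately show "a i \<bullet> K_upd x Q + sqrt (a i \<bullet> (matrix_inv (E_upd Q) *v a i)) \<le> 1"
    by (simp add: algebra_simps)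
qed

lemma K_upd_interior:
  assumes "x \<in> interior (hpoly a)" "lifted_feasible a x Q"
  shows "K_upd x Q \<in> interior (hpoly a)"
  using E_upd_eq(1) update_ellipsoid_subset assms by (intro ellipsoid_center_interior)

end

section \<open>The potential\<close>

context
  fixes a :: "'m::finite \<Rightarrow> real ^ 'n"
  assumes bd: "bounded (hpoly a)"
begin

text \<open>The optimum \<open>Q\<close> cuts out \<open>ellipsoid c M\<close>. By
  \<open>power_le_kap\<close>, \<open>det Q\<close> is at most \<open>kap n * det M\<close>; lifting
  the same ellipsoid optimally gives equality. Any competing ellipsoid also lifts to a feasible
  matrix, so its shape determinant cannot exceed \<open>det M\<close>.\<close>

lemma
  assumes x: "x \<in> interior (hpoly a)"
  defines "Q \<equiv> lifted_opt a x"
  shows vpot_eq: "vpot a x = - ln (det (blk_G Q) / beta Q ^ CARD('n)) / 2"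
    and det_lifted_opt: "det Q = kap CARD('n) * (det (blk_G Q) / beta Q ^ CARD('n))"
proof -
  define G z b where "G = blk_G Q" and "z = blk_z Q" and "b = beta Q"
  let ?P = "polar_set ((\<lambda>p. p - x) ` hpoly a)"
  let ?n = "CARD('n)"
  have opt: "is_lifted_opt a x Q" unfolding Q_def by (rule lifted_opt_is_opt[OF bd x])
  then have feas: "lifted_feasible a x Q" by (simp add: is_lifted_opt_def)
  then have pd: "pos_def Q" by (simp add: lifted_feasible_def)
  have G: "pos_def G" and b: "b = (1 - blk_s Q) + z \<bullet> (matrix_inv G *v z)" "b < 1"
    and detQ: "det Q = (1 - b) * det G"
    using pos_def_lmat(1,4,6,7)[OF pd] by (auto simp: G_def z_def b_def)
  have b0: "b > 0" using lifted_feasible_beta_pos(3)[OF bd x feas] by (simp add: b_def)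
  define M c where "M = (1 / b) *\<^sub>R G" and "c = - (matrix_inv G *v z)"
  have M: "pos_def M" using b0 G by (simp add: M_def pos_def_scaleR)
  have detM: "det M = det G / b ^ ?n" by (simp add: M_def det_scaleR power_divide)
  have mem: "p \<in> ellipsoid c M \<longleftrightarrow> p \<bullet> (G *v p) + 2 * (z \<bullet> p) \<le> 1 - blk_s Q" for p
    unfolding c_def M_def by (rule quadratic_ellipsoid_iff[OF G b(1) b0])
  have kap: "kap ?n > 0" by (rule kap_pos) simp
  have max: "lifted_feasible a x Q' \<Longrightarrow> det Q' \<le> det Q" for Q' using opt by (simp add: is_lifted_opt_iff)
  have sub: "?P \<subseteq> ellipsoid c M"
    using feas by (simp add: polar_subset_iff[OF bd x closed_ellipsoid convex_ellipsoid[OF M]] mem lifted_feasible_iff G_def z_def)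
  have ge: "det Q \<le> kap ?n * det M"
  proof -
    have "(1 - b) * b ^ ?n * (det G / b ^ ?n) \<le> kap ?n * (det G / b ^ ?n)"
      using pos_def_det_pos[OF G] b b0 by (intro mult_right_mono power_le_kap) auto
    then show ?thesis using b0 by (simp add: detQ detM)
  qed
  have inside: "a_tilde a x i \<bullet> (G *v a_tilde a x i) + 2 * (z \<bullet> a_tilde a x i) \<le> 1 - blk_s Q" for i
    using feas by (simp add: lifted_feasible_iff G_def z_def)
  show det: "det Q = kap ?n * (det (blk_G Q) / beta Q ^ ?n)"
    using lift_quadratic[OF G b(1) b0 inside] max ge by (fastforce simp: detM G_def b_def)
  \<comment> \<open>Uniqueness is needed along with minimality, for the description in
    \<open>MinCE\<close>. An ellipsoid of no larger volume lifts to an optimizer; as that is unique,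
    both ellipsoids have the same quadratic inequality up to the factor \<open>?k\<close>.\<close>
  have least: "Vol (ellipsoid c M) \<le> Vol T \<and> (Vol T \<le> Vol (ellipsoid c M) \<longrightarrow> T = ellipsoid c M)"
    if T: "is_ellipsoid T" "?P \<subseteq> T" for T
  proof -
    from is_ellipsoid_quadratic[OF T(1)] obtain H \<tau> y where H: "pos_def H"
      "1 = \<tau> + y \<bullet> (matrix_inv H *v y)" and TH: "T = {p. p \<bullet> (H *v p) + 2 * (y \<bullet> p) \<le> \<tau>}"
      and VT: "Vol T = det H powr (- 1 / 2)" .
    have "closed T" "convex T" using T(1) by (auto simp: is_ellipsoid_def closed_ellipsoid convex_ellipsoid)
    then have "a_tilde a x i \<in> T" for i using T(2) polar_subset_iff[OF bd x] by blast
    then have le: "a_tilde a x i \<bullet> (H *v a_tilde a x i) + 2 * (y \<bullet> a_tilde a x i) \<le> \<tau>" for i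
      by (simp add: TH)
    let ?k = "real ?n / (real (?n + 1) * 1)"
    let ?Q = "blkm (?k *\<^sub>R H) (?k *\<^sub>R y) (?k *\<^sub>R y) (1 - ?k * \<tau>)"
    have Q': "lifted_feasible a x ?Q" "det ?Q = kap ?n * det H"
      using lift_quadratic[OF H(1,2) _ le] by simp_all
    have "kap ?n * det H \<le> kap ?n * det M" using max[OF Q'(1)] ge Q'(2) by linarith
    then have HM: "det H \<le> det M" using kap by simp
    have VM: "Vol (ellipsoid c M) = det M powr (- 1 / 2)" by (rule Vol_ellipsoid[OF M])
    have "T = ellipsoid c M" if "Vol T \<le> Vol (ellipsoid c M)"
    proof -
      have "\<not> det H < det M"
        using that powr_less_mono2_neg[of "- 1 / 2" "det H" "det M"] pos_def_det_pos[OF H(1)]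
        by (auto simp: VT VM)
      with HM have "det H = det M" by simp
      then have "is_lifted_opt a x ?Q"
        using Q' max ge by (force simp: is_lifted_opt_iff)
      then have QQ: "?Q = Q" using lifted_opt_unique[OF bd x] opt by blast
      have "G = ?k *\<^sub>R H" "z = ?k *\<^sub>R y" "1 - blk_s Q = ?k * \<tau>"
        unfolding G_def z_def by (simp_all only: QQ[symmetric] blk_blkm)
      then have "p \<in> ellipsoid c M \<longleftrightarrow> ?k * (p \<bullet> (H *v p) + 2 * (y \<bullet> p)) \<le> ?k * \<tau>" for p
        unfolding mem by (simp add: scaleR_matrix_vector_assoc[symmetric] distrib_left mult_ac)
      then have "p \<in> ellipsoid c M \<longleftrightarrow> p \<bullet> (H *v p) + 2 * (y \<bullet> p) \<le> \<tau>" for p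
        using mult_le_cancel_left_pos[of ?k] by simp
      then show ?thesis by (auto simp: TH)
    qed
    moreover have "Vol (ellipsoid c M) \<le> Vol T"
      unfolding VT VM using HM pos_def_det_pos[OF H(1)] by (intro powr_mono2') auto
    ultimately show ?thesis by blast
  qed
  have isM: "is_ellipsoid (ellipsoid c M)" using M by (auto simp: is_ellipsoid_def)
  have "MinCE ?P = ellipsoid c M"
    unfolding MinCE_def
    by (rule the_equality) (use least isM sub in blast)+
  then show "vpot a x = - ln (det (blk_G Q) / beta Q ^ ?n) / 2"
    by (simp add: vpot_def ln_Vol_ellipsoid[OF M] detM G_def b_def)
qed

text \<open>Upper bounds on the potential start here: the lift of a containing ellipsoid competes
  with \<open>lifted_opt a x\<close>.\<close>

lemma vpot_le_quadratic:
  fixes G :: "real ^ 'n ^ 'n"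
  assumes x: "x \<in> interior (hpoly a)"
    and G: "pos_def G" and b: "b = \<sigma> + z \<bullet> (matrix_inv G *v z)" "b > 0"
    and le: "\<And>i. a_tilde a x i \<bullet> (G *v a_tilde a x i) + 2 * (z \<bullet> a_tilde a x i) \<le> \<sigma>"
  shows "vpot a x \<le> - ln (det G / b ^ CARD('n)) / 2"
proof -
  let ?Q = "lifted_opt a x" and ?n = "CARD('n)"
  have kap: "kap ?n > 0" by (rule kap_pos) simp
  obtain Q' where "lifted_feasible a x Q'" "det Q' = kap ?n * (det G / b ^ ?n)"
    using lift_quadratic[OF G b le] by blast
  then have "kap ?n * (det G / b ^ ?n) \<le> kap ?n * (det (blk_G ?Q) / beta ?Q ^ ?n)"
    using lifted_opt_is_opt[OF bd x] det_lifted_opt[OF x] by (simp add: is_lifted_opt_iff) metis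
  then have "det G / b ^ ?n \<le> det (blk_G ?Q) / beta ?Q ^ ?n" using mult_le_cancel_left_pos[OF kap] by blast
  moreover have "det G / b ^ ?n > 0" using pos_def_det_pos[OF G] b by simp
  ultimately have "ln (det G / b ^ ?n) \<le> ln (det (blk_G ?Q) / beta ?Q ^ ?n)" by simp
  then show ?thesis by (simp add: vpot_eq[OF x])
qed

text \<open>Both sides are explicit in the blocks of the optimizer and differ by
  \<open>(n + 1) / 2 * (ln b - ln (1 - s))\<close> with \<open>b\<close> its \<open>beta\<close> and
  \<open>s\<close> its \<open>blk_s\<close>, which is nonnegative because
  \<open>1 - s \<le> b\<close>.\<close>

lemma update_ellipsoid_volume:
  assumes x: "x \<in> interior (hpoly a)"
  shows "- vpot a x \<le> ln (Vol (ellipsoid (K_exact a x) (E_exact a x)))"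
proof -
  let ?Q = "lifted_opt a x" and ?n = "CARD('n)"
  have feas: "lifted_feasible a x ?Q" using lifted_opt_is_opt[OF bd x] by (simp add: is_lifted_opt_def)
  note b = lifted_feasible_beta_pos[OF bd x feas]
  have "pos_def (blk_G ?Q)" using feas by (intro pos_def_lmat) (simp add: lifted_feasible_def)
  then have G: "det (blk_G ?Q) > 0" by (rule pos_def_det_pos)
  have "ln (1 - blk_s ?Q) \<le> ln (beta ?Q)" using b by simp
  then have "(real ?n + 1) * ln (1 - blk_s ?Q) \<le> (real ?n + 1) * ln (beta ?Q)"
    by (intro mult_left_mono) auto
  moreover have "ln (det (E_exact a x)) = (real ?n + 1) * ln (1 - blk_s ?Q) - ln (beta ?Q) - ln (det (blk_G ?Q))"
  proof -
    define X where "X = (1 - blk_s ?Q) ^ (?n + 1)"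
    have "X > 0" "ln X = (real ?n + 1) * ln (1 - blk_s ?Q)"
      using b(1) ln_realpow[of "1 - blk_s ?Q" "?n + 1"] by (simp_all add: X_def del: power_Suc)
    then show ?thesis
      using b G by (simp add: E_exact_def E_upd_eq(3)[OF bd x feas, folded X_def] ln_div ln_mult)
  qed
  moreover have "vpot a x = - (ln (det (blk_G ?Q)) - real ?n * ln (beta ?Q)) / 2"
    using b G by (simp add: vpot_eq[OF x] ln_div ln_realpow)
  ultimately show ?thesis
    by (simp add: K_exact_def E_exact_def ln_Vol_ellipsoid[OF E_upd_eq(1)[OF bd x feas]] algebra_simps)
qed

text \<open>The ellipsoid polar to an inscribed one with respect to the point \<open>y\<close> contains the polar of
  the polytope.\<close>
lemma vpot_le_inscribed:
  fixes E :: "real ^ 'n ^ 'n"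
  assumes E: "pos_def E" and sub: "ellipsoid k E \<subseteq> hpoly a"
    and y: "y \<in> interior (hpoly a)" and t: "(y - k) \<bullet> (E *v (y - k)) < 1"
  shows "vpot a y \<le> ln (det E) / 2 - (real CARD('n) + 1) / 2 * ln (1 - (y - k) \<bullet> (E *v (y - k)))"
proof -
  let ?n = "CARD('n)"
  define u B t where "u = k - y" and "B = matrix_inv E" and "t = u \<bullet> (E *v u)"
  have t_eq: "(y - k) \<bullet> (E *v (y - k)) = t"
  proof -
    have "y - k = - u" by (simp add: u_def)
    then show ?thesis
      by (simp only: t_def linear_neg[OF matrix_vector_mul_linear] inner_minus_left inner_minus_right minus_minus)
  qed
  have t1: "t < 1" using t by (simp add: t_eq)
  have B: "pos_def B" unfolding B_def by (rule pos_def_matrix_inv[OF E])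
  have BE: "B *v (E *v u) = u" by (simp add: B_def pos_def_matrix_inv_mult[OF E])
  \<comment> \<open>The polar about \<open>y\<close> is
    \<open>u . p + sqrt (p . B p) \<le> 1\<close> in the variable \<open>p\<close>. Squaring gives a
    quadratic inequality with matrix \<open>G\<close>, linear part \<open>u\<close> and right-hand
    side 1; \<open>G\<close> is positive definite because \<open>t < 1\<close>.\<close>
  define G where "G = B + (- 1) *\<^sub>R outer u u"
  have G_vec: "G *v v = B *v v - (u \<bullet> v) *\<^sub>R u" for v
    by (simp add: G_def matrix_vector_mult_add_rdistrib matrix_vector_mult_diff_rdistrib outer_mult_vector)
  have G: "pos_def G" unfolding pos_def_def
  proof (intro conjI allI impI)
    show "transpose G = G"
      by (simp only: G_def transpose_add transpose_scalar transpose_outer pos_defD(1)[OF B])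
    fix v :: "real ^ 'n" assume v: "v \<noteq> 0"
    have "(u \<bullet> v)\<^sup>2 \<le> t * (v \<bullet> (B *v v))"
      using pos_def_Cauchy_Schwarz[OF B, of u v] by (simp add: t_def B_def matrix_inv_matrix_inv[OF E])
    also have "\<dots> < 1 * (v \<bullet> (B *v v))" by (intro mult_strict_right_mono t1 pos_defD(2)[OF B v])
    finally show "v \<bullet> (G *v v) > 0" by (simp add: G_vec inner_simps inner_commute power2_eq_square)
  qed
  have "G *v (E *v u) = (1 - t) *\<^sub>R u" by (simp add: G_vec BE t_def algebra_simps)
  then have "G *v ((1 / (1 - t)) *\<^sub>R (E *v u)) = u" using t1 by (simp add: matrix_vector_mult_scaleR)
  then have Giu: "matrix_inv G *v u = (1 / (1 - t)) *\<^sub>R (E *v u)"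
    using pos_def_matrix_inv_mult[OF G] by metis
  have b: "1 / (1 - t) = 1 + u \<bullet> (matrix_inv G *v u)" "1 / (1 - t) > 0"
    using t1 by (simp_all add: Giu t_def[symmetric] field_simps)
  have detG: "det G = (1 - t) / det E"
  proof -
    have "outer u u = outer (B *v (E *v u)) (B *v (E *v u))" by (simp only: BE)
    then have "det G = (1 + (- 1) * ((E *v u) \<bullet> (B *v (E *v u)))) * det B"
      unfolding G_def by (simp only: det_rank_one_update[OF pos_defD(1)[OF B]])
    then show ?thesis by (simp only: BE) (simp add: t_def inner_commute B_def det_matrix_inv[OF E])
  qed
  have "vpot a y \<le> - ln (det G / (1 / (1 - t)) ^ ?n) / 2"
  proof (rule vpot_le_quadratic[OF y G b])
    fix i
    define p q where "p = 1 - a i \<bullet> y" and "q = a_tilde a y i \<bullet> u"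
    have p: "p > 0" using y by (simp add: p_def interior_hpoly)
    have ai: "a i = p *\<^sub>R a_tilde a y i" using a_tilde_scale[OF y, of i] by (simp add: p_def)
    have "a i \<bullet> k + sqrt (a i \<bullet> (B *v a i)) \<le> 1"
      using sub by (simp add: ellipsoid_subset_hpoly_iff[OF E] B_def)
    moreover have "a i \<bullet> k = 1 - p + p * q"
    proof -
      have "a i \<bullet> u = p * q" using arg_cong[OF ai, of "\<lambda>v. v \<bullet> u"] by (simp add: q_def)
      then show ?thesis by (simp add: p_def u_def inner_diff_right)
    qed
    ultimately have "sqrt (a i \<bullet> (B *v a i)) \<le> p * (1 - q)" by (simp add: algebra_simps)
    then have "a i \<bullet> (B *v a i) \<le> (p * (1 - q))\<^sup>2" using sqrt_le_D by blast
    moreover have "a i \<bullet> (B *v a i) = p\<^sup>2 * (a_tilde a y i \<bullet> (B *v a_tilde a y i))"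
    proof -
      have "(p *\<^sub>R v) \<bullet> (B *v (p *\<^sub>R v)) = p\<^sup>2 * (v \<bullet> (B *v v))" for v
        by (simp add: matrix_vector_mult_scaleR power2_eq_square)
      from this[of "a_tilde a y i"] show ?thesis by (simp only: ai[symmetric])
    qed
    ultimately have "a_tilde a y i \<bullet> (B *v a_tilde a y i) \<le> (1 - q)\<^sup>2"
      using p by (simp add: power_mult_distrib)
    then show "a_tilde a y i \<bullet> (G *v a_tilde a y i) + 2 * (u \<bullet> a_tilde a y i) \<le> 1"
      by (simp add: G_vec inner_simps inner_commute q_def power2_eq_square algebra_simps)
  qed
  also have "det G / (1 / (1 - t)) ^ ?n = (1 - t) ^ (?n + 1) / det E"
    by (simp add: detG power_divide)
  also have "- ln \<dots> / 2 = ln (det E) / 2 - (real ?n + 1) / 2 * ln (1 - t)"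
  proof -
    have "ln ((1 - t) ^ (?n + 1) / det E) = (real ?n + 1) * ln (1 - t) - ln (det E)"
      using t1 pos_def_det_pos[OF E] ln_realpow[of "1 - t" "?n + 1"]
      by (subst ln_div) (simp_all del: power_Suc)
    then show ?thesis by (simp add: field_simps)
  qed
  finally show ?thesis by (simp add: t_eq)
qed

section \<open>The maximal inscribed ellipsoid\<close>

lemma normals_span:
  assumes "\<And>i. a i \<bullet> v = 0"
  shows "v = 0"
  using assms by (intro bounded_hpoly_recession[OF bd]) simp

text \<open>In the variable \<open>A\<close>, the inverse of \<open>E\<close>, the support
  inequalities are closed conditions that make sense for singular matrices, and maximal volume means
  maximal \<open>det A\<close>.\<close>

lemma max_inscribed_exists:
  shows "\<exists>(c :: real ^ 'n) E. pos_def E \<and> ellipsoid c E \<subseteq> hpoly a \<and>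
    (\<forall>c' E'. pos_def E' \<longrightarrow> ellipsoid c' E' \<subseteq> hpoly a \<longrightarrow> det E \<le> det E')"
proof -
  define S :: "((real ^ 'n) \<times> (real ^ 'n ^ 'n)) set" where
    "S = {(c, A). transpose A = A \<and> (\<forall>v. v \<bullet> (A *v v) \<ge> 0)
      \<and> (\<forall>i. a i \<bullet> c + sqrt (a i \<bullet> (A *v a i)) \<le> 1)}"
  obtain B where B: "B > 0" "\<And>c. c \<in> hpoly a \<Longrightarrow> norm c \<le> B" using bd bounded_pos by metis
  let ?l = "lambda_min (\<Sum>i\<in>UNIV. outer (a i) (a i))"
  have l: "?l > 0" by (intro gram_lambda_min(3) normals_span)
  \<comment> \<open>A feasible center has norm at most \<open>B\<close>, so
    \<open>sqrt (a i . A a i)\<close> is at most \<open>1 + norm (a i) * B\<close>, hence at most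
    \<open>C\<close>. Dividing the normals by \<open>C\<close> makes
    \<open>feasible_norm_bound\<close> applicable.\<close>
  define C where "C = 1 + B * (\<Sum>i\<in>UNIV. norm (a i))"
  have C: "C > 0" unfolding C_def using B by (intro add_pos_nonneg mult_nonneg_nonneg sum_nonneg) auto
  have aC: "1 + norm (a i) * B \<le> C" for i
    using mult_left_mono[OF member_le_sum[of i UNIV "\<lambda>i. norm (a i)"], of B] B by (simp add: C_def mult.commute)
  have S_eq: "S = {x. transpose (snd x) = snd x} \<inter> (\<Inter>v. {x. v \<bullet> (snd x *v v) \<ge> 0})
      \<inter> (\<Inter>i. {x. a i \<bullet> fst x + sqrt (a i \<bullet> (snd x *v a i)) \<le> 1})"
    by (auto simp: S_def)
  have cont: "continuous_on UNIV (\<lambda>x :: (real ^ 'n) \<times> (real ^ 'n ^ 'n). v \<bullet> (snd x *v w))" for v w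
    by (rule continuous_on_compose2[OF continuous_on_matrix_form[of UNIV] continuous_on_snd[OF continuous_on_id]]) auto
  have "closed {x :: (real ^ 'n) \<times> (real ^ 'n ^ 'n). transpose (snd x) = snd x}"
    using closed_vimage_snd[OF closed_symmetric] by (simp add: vimage_def)
  then have "closed S" unfolding S_eq
    by (intro closed_Int closed_INT ballI closed_Collect_le continuous_intros cont)
  moreover have "bounded S"
  proof -
    have *: "norm c \<le> B \<and> norm A \<le> real CARD('m) / (?l / C\<^sup>2)" if "(c, A) \<in> S" for c A
    proof
      have A: "transpose A = A" "\<And>v. v \<bullet> (A *v v) \<ge> 0" and
        le: "\<And>i. a i \<bullet> c + sqrt (a i \<bullet> (A *v a i)) \<le> 1" using that by (auto simp: S_def)
      have "a i \<bullet> c \<le> 1" for i using le[of i] A(2)[of "a i"] by (smt (verit) real_sqrt_ge_0_iff)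
      then show cB: "norm c \<le> B" by (intro B) (simp add: hpoly_def)
      show "norm A \<le> real CARD('m) / (?l / C\<^sup>2)"
      proof (rule feasible_norm_bound[OF _ _ A, where h = "\<lambda>i. (1 / C) *\<^sub>R a i"])
        show "?l / C\<^sup>2 > 0" using l C by simp
        have "?l / C\<^sup>2 * (norm v)\<^sup>2 \<le> (\<Sum>i\<in>UNIV. (a i \<bullet> v)\<^sup>2) / C\<^sup>2" for v
          using divide_right_mono[OF gram_lambda_min(1)[of a v], of "C\<^sup>2"] by simp
        then show "?l / C\<^sup>2 * (norm v)\<^sup>2 \<le> (\<Sum>i\<in>UNIV. (((1 / C) *\<^sub>R a i) \<bullet> v)\<^sup>2)" for v
          by (simp add: power_divide sum_divide_distrib)
        fix i
        have "\<bar>a i \<bullet> c\<bar> \<le> norm (a i) * B"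
          using order_trans[OF Cauchy_Schwarz_ineq2 mult_left_mono[OF cB]] by simp
        then have "sqrt (a i \<bullet> (A *v a i)) \<le> C" using le[of i] aC[of i] by linarith
        then have "a i \<bullet> (A *v a i) \<le> C\<^sup>2" by (rule sqrt_le_D)
        then show "((1 / C) *\<^sub>R a i) \<bullet> (A *v ((1 / C) *\<^sub>R a i)) \<le> 1"
          using C by (simp add: matrix_vector_mult_scaleR power2_eq_square pos_divide_le_eq)
      qed
    qed
    have "S \<subseteq> cball 0 B \<times> cball 0 (real CARD('m) / (?l / C\<^sup>2))"
      using * by (auto simp: dist_norm)
    then show ?thesis by (rule bounded_subset[rotated]) (intro bounded_Times bounded_cball)
  qed
  ultimately have "compact S" by (simp add: compact_eq_bounded_closed)
  define r where "r = 1 / (1 + (\<Sum>i\<in>UNIV. (norm (a i))\<^sup>2))"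
  have r0: "1 + (\<Sum>i\<in>UNIV. (norm (a i))\<^sup>2) > 0" by (intro add_pos_nonneg sum_nonneg) auto
  then have r: "r > 0" by (simp add: r_def)
  have I: "pos_def (r *\<^sub>R mat 1 :: real ^ 'n ^ 'n)"
    using r by (intro pos_def_scaleR) (auto simp: pos_def_def)
  have "(norm (a i))\<^sup>2 \<le> (\<Sum>i\<in>UNIV. (norm (a i))\<^sup>2)" for i by (rule member_le_sum) auto
  then have "a i \<bullet> ((r *\<^sub>R mat 1) *v a i) \<le> 1" for i
    using r0 by (simp add: scaleR_matrix_vector_assoc[symmetric] power2_norm_eq_inner[symmetric] r_def
        pos_divide_le_eq add_increasing)
  then have inS: "(0, r *\<^sub>R mat 1) \<in> S"
    using I by (auto simp: S_def pos_defD simp del: scaleR_matrix_vector_assoc)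
  have "continuous_on S (\<lambda>x. det (snd x))"
    by (rule continuous_on_compose2[OF continuous_on_det[of UNIV] continuous_on_snd[OF continuous_on_id]]) auto
  from continuous_attains_sup[OF \<open>compact S\<close> _ this] inS
  obtain c A where cA: "(c, A) \<in> S" and max: "\<And>c' A'. (c', A') \<in> S \<Longrightarrow> det A' \<le> det A" by fastforce
  have "det A > 0" using max[OF inS] pos_def_det_pos[OF I] by linarith
  then have A: "pos_def A" using cA by (intro pos_semidef_det_nonzero_imp_pos_def) (auto simp: S_def)
  show ?thesis
  proof (intro exI conjI allI impI)
    show iA: "pos_def (matrix_inv A)" by (rule pos_def_matrix_inv[OF A])
    show "ellipsoid c (matrix_inv A) \<subseteq> hpoly a"
      using cA by (simp add: ellipsoid_subset_hpoly_iff[OF iA] matrix_inv_matrix_inv[OF A] S_def)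
    fix c' E' assume E': "pos_def E'" "ellipsoid c' E' \<subseteq> hpoly a"
    then have "(c', matrix_inv E') \<in> S"
      by (auto simp: S_def ellipsoid_subset_hpoly_iff pos_defD pos_def_matrix_inv)
    from max[OF this] show "det (matrix_inv A) \<le> det E'"
      using pos_def_det_pos[OF A] pos_def_det_pos[OF E'(1)]
      by (simp add: det_matrix_inv[OF A] det_matrix_inv[OF E'(1)] field_simps)
  qed
qed

text \<open>For two maximal ellipsoids with \<open>inverse E1 = transpose R ** R\<close> and
  \<open>inverse E2 = transpose R ** D ** R\<close>, averaging the factors \<open>R\<close> and \<open>sqrt D ** R\<close> gives an
  inscribed ellipsoid of larger volume unless \<open>D = 1\<close>; if then the centers differ by \<open>2 w\<close>,
  the ellipsoid around the midpoint can be stretched along \<open>w\<close>.\<close>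
lemma max_inscribed_unique:
  fixes c1 c2 :: "real ^ 'n"
  assumes E1: "pos_def E1" "ellipsoid c1 E1 \<subseteq> hpoly a"
    and E2: "pos_def E2" "ellipsoid c2 E2 \<subseteq> hpoly a"
    and det: "det E1 = det E2"
    and min: "\<And>c' E'. pos_def E' \<Longrightarrow> ellipsoid c' E' \<subseteq> hpoly a \<Longrightarrow> det E1 \<le> det E'"
  shows "c1 = c2 \<and> E1 = E2"
proof -
  define A1 A2 where "A1 = matrix_inv E1" and "A2 = matrix_inv E2"
  have A1: "pos_def A1" and A2: "pos_def A2"
    using E1 E2 by (auto simp: A1_def A2_def pos_def_matrix_inv)
  have le1: "a i \<bullet> c1 + sqrt (a i \<bullet> (A1 *v a i)) \<le> 1" and le2: "a i \<bullet> c2 + sqrt (a i \<bullet> (A2 *v a i)) \<le> 1" for i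
    using E1 E2 by (auto simp: A1_def A2_def ellipsoid_subset_hpoly_iff)
  have max: "det A \<le> det A1" if "pos_def A" "\<And>i. a i \<bullet> c + sqrt (a i \<bullet> (A *v a i)) \<le> 1" for A c
  proof -
    have "det E1 \<le> det (matrix_inv A)"
      using that by (intro min[of _ c]) (simp_all add: pos_def_matrix_inv ellipsoid_subset_hpoly_iff matrix_inv_matrix_inv)
    then show ?thesis using pos_def_det_pos[OF that(1)] pos_def_det_pos[OF E1(1)]
      by (simp add: A1_def det_matrix_inv E1 that field_simps)
  qed
  define m where "m = (1 / 2) *\<^sub>R (c1 + c2)"
  have am: "a i \<bullet> m = (a i \<bullet> c1 + a i \<bullet> c2) / 2" for i by (simp add: m_def inner_simps)
  from simultaneous_diagonalization[OF A1 pos_defD(1)[OF A2]] obtain R :: "real ^ 'n ^ 'n" and d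
    where R: "invertible R" "A1 = transpose R ** R" "A2 = transpose R ** dmat d ** R" .
  have d: "d i > 0" for i
  proof -
    obtain S where S: "R ** S = mat 1" "S ** R = mat 1" using R by (auto simp: invertible_def)
    have "transpose S ** A2 ** S = transpose (R ** S) ** dmat d ** (R ** S)"
      by (simp add: R matrix_transpose_mul matrix_mul_assoc)
    moreover have "pos_def (transpose S ** A2 ** S)"
      using S by (intro pos_def_congruence A2) (auto simp: invertible_def)
    ultimately show ?thesis by (simp add: S pos_def_dmat_iff)
  qed
  have detR: "(det R)\<^sup>2 > 0" using R(1) by (simp add: invertible_det_nz)
  have "det A1 = det A2" using det by (simp add: A1_def A2_def det_matrix_inv E1 E2)
  then have prod_d: "prod d UNIV = 1" using R(1)[unfolded invertible_det_nz] by (simp add: R det_mul det_dmat power2_eq_square)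
  define e where "e i = (1 + sqrt (d i)) / 2" for i
  have e: "e i > 0" for i using d[of i] by (simp add: e_def add_pos_nonneg)
  define S where "S = dmat e ** R"
  have SS: "transpose S ** S = transpose R ** dmat (\<lambda>i. e i * e i) ** R"
  proof -
    have "transpose S ** S = transpose R ** (dmat e ** dmat e) ** R"
      by (simp add: S_def matrix_transpose_mul matrix_mul_assoc)
    then show ?thesis by (simp only: dmat_mult)
  qed
  let ?D = "dmat (\<lambda>i. sqrt (d i))"
  have A2': "A2 = transpose (?D ** R) ** (?D ** R)"
  proof -
    have "transpose (?D ** R) ** (?D ** R) = transpose R ** (?D ** ?D) ** R"
      by (simp add: matrix_transpose_mul matrix_mul_assoc)
    then show ?thesis using d by (simp add: dmat_mult R less_imp_le)
  qed
  have "det (transpose S ** S) \<le> det A1"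
  proof (rule max[of _ m])
    show "pos_def (transpose S ** S)" unfolding SS
      using e R by (intro pos_def_congruence) (auto simp: pos_def_dmat_iff)
    fix i
    have "S *v a i = (1 / 2) *\<^sub>R (R *v a i + (?D ** R) *v a i)"
      by (simp add: S_def matrix_vector_mul_assoc[symmetric] dmat_mult_vector vec_eq_iff e_def field_simps)
    then have "norm (S *v a i) \<le> (norm (R *v a i) + norm ((?D ** R) *v a i)) / 2"
      by (simp only:) (simp add: norm_triangle_ineq)
    then have "sqrt (a i \<bullet> ((transpose S ** S) *v a i))
        \<le> (sqrt (a i \<bullet> (A1 *v a i)) + sqrt (a i \<bullet> (A2 *v a i))) / 2"
      unfolding A2' R(2) quadratic_form_factor by simp
    moreover have "y + X \<le> 1" if "X \<le> (p + q) / 2" "u + p \<le> 1" "v + q \<le> 1" "y = (u + v) / 2"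
      for X p q u v y :: real using that by (simp add: field_simps)
    ultimately show "a i \<bullet> m + sqrt (a i \<bullet> ((transpose S ** S) *v a i)) \<le> 1"
      using le1[of i] le2[of i] am[of i] by blast
  qed
  then have prod_e: "(\<Prod>i\<in>UNIV. e i * e i) \<le> 1"
    using detR by (simp add: SS R(2) det_mul det_dmat power2_eq_square mult_ac)
      (simp add: mult_le_cancel_left2 mult.assoc[symmetric])
  \<comment> \<open>AM-GM for 1 and \<open>sqrt (d i)\<close>. The product of the left-hand sides is
    1 and that of the right-hand sides at most 1, so equality holds in every coordinate, which means
    \<open>d i = 1\<close>.\<close>
  have ge: "sqrt (d i) \<le> e i * e i" for i
  proof -
    have "0 \<le> (1 - sqrt (d i))\<^sup>2" by simp
    then show ?thesis using d[of i] by (simp add: e_def power2_eq_square field_simps)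
  qed
  have "(\<Sum>i\<in>UNIV. ln (e i * e i) - ln (sqrt (d i))) \<le> 0"
  proof -
    have "(\<Sum>i\<in>UNIV. ln (e i * e i)) = ln (\<Prod>i\<in>UNIV. e i * e i)"
      using e by (subst ln_prod) (auto simp: less_imp_neq[symmetric])
    also have "\<dots> \<le> 0" using prod_e e by (simp add: ln_le_zero_iff prod_pos)
    finally have 1: "(\<Sum>i\<in>UNIV. ln (e i * e i)) \<le> 0" .
    have "(\<Sum>i\<in>UNIV. ln (sqrt (d i))) = (\<Sum>i\<in>UNIV. ln (d i)) / 2"
      unfolding sum_divide_distrib using d by (intro sum.cong ln_sqrt) (auto intro: less_imp_le)
    also have "(\<Sum>i\<in>UNIV. ln (d i)) = ln (prod d UNIV)"
      by (rule ln_prod[symmetric]) (use less_imp_neq[OF d, symmetric] in simp_all)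
    finally have "(\<Sum>i\<in>UNIV. ln (sqrt (d i))) = 0" by (simp add: prod_d)
    with 1 show ?thesis by (simp add: sum_subtractf)
  qed
  moreover have nn: "ln (e i * e i) - ln (sqrt (d i)) \<ge> 0" for i using ge[of i] d[of i] e[of i] by simp
  ultimately have "(\<Sum>i\<in>UNIV. ln (e i * e i) - ln (sqrt (d i))) = 0" by (simp add: antisym sum_nonneg)
  then have "ln (e i * e i) - ln (sqrt (d i)) = 0" for i
    using nn by (subst (asm) sum_nonneg_eq_0_iff) auto
  then have "ln (e i * e i) = ln (sqrt (d i))" for i by (metis eq_iff_diff_eq_0)
  then have "e i * e i = sqrt (d i)" for i
    using ln_inj_iff[of "e i * e i" "sqrt (d i)"] mult_pos_pos[OF e e, of i i] d[of i]
    by (metis real_sqrt_gt_zero)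
  moreover have "s = 1" if "((1 + s) / 2) * ((1 + s) / 2) = s" for s :: real
  proof -
    have "(1 - s) * (1 - s) = 0" using that by (simp add: algebra_simps)
    then show ?thesis by simp
  qed
  ultimately have "sqrt (d i) = 1" for i unfolding e_def by metis
  then have "d = (\<lambda>i. 1)" by (simp add: fun_eq_iff)
  then have A12: "A1 = A2" by (simp add: R dmat_1)
  have "c1 = c2"
  proof (rule ccontr)
    assume ne: "c1 \<noteq> c2"
    define w where "w = (1 / 2) *\<^sub>R (c1 - c2)"
    have w: "w \<noteq> 0" using ne by (simp add: w_def)
    \<comment> \<open>At the midpoint, constraint \<open>i\<close> has slack at least
      \<open>abs (a i . w)\<close>, half the difference of its values at the two centers; this pays
      for the rank-one term.\<close>
    define A where "A = A1 + 1 *\<^sub>R outer w w"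
    have A_vec: "v \<bullet> (A *v v) = v \<bullet> (A1 *v v) + (v \<bullet> w)\<^sup>2" for v
      by (simp add: A_def matrix_vector_mult_add_rdistrib outer_mult_vector inner_simps inner_commute power2_eq_square)
    have "det A \<le> det A1"
    proof (rule max[of _ m])
      show "pos_def A" unfolding pos_def_def
        by (auto simp: A_def transpose_add pos_defD(1)[OF A1]) (use A_vec in \<open>simp add: A_def add_pos_nonneg pos_defD(2)[OF A1]\<close>)
      fix i
      have "sqrt (a i \<bullet> (A *v a i)) \<le> sqrt (a i \<bullet> (A1 *v a i)) + \<bar>a i \<bullet> w\<bar>"
        unfolding A_vec using sqrt_add_le_add_sqrt[of "a i \<bullet> (A1 *v a i)" "(a i \<bullet> w)\<^sup>2"] pos_defD(3)[OF A1] by simp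
      moreover have "a i \<bullet> w = (a i \<bullet> c1 - a i \<bullet> c2) / 2" by (simp add: w_def inner_simps)
      moreover have "y + X \<le> 1" if "X \<le> p + \<bar>t\<bar>" "t = (u - v) / 2" "u + p \<le> 1" "v + p \<le> 1" "y = (u + v) / 2"
        for X p t u v y :: real using that by (simp add: field_simps abs_if split: if_splits)
      ultimately show "a i \<bullet> m + sqrt (a i \<bullet> (A *v a i)) \<le> 1"
        using le1[of i] le2[of i, folded A12] am[of i] by blast
    qed
    moreover have "det A = (1 + w \<bullet> (matrix_inv A1 *v w)) * det A1"
    proof -
      have "A1 *v (matrix_inv A1 *v w) = w" by (rule pos_def_mult_matrix_inv[OF A1])
      then show ?thesis using det_rank_one_update[OF pos_defD(1)[OF A1], of 1 "matrix_inv A1 *v w"]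
        by (simp only: A_def mult_1 inner_commute[of _ w])
    qed
    moreover have "w \<bullet> (matrix_inv A1 *v w) * det A1 > 0"
      by (intro mult_pos_pos pos_defD(2)[OF pos_def_matrix_inv[OF A1]] w pos_def_det_pos A1)
    ultimately show False by (simp add: distrib_right)
  qed
  moreover have "E1 = E2" using A12 E1 E2 by (metis A1_def A2_def matrix_inv_matrix_inv)
  ultimately show ?thesis ..
qed

lemma MaxIE_ellipsoid:
  obtains c E where "pos_def E" "MaxIE (hpoly a) = ellipsoid c E" "ellipsoid c E \<subseteq> hpoly a"
    "\<forall>c' E'. pos_def E' \<longrightarrow> ellipsoid c' E' \<subseteq> hpoly a \<longrightarrow> det E \<le> det E'"
proof -
  obtain c :: "real ^ 'n" and E where E: "pos_def E" "ellipsoid c E \<subseteq> hpoly a"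
    and min: "\<forall>c' E'. pos_def E' \<longrightarrow> ellipsoid c' E' \<subseteq> hpoly a \<longrightarrow> det E \<le> det E'"
    using max_inscribed_exists by blast
  have "MaxIE (hpoly a) = ellipsoid c E"
    unfolding MaxIE_def
  proof (rule the_equality)
    show "is_ellipsoid (ellipsoid c E) \<and> ellipsoid c E \<subseteq> hpoly a \<and>
      (\<forall>T. is_ellipsoid T \<and> T \<subseteq> hpoly a \<longrightarrow> Vol T \<le> Vol (ellipsoid c E))"
    proof (intro conjI allI impI E)
      show "is_ellipsoid (ellipsoid c E)" using E by (auto simp: is_ellipsoid_def)
      fix T assume T: "is_ellipsoid T \<and> T \<subseteq> hpoly a"
      then obtain c' E' where T': "pos_def E'" "T = ellipsoid c' E'" by (auto simp: is_ellipsoid_def)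
      with T have "det E \<le> det E'" by (intro min[rule_format]) auto
      then show "Vol T \<le> Vol (ellipsoid c E)"
        using pos_def_det_pos[OF E(1)] by (simp only: T' Vol_ellipsoid E(1)) (intro powr_mono2', auto)
    qed
    fix S assume S: "is_ellipsoid S \<and> S \<subseteq> hpoly a \<and>
      (\<forall>T. is_ellipsoid T \<and> T \<subseteq> hpoly a \<longrightarrow> Vol T \<le> Vol S)"
    then obtain c' E' where S': "pos_def E'" "S = ellipsoid c' E'" by (auto simp: is_ellipsoid_def)
    have "is_ellipsoid (ellipsoid c E)" using E(1) by (auto simp: is_ellipsoid_def)
    then have "Vol (ellipsoid c E) \<le> Vol S" using S E(2) by blast
    then have "\<not> det E < det E'"
      using powr_less_mono2_neg[of "- 1 / 2" "det E" "det E'"] pos_def_det_pos[OF E(1)]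
      by (auto simp: S' Vol_ellipsoid E(1))
    moreover have sub: "ellipsoid c' E' \<subseteq> hpoly a" using S S' by simp
    ultimately have "det E = det E'" using min S'(1) sub by force
    from max_inscribed_unique[OF E S'(1) sub this min[rule_format]] show "S = ellipsoid c E" by (simp add: S')
  qed
  from that[OF E(1) this E(2) min] show thesis .
qed

lemma Vol_MaxIE_pos: "Vol (MaxIE (hpoly a)) > 0"
  by (rule MaxIE_ellipsoid) (simp add: Vol_ellipsoid pos_def_det_pos less_imp_neq[OF pos_def_det_pos, symmetric])

lemma ln_Vol_le_MaxIE:
  assumes E: "pos_def E" "ellipsoid c E \<subseteq> hpoly a"
  shows "ln (Vol (ellipsoid c E)) \<le> ln (Vol (MaxIE (hpoly a)))"
proof (rule MaxIE_ellipsoid)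
  fix c' :: "real ^ 'n" and E' assume *: "pos_def E'" "MaxIE (hpoly a) = ellipsoid c' E'"
    "\<forall>c E. pos_def E \<longrightarrow> ellipsoid c E \<subseteq> hpoly a \<longrightarrow> det E' \<le> det E"
  have "ln (det E') \<le> ln (det E)" using *(3)[rule_format, OF E] pos_def_det_pos[OF *(1)] by simp
  then show ?thesis by (simp add: * ln_Vol_ellipsoid E)
qed

text \<open>At the center the logarithmic term of \<open>vpot_le_inscribed\<close> vanishes, which
  gives one inequality. For the other, the exact update of the center is inscribed and cannot have
  larger volume than the maximal ellipsoid.\<close>

lemma vpot_MaxIE_center: "vpot a (ell_center (MaxIE (hpoly a))) = - ln (Vol (MaxIE (hpoly a)))"
proof (rule MaxIE_ellipsoid)
  fix c :: "real ^ 'n" and E assume *: "pos_def E" "MaxIE (hpoly a) = ellipsoid c E" "ellipsoid c E \<subseteq> hpoly a"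
  have c: "c \<in> interior (hpoly a)" using * by (intro ellipsoid_center_interior)
  have "vpot a c \<le> - ln (Vol (MaxIE (hpoly a)))"
    using vpot_le_inscribed[OF *(1,3) c] by (simp add: * ln_Vol_ellipsoid)
  moreover have "- vpot a c \<le> ln (Vol (MaxIE (hpoly a)))"
  proof -
    have feas: "lifted_feasible a c (lifted_opt a c)"
      using lifted_opt_is_opt[OF bd c] by (simp add: is_lifted_opt_def)
    have "ln (Vol (ellipsoid (K_exact a c) (E_exact a c))) \<le> ln (Vol (MaxIE (hpoly a)))"
      unfolding K_exact_def E_exact_def
      by (intro ln_Vol_le_MaxIE E_upd_eq(1)[OF bd c feas] update_ellipsoid_subset[OF bd c feas])
    with update_ellipsoid_volume[OF c] show ?thesis by linarith
  qed
  moreover have "ell_center (MaxIE (hpoly a)) = c" using * by (simp add: ell_center_ellipsoid)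
  ultimately show ?thesis by simp
qed

lemma delta_v_nonneg:
  assumes x: "x \<in> interior (hpoly a)"
  shows "delta_v a x \<ge> 0"
proof -
  have feas: "lifted_feasible a x (lifted_opt a x)"
    using lifted_opt_is_opt[OF bd x] by (simp add: is_lifted_opt_def)
  have "ln (Vol (ellipsoid (K_exact a x) (E_exact a x))) \<le> ln (Vol (MaxIE (hpoly a)))"
    unfolding K_exact_def E_exact_def
    by (intro ln_Vol_le_MaxIE E_upd_eq(1)[OF bd x feas] update_ellipsoid_subset[OF bd x feas])
  with update_ellipsoid_volume[OF x] show ?thesis by (simp add: delta_v_def vpot_MaxIE_center)
qed

lemma update_ellipsoid_volume_delta:
  assumes x: "x \<in> interior (hpoly a)"
  shows "ln (Vol (MaxIE (hpoly a))) - delta_v a x \<le> ln (Vol (ellipsoid (K_exact a x) (E_exact a x)))"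
  using update_ellipsoid_volume[OF x] by (simp add: delta_v_def vpot_MaxIE_center)

end

section \<open>Differentiability of the potential\<close>

lemma tendsto_hvec:
  fixes a :: "'m::finite \<Rightarrow> real ^ 'n"
  assumes x: "x \<in> interior (hpoly a)"
  shows "((\<lambda>y. hvec a y i) \<longlongrightarrow> hvec a x i) (at x)"
proof (rule vec_tendstoI)
  fix k :: "'n + unit"
  have "1 - a i \<bullet> x \<noteq> 0" using x by (auto simp: interior_hpoly dest: spec[of _ i])
  then have "((\<lambda>y. a_tilde a y i) \<longlongrightarrow> a_tilde a x i) (at x)"
    unfolding a_tilde_def by (intro tendsto_intros)
  then show "((\<lambda>y. hvec a y i $ k) \<longlongrightarrow> hvec a x i $ k) (at x)"
    by (cases k) (auto simp: hvec_def intro: tendsto_vec_nth)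
qed

text \<open>By \<open>(p - q)\<^sup>2 \<le> 2 * p\<^sup>2 + 2 * q\<^sup>2\<close>: half of
  \<open>l\<close> goes to the perturbation and half of the rest to the factor 2. This keeps the
  optimizers near a point in one norm ball.\<close>

lemma gram_perturbation:
  fixes h h' :: "'i::finite \<Rightarrow> real ^ 'k"
  assumes h: "\<And>v. l * (norm v)\<^sup>2 \<le> (\<Sum>i\<in>UNIV. (h i \<bullet> v)\<^sup>2)"
    and d: "(\<Sum>i\<in>UNIV. (norm (h' i - h i))\<^sup>2) \<le> l / 4"
  shows "l / 4 * (norm v)\<^sup>2 \<le> (\<Sum>i\<in>UNIV. (h' i \<bullet> v)\<^sup>2)"
proof -
  have "(h i \<bullet> v)\<^sup>2 \<le> 2 * (h' i \<bullet> v)\<^sup>2 + 2 * ((norm (h' i - h i))\<^sup>2 * (norm v)\<^sup>2)" for i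
  proof -
    have "(h i \<bullet> v)\<^sup>2 = (h' i \<bullet> v - (h' i - h i) \<bullet> v)\<^sup>2" by (simp add: inner_diff_left)
    also have "\<dots> \<le> 2 * (h' i \<bullet> v)\<^sup>2 + 2 * ((h' i - h i) \<bullet> v)\<^sup>2"
      using zero_le_power2[of "h' i \<bullet> v + (h' i - h i) \<bullet> v"] by (simp add: power2_eq_square algebra_simps)
    also have "((h' i - h i) \<bullet> v)\<^sup>2 \<le> (norm (h' i - h i))\<^sup>2 * (norm v)\<^sup>2"
      by (metis Cauchy_Schwarz_ineq power2_norm_eq_inner)
    finally show ?thesis by simp
  qed
  then have "(\<Sum>i\<in>UNIV. (h i \<bullet> v)\<^sup>2)
      \<le> (\<Sum>i\<in>UNIV. 2 * (h' i \<bullet> v)\<^sup>2 + 2 * ((norm (h' i - h i))\<^sup>2 * (norm v)\<^sup>2))"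
    by (intro sum_mono)
  also have "\<dots> = 2 * (\<Sum>i\<in>UNIV. (h' i \<bullet> v)\<^sup>2) + 2 * ((\<Sum>i\<in>UNIV. (norm (h' i - h i))\<^sup>2) * (norm v)\<^sup>2)"
    by (simp add: sum.distrib sum_distrib_left sum_distrib_right)
  also have "\<dots> \<le> 2 * (\<Sum>i\<in>UNIV. (h' i \<bullet> v)\<^sup>2) + 2 * (l / 4 * (norm v)\<^sup>2)"
    using d by (intro add_left_mono mult_left_mono mult_right_mono) auto
  finally show ?thesis using h[of v] by simp
qed

lemma quadratic_form_perturbation:
  fixes Q :: "real ^ 'k ^ 'k"
  assumes sym: "transpose Q = Q" and Q: "norm Q \<le> B"
  shows "h' \<bullet> (Q *v h') \<le> h \<bullet> (Q *v h) + B * (norm (h' - h) * (norm h' + norm h))"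
proof -
  have "h' \<bullet> (Q *v h') - h \<bullet> (Q *v h) = (h' - h) \<bullet> (Q *v (h' + h))"
    using inner_matrix_vector_symmetric[OF sym, of h' h]
    by (simp add: matrix_vector_right_distrib inner_simps inner_commute)
  also have "\<dots> \<le> norm Q * norm (h' - h) * norm (h' + h)"
    using abs_quadratic_form_le[of "h' - h" Q "h' + h"] by linarith
  also have "\<dots> \<le> B * norm (h' - h) * (norm h' + norm h)"
    using Q order_trans[OF norm_ge_zero Q] by (intro mult_mono norm_triangle_ineq mult_right_mono) auto
  finally show ?thesis by (simp add: mult.assoc)
qed

context
  fixes a :: "'m::finite \<Rightarrow> real ^ 'n"
  assumes bd: "bounded (hpoly a)"
begin

text \<open>After division by \<open>1 + \<eta>\<close>, the optimizers at \<open>x\<close> and at a nearby point \<open>y\<close> are feasible for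
  each other's problem, so the gap estimate at \<open>x\<close> applies.\<close>
lemma tendsto_lifted_opt:
  assumes x: "x \<in> interior (hpoly a)"
  shows "(lifted_opt a \<longlongrightarrow> lifted_opt a x) (at x)"
proof -
  define l where "l = lambda_min (\<Sum>i\<in>UNIV. outer (hvec a x i) (hvec a x i))"
  have l: "l > 0" unfolding l_def by (rule hvec_gram_pos[OF bd x])
  have gram: "l * (norm v)\<^sup>2 \<le> (\<Sum>i\<in>UNIV. (hvec a x i \<bullet> v)\<^sup>2)" for v
    unfolding l_def by (rule gram_lambda_min)
  define m where "m = real CARD('m)"
  define k where "k = real CARD('n + unit)"
  define B where "B = m / (l / 4)"
  have B: "B \<ge> 0" using l by (simp add: B_def m_def)
  \<comment> \<open>\<open>\<eta> y\<close> bounds the amount by which the optimizer for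
    \<open>x\<close> or \<open>y\<close> can violate the constraints of the other point;
    \<open>B\<close> bounds the norm of both optimizers.\<close>
  define \<eta> where "\<eta> y = (\<Sum>i\<in>UNIV. B * (norm (hvec a y i - hvec a x i) * (norm (hvec a y i) + norm (hvec a x i))))" for y
  have \<eta>0: "\<eta> y \<ge> 0" for y unfolding \<eta>_def using B by (intro sum_nonneg mult_nonneg_nonneg) auto
  have term_le_\<eta>: "B * (norm (hvec a y i - hvec a x i) * (norm (hvec a y i) + norm (hvec a x i))) \<le> \<eta> y" for y i
    unfolding \<eta>_def using B
      member_le_sum[of i UNIV "\<lambda>i. B * (norm (hvec a y i - hvec a x i) * (norm (hvec a y i) + norm (hvec a x i)))"]
    by simp
  have "(\<eta> \<longlongrightarrow> (\<Sum>i\<in>(UNIV::'m set). B * (norm (hvec a x i - hvec a x i) * (norm (hvec a x i) + norm (hvec a x i))))) (at x)"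
    unfolding \<eta>_def by (intro tendsto_intros tendsto_hvec[OF x])
  then have \<eta>_lim: "(\<eta> \<longlongrightarrow> 0) (at x)" by simp
  have "((\<lambda>y. \<Sum>i\<in>UNIV. (norm (hvec a y i - hvec a x i))\<^sup>2) \<longlongrightarrow> (\<Sum>i\<in>(UNIV::'m set). (norm (hvec a x i - hvec a x i))\<^sup>2)) (at x)"
    by (intro tendsto_intros tendsto_hvec[OF x])
  then have "((\<lambda>y. \<Sum>i\<in>UNIV. (norm (hvec a y i - hvec a x i))\<^sup>2) \<longlongrightarrow> 0) (at x)" by simp
  then have ev1: "eventually (\<lambda>y. (\<Sum>i\<in>UNIV. (norm (hvec a y i - hvec a x i))\<^sup>2) < l / 4) (at x)"
    by (rule order_tendstoD) (use l in simp)
  have ev2: "eventually (\<lambda>y. y \<in> interior (hpoly a)) (at x)"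
    using x by (intro eventually_at_in_open') auto
  have bound: "norm (lifted_opt a y - lifted_opt a x) \<le> sqrt (4 * m\<^sup>2 * k * \<eta> y) / l + B * \<eta> y"
    if close: "(\<Sum>i\<in>UNIV. (norm (hvec a y i - hvec a x i))\<^sup>2) < l / 4" and y: "y \<in> interior (hpoly a)" for y
  proof -
    let ?Q = "lifted_opt a x" and ?Q' = "lifted_opt a y"
    define s where "s = 1 / (1 + \<eta> y)"
    have s: "0 < s" "s \<le> 1" using \<eta>0[of y] by (auto simp: s_def)
    have opt: "is_lifted_opt a x ?Q" "is_lifted_opt a y ?Q'" using lifted_opt_is_opt[OF bd] x y by auto
    then have pd: "pos_def ?Q" "pos_def ?Q'"
      and feas: "\<And>i. hvec a x i \<bullet> (?Q *v hvec a x i) \<le> 1" "\<And>i. hvec a y i \<bullet> (?Q' *v hvec a y i) \<le> 1"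
      by (auto simp: is_lifted_opt_def lifted_feasible_def)
    have gram': "l / 4 * (norm v)\<^sup>2 \<le> (\<Sum>i\<in>UNIV. (hvec a y i \<bullet> v)\<^sup>2)" for v
      using close by (intro gram_perturbation[OF gram]) simp
    have gram'': "l / 4 * (norm v)\<^sup>2 \<le> (\<Sum>i\<in>UNIV. (hvec a x i \<bullet> v)\<^sup>2)" for v
      using l by (intro gram_perturbation[OF gram]) simp
    have nQ: "norm ?Q \<le> B" "norm ?Q' \<le> B"
      using l pd feas unfolding B_def m_def
      by (intro feasible_norm_bound[OF gram''] feasible_norm_bound[OF gram'] pos_defD; simp)+
    have feas': "lifted_feasible a x (s *\<^sub>R ?Q')" "lifted_feasible a y (s *\<^sub>R ?Q)"
    proof -
      have "hvec a x i \<bullet> (?Q' *v hvec a x i) \<le> 1 + \<eta> y" for i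
        using quadratic_form_perturbation[OF pos_defD(1)[OF pd(2)] nQ(2), of "hvec a x i" "hvec a y i"] feas(2)[of i] term_le_\<eta>[of y i]
        by (simp add: norm_minus_commute add.commute)
      then show "lifted_feasible a x (s *\<^sub>R ?Q')"
        using \<eta>0[of y] s pd by (simp add: lifted_feasible_def pos_def_scaleR scaleR_matrix_vector_assoc[symmetric] s_def pos_divide_le_eq)
      have "hvec a y i \<bullet> (?Q *v hvec a y i) \<le> 1 + \<eta> y" for i
        using quadratic_form_perturbation[OF pos_defD(1)[OF pd(1)] nQ(1), of "hvec a y i" "hvec a x i"] feas(1)[of i] term_le_\<eta>[of y i]
        by simp
      then show "lifted_feasible a y (s *\<^sub>R ?Q)"
        using \<eta>0[of y] s pd by (simp add: lifted_feasible_def pos_def_scaleR scaleR_matrix_vector_assoc[symmetric] s_def pos_divide_le_eq)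
    qed
    have lnd: "ln (det (s *\<^sub>R A)) = ln (det A) - k * ln (1 + \<eta> y)" if "pos_def A" for A :: "'n lmat"
      using pos_def_det_pos[OF that] s \<eta>0[of y]
      by (simp add: det_scaleR ln_mult ln_realpow k_def s_def ln_div algebra_simps)
    have "ln (det (s *\<^sub>R ?Q)) \<le> ln (det ?Q')"
      using opt(2) feas'(2) by (simp add: is_lifted_opt_def)
    \<comment> \<open>Each of the two rescalings costs \<open>k * ln (1 + \<eta> y)\<close>, where
      \<open>k = n + 1\<close> is the order of the matrices.\<close>
    then have "- ln (det (s *\<^sub>R ?Q')) \<le> - ln (det ?Q) + 2 * k * ln (1 + \<eta> y)"
      using lnd[OF pd(1)] lnd[OF pd(2)] by simp
    from is_lifted_opt_gap[OF bd l gram opt(1) feas'(1) this]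
    have "l\<^sup>2 * (norm (s *\<^sub>R ?Q' - ?Q))\<^sup>2 \<le> 2 * m\<^sup>2 * (2 * k * ln (1 + \<eta> y))" by (simp add: m_def)
    also have "\<dots> \<le> 2 * m\<^sup>2 * (2 * k * \<eta> y)"
      using \<eta>0[of y] by (intro mult_left_mono ln_add_one_self_le_self) (auto simp: k_def)
    finally have "(l * norm (s *\<^sub>R ?Q' - ?Q))\<^sup>2 \<le> 4 * m\<^sup>2 * k * \<eta> y"
      by (simp add: power_mult_distrib mult_ac)
    then have "l * norm (s *\<^sub>R ?Q' - ?Q) \<le> sqrt (4 * m\<^sup>2 * k * \<eta> y)" by (rule real_le_rsqrt)
    then have 1: "norm (s *\<^sub>R ?Q' - ?Q) \<le> sqrt (4 * m\<^sup>2 * k * \<eta> y) / l"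
      using l by (simp add: pos_le_divide_eq mult.commute)
    have "norm (?Q' - s *\<^sub>R ?Q') = (1 - s) * norm ?Q'"
    proof -
      have "?Q' - s *\<^sub>R ?Q' = (1 - s) *\<^sub>R ?Q'" by (simp add: scaleR_left_diff_distrib)
      then show ?thesis using s by simp
    qed
    also have "\<dots> \<le> \<eta> y * B"
    proof (rule mult_mono)
      have "1 - s = \<eta> y * s" using \<eta>0[of y] by (simp add: s_def field_simps)
      also have "\<dots> \<le> \<eta> y * 1" using s \<eta>0[of y] by (intro mult_left_mono) auto
      finally show "1 - s \<le> \<eta> y" by simp
    qed (use nQ \<eta>0 in auto)
    finally have 2: "norm (?Q' - s *\<^sub>R ?Q') \<le> B * \<eta> y" by (simp add: mult.commute)
    have "norm (?Q' - ?Q) \<le> norm (?Q' - s *\<^sub>R ?Q') + norm (s *\<^sub>R ?Q' - ?Q)"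
      using norm_triangle_ineq[of "?Q' - s *\<^sub>R ?Q'" "s *\<^sub>R ?Q' - ?Q"] by simp
    with 1 2 show ?thesis by linarith
  qed
  have "((\<lambda>y. sqrt (4 * m\<^sup>2 * k * \<eta> y) / l + B * \<eta> y) \<longlongrightarrow> sqrt (4 * m\<^sup>2 * k * 0) / l + B * 0) (at x)"
    using l by (intro tendsto_intros \<eta>_lim) auto
  then have lim: "((\<lambda>y. sqrt (4 * m\<^sup>2 * k * \<eta> y) / l + B * \<eta> y) \<longlongrightarrow> 0) (at x)" by simp
  have "((\<lambda>y. lifted_opt a y - lifted_opt a x) \<longlongrightarrow> 0) (at x)"
    by (rule Lim_null_comparison[OF _ lim]) (use ev1 ev2 bound in \<open>auto elim: eventually_elim2\<close>)
  then show ?thesis by (rule LIM_zero_cancel)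
qed

text \<open>The negative of the center of the minimal ellipsoid containing the polar.\<close>
definition polar_shift :: "real ^ 'n \<Rightarrow> real ^ 'n" where
  "polar_shift x = matrix_inv (blk_G (lifted_opt a x)) *v blk_z (lifted_opt a x)"

section \<open>Continuity of the shift\<close>

lemma blk_G_opt_pos_def:
  assumes x: "x \<in> interior (hpoly a)"
  shows "pos_def (blk_G (lifted_opt a x))"
  using lifted_opt_is_opt[OF bd x] by (intro pos_def_lmat) (simp add: is_lifted_opt_def lifted_feasible_def)

lemma tendsto_blk_opt:
  assumes x: "x \<in> interior (hpoly a)"
  shows "((\<lambda>y. blk_G (lifted_opt a y)) \<longlongrightarrow> blk_G (lifted_opt a x)) (at x)"
    and "((\<lambda>y. blk_z (lifted_opt a y)) \<longlongrightarrow> blk_z (lifted_opt a x)) (at x)"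
  unfolding blk_G_def blk_z_def by (intro tendsto_intros tendsto_lifted_opt[OF x])+

text \<open>One \<open>\<mu>\<close> for a whole neighborhood makes the constants in the quadratic
  estimate for \<open>vpot\<close> independent of the base point. Halving the least eigenvalue at
  \<open>x\<close> leaves room for the perturbation.\<close>

lemma eventually_blk_G_ge:
  assumes x: "x \<in> interior (hpoly a)"
  obtains \<mu> where "\<mu> > 0" "\<And>v. \<mu> * (norm v)\<^sup>2 \<le> v \<bullet> (blk_G (lifted_opt a x) *v v)"
    "eventually (\<lambda>y. \<forall>v. \<mu> * (norm v)\<^sup>2 \<le> v \<bullet> (blk_G (lifted_opt a y) *v v)) (at x)"
proof -
  let ?G = "\<lambda>y. blk_G (lifted_opt a y)"
  have G: "pos_def (?G x)" by (rule blk_G_opt_pos_def[OF x])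
  obtain u where u: "norm u = 1" "lambda_min (?G x) = u \<bullet> (?G x *v u)"
    "\<forall>v. lambda_min (?G x) * (norm v)\<^sup>2 \<le> v \<bullet> (?G x *v v)"
    using lambda_min_attained[OF pos_defD(1)[OF G]] by blast
  define \<mu> where "\<mu> = lambda_min (?G x) / 2"
  have "u \<noteq> 0" using u(1) by auto
  then have \<mu>: "\<mu> > 0" using pos_defD(2)[OF G, of u] by (simp add: \<mu>_def u(2))
  have Gx: "2 * \<mu> * (norm v)\<^sup>2 \<le> v \<bullet> (?G x *v v)" for v using u(3) by (simp add: \<mu>_def)
  have ev: "eventually (\<lambda>y. norm (?G y - ?G x) < \<mu>) (at x)"
    using tendstoD[OF tendsto_blk_opt(1)[OF x] \<mu>] by (simp add: dist_norm)
  have "\<mu> * (norm v)\<^sup>2 \<le> v \<bullet> (?G y *v v)" if "norm (?G y - ?G x) < \<mu>" for y v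
  proof -
    have "\<bar>v \<bullet> ((?G y - ?G x) *v v)\<bar> \<le> norm (?G y - ?G x) * norm v * norm v" by (rule abs_quadratic_form_le)
    also have "\<dots> \<le> \<mu> * norm v * norm v" using that by (intro mult_right_mono) auto
    finally have "\<bar>v \<bullet> (?G y *v v) - v \<bullet> (?G x *v v)\<bar> \<le> \<mu> * (norm v)\<^sup>2"
      by (simp add: matrix_vector_mult_diff_rdistrib inner_diff_right power2_eq_square mult.assoc)
    then show ?thesis using Gx[of v] by (simp add: abs_le_iff)
  qed
  with ev have "eventually (\<lambda>y. \<forall>v. \<mu> * (norm v)\<^sup>2 \<le> v \<bullet> (?G y *v v)) (at x)"
    by (auto elim: eventually_mono)
  moreover have "\<mu> * (norm v)\<^sup>2 \<le> v \<bullet> (?G x *v v)" for v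
  proof -
    have "0 \<le> \<mu> * (norm v)\<^sup>2" using \<mu> by simp
    then show ?thesis using Gx[of v] by (simp add: mult.assoc)
  qed
  ultimately show thesis using that \<mu> by blast
qed

text \<open>The linear systems solved by the shifts at \<open>y\<close> and \<open>x\<close> are
  subtracted, and the uniform coercivity of \<open>?G y\<close> bounds the difference; continuity of
  matrix inversion is bypassed.\<close>

lemma tendsto_shift:
  assumes x: "x \<in> interior (hpoly a)"
  shows "(polar_shift \<longlongrightarrow> polar_shift x) (at x)"
proof -
  let ?G = "\<lambda>y. blk_G (lifted_opt a y)" and ?z = "\<lambda>y. blk_z (lifted_opt a y)"
  obtain \<mu> where \<mu>: "\<mu> > 0" and ev: "eventually (\<lambda>y. \<forall>v. \<mu> * (norm v)\<^sup>2 \<le> v \<bullet> (?G y *v v)) (at x)"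
    using eventually_blk_G_ge[OF x] by blast
  have ev2: "eventually (\<lambda>y. y \<in> interior (hpoly a)) (at x)"
    using x by (intro eventually_at_in_open') auto
  let ?g = "\<lambda>y. (norm (?z y - ?z x) + norm (?G y - ?G x) * norm (polar_shift x)) / \<mu>"
  have G_shift: "?G y *v polar_shift y = ?z y" if "y \<in> interior (hpoly a)" for y
    unfolding polar_shift_def by (rule pos_def_mult_matrix_inv[OF blk_G_opt_pos_def[OF that]])
  have bound: "norm (polar_shift y - polar_shift x) \<le> ?g y"
    if y: "y \<in> interior (hpoly a)" and ge: "\<forall>v. \<mu> * (norm v)\<^sup>2 \<le> v \<bullet> (?G y *v v)" for y
  proof -
    define e where "e = polar_shift y - polar_shift x"
    have "?G y *v e = (?z y - ?z x) - (?G y - ?G x) *v polar_shift x"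
      by (simp add: e_def matrix_vector_mult_diff_distrib matrix_vector_mult_diff_rdistrib G_shift x y)
    then have "norm (?G y *v e) \<le> norm (?z y - ?z x) + norm (?G y - ?G x) * norm (polar_shift x)"
      using norm_triangle_ineq4[of "?z y - ?z x" "(?G y - ?G x) *v polar_shift x"]
        norm_matrix_vector_le[of "?G y - ?G x" "polar_shift x"] by simp
    then have "norm e * norm (?G y *v e) \<le> norm e * (norm (?z y - ?z x) + norm (?G y - ?G x) * norm (polar_shift x))"
      by (intro mult_left_mono) auto
    moreover have "\<mu> * (norm e)\<^sup>2 \<le> norm e * norm (?G y *v e)"
      using ge Cauchy_Schwarz_ineq2[of e "?G y *v e"] by (smt (verit))
    ultimately have "norm e * (\<mu> * norm e) \<le> norm e * (norm (?z y - ?z x) + norm (?G y - ?G x) * norm (polar_shift x))"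
      by (simp add: power2_eq_square mult_ac)
    then have "\<mu> * norm e \<le> norm (?z y - ?z x) + norm (?G y - ?G x) * norm (polar_shift x)"
      by (cases "e = 0") (auto simp: mult_le_cancel_left)
    then show ?thesis using \<mu> by (simp add: e_def pos_le_divide_eq mult.commute)
  qed
  have "(?g \<longlongrightarrow> (norm (?z x - ?z x) + norm (?G x - ?G x) * norm (polar_shift x)) / \<mu>) (at x)"
    using \<mu> by (intro tendsto_intros tendsto_blk_opt[OF x]) auto
  then have lim: "(?g \<longlongrightarrow> 0) (at x)" by simp
  have "((\<lambda>y. polar_shift y - polar_shift x) \<longlongrightarrow> 0) (at x)"
    by (rule Lim_null_comparison[OF _ lim]) (use ev ev2 bound in \<open>auto elim: eventually_elim2\<close>)
  then show ?thesis by (rule LIM_zero_cancel)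
qed

text \<open>The exact update ellipsoid of \<open>x\<close> still bounds the potential at
  \<open>x + d\<close> through \<open>vpot_le_inscribed\<close>, and the bound is sharp at
  \<open>d = 0\<close>. Its logarithm is expanded to second order with constants that depend only on
  the dimension, \<open>\<mu>\<close> and \<open>M\<close>, so the estimate can be reused with the
  two points exchanged.\<close>

lemma vpot_upper_bound:
  assumes x: "x \<in> interior (hpoly a)" and xd: "x + d \<in> interior (hpoly a)"
    and \<mu>: "\<mu> > 0" "\<And>v. \<mu> * (norm v)\<^sup>2 \<le> v \<bullet> (blk_G (lifted_opt a x) *v v)"
    and M: "norm (polar_shift x) \<le> M" and d: "norm d \<le> 1" "(2 * M + 1 / \<mu>) * norm d \<le> 1 / 2"
  shows "vpot a (x + d) - vpot a x \<le> - (real CARD('n) + 1) * (polar_shift x \<bullet> d)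
    + (real CARD('n) + 1) / 2 * (1 / \<mu> + 2 * (2 * M + 1 / \<mu>)\<^sup>2) * (norm d)\<^sup>2"
proof -
  let ?Q = "lifted_opt a x" and ?n = "real CARD('n)"
  define G z \<sigma> b w where "G = blk_G ?Q" and "z = blk_z ?Q" and "\<sigma> = 1 - blk_s ?Q" and "b = beta ?Q"
    and "w = polar_shift x"
  note defs = G_def z_def \<sigma>_def b_def w_def
  have feas: "lifted_feasible a x ?Q" using lifted_opt_is_opt[OF bd x] by (simp add: is_lifted_opt_def)
  then have pd: "pos_def ?Q" by (simp add: lifted_feasible_def)
  have w: "w = matrix_inv G *v z" by (simp add: w_def polar_shift_def G_def z_def)
  have G: "pos_def G" and b: "b = \<sigma> + z \<bullet> w" "b < 1"
    using pos_def_lmat(1,4,6)[OF pd] by (auto simp: defs polar_shift_def)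
  have pos: "\<sigma> > 0" "b > 0" using lifted_feasible_beta_pos[OF bd x feas] by (auto simp: defs)
  note E = E_upd_eq(1,3)[OF bd x feas] and sub = update_ellipsoid_subset[OF bd x feas]
  let ?E = "E_upd ?Q"
  have iG: "transpose (matrix_inv G) = matrix_inv G" by (rule pos_defD(1)[OF pos_def_matrix_inv[OF G]])
  have E_vec: "?E *v v = \<sigma> *\<^sub>R (matrix_inv G *v v - ((w \<bullet> v) / b) *\<^sub>R w)" for v
    unfolding E_upd_def defs[symmetric]
    by (simp add: matrix_vector_mult_diff_rdistrib scaleR_matrix_vector_assoc[symmetric]
        matrix_vector_mul_assoc[symmetric] outer_mult_vector matrix_vector_mult_scaleR w
        inner_matrix_vector_symmetric[OF iG] del: scaleR_right_diff_distrib)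
  define k where "k = (1 / \<sigma>) *\<^sub>R z"
  have K: "K_upd x ?Q = x + k" by (simp add: K_upd_def k_def defs)
  have Ek: "?E *v k = (\<sigma> / b) *\<^sub>R w"
  proof -
    have "matrix_inv G *v k - ((w \<bullet> k) / b) *\<^sub>R w = (1 / \<sigma> - (z \<bullet> w) / (\<sigma> * b)) *\<^sub>R w"
      by (simp add: k_def matrix_vector_mult_scaleR w[symmetric] inner_commute algebra_simps)
    also have "1 / \<sigma> - (z \<bullet> w) / (\<sigma> * b) = 1 / b"
    proof -
      have zw: "z \<bullet> w = b - \<sigma>" using b by simp
      show ?thesis using pos by (simp only: zw) (simp add: field_simps)
    qed
    finally show ?thesis by (simp add: E_vec)
  qed
  have kEk: "k \<bullet> (?E *v k) = 1 - \<sigma> / b"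
  proof -
    have zw: "z \<bullet> w = b - \<sigma>" using b by simp
    have "k \<bullet> (?E *v k) = (z \<bullet> w) / b" unfolding Ek using pos by (simp add: k_def)
    then show ?thesis using pos by (simp add: zw diff_divide_distrib)
  qed
  define q where "q = b / \<sigma> * (d \<bullet> (?E *v d))"
  \<comment> \<open>\<open>1 + u\<close> is the factor by which the argument of the logarithm in
    \<open>vpot_le_inscribed\<close> changes between \<open>x\<close> and \<open>x + d\<close>;
    \<open>2 * (w \<bullet> d)\<close> is its linear part.\<close>
  define u where "u = 2 * (w \<bullet> d) - q"
  have "q \<ge> 0" unfolding q_def using pos pos_defD(3)[OF E(1)] by simp
  moreover have "q \<le> (norm d)\<^sup>2 / \<mu>"
  proof -
    have "q = b * (d \<bullet> (matrix_inv G *v d)) - (w \<bullet> d)\<^sup>2"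
      using pos by (simp add: q_def E_vec inner_simps inner_commute power2_eq_square field_simps)
    also have "\<dots> \<le> b * (d \<bullet> (matrix_inv G *v d))" by simp
    also have "\<dots> \<le> 1 * (d \<bullet> (matrix_inv G *v d))"
      using b pos by (intro mult_right_mono pos_defD(3)[OF pos_def_matrix_inv[OF G]]) auto
    also have "\<dots> \<le> (norm d)\<^sup>2 / \<mu>"
    proof -
      define e where "e = matrix_inv G *v d"
      have Ge: "G *v e = d" by (simp add: e_def pos_def_mult_matrix_inv[OF G])
      have "norm e * (\<mu> * norm e) \<le> norm e * norm d"
        using \<mu>(2)[of e] norm_cauchy_schwarz[of e d] by (simp add: G_def[symmetric] Ge power2_eq_square mult_ac)
      then have "\<mu> * norm e \<le> norm d" by (cases "e = 0") (auto simp: mult_le_cancel_left)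
      then have "norm e \<le> norm d / \<mu>" using \<mu> by (simp add: pos_le_divide_eq mult.commute)
      then have "norm d * norm e \<le> norm d * (norm d / \<mu>)" by (rule mult_left_mono) simp
      with norm_cauchy_schwarz[of d e] show ?thesis by (simp add: e_def power2_eq_square)
    qed
    finally show ?thesis .
  qed
  ultimately have q: "q \<ge> 0" "q \<le> (norm d)\<^sup>2 / \<mu>" by auto
  let ?C = "2 * M + 1 / \<mu>"
  have u: "\<bar>u\<bar> \<le> ?C * norm d"
  proof -
    have "\<bar>w \<bullet> d\<bar> \<le> norm w * norm d" by (rule Cauchy_Schwarz_ineq2)
    also have "\<dots> \<le> M * norm d" using M by (intro mult_right_mono) (auto simp: w_def)
    finally have 1: "\<bar>w \<bullet> d\<bar> \<le> M * norm d" .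
    have "(norm d)\<^sup>2 / \<mu> \<le> norm d / \<mu>"
      using d(1) \<mu>(1) by (intro divide_right_mono) (auto simp: power2_eq_square mult_left_le)
    with 1 q show ?thesis unfolding u_def by (simp add: algebra_simps)
  qed
  with d have u2: "\<bar>u\<bar> \<le> 1 / 2" by linarith
  have quad: "(x + d - K_upd x ?Q) \<bullet> (?E *v (x + d - K_upd x ?Q)) = 1 - \<sigma> / b * (1 + u)"
  proof -
    have dk: "x + d - K_upd x ?Q = d - k" by (simp add: K)
    have expand: "(d - k) \<bullet> (?E *v (d - k)) = d \<bullet> (?E *v d) - 2 * (d \<bullet> (?E *v k)) + k \<bullet> (?E *v k)"
      using inner_matrix_vector_symmetric[OF pos_defD(1)[OF E(1)], of k d]
      by (simp add: matrix_vector_mult_diff_distrib inner_simps inner_commute)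
    have dEd: "d \<bullet> (?E *v d) = \<sigma> / b * q" using pos by (simp add: q_def)
    show ?thesis unfolding dk expand kEk dEd unfolding Ek
      by (simp add: u_def inner_commute algebra_simps)
  qed
  have u1: "1 + u > 0" using u2 by linarith
  then have "\<sigma> / b * (1 + u) > 0" using pos by simp
  then have "vpot a (x + d) \<le> ln (det ?E) / 2 - (?n + 1) / 2 * ln (\<sigma> / b * (1 + u))"
    using vpot_le_inscribed[OF bd E(1) sub xd] unfolding quad by simp
  also have "ln (\<sigma> / b * (1 + u)) = ln (\<sigma> / b) + ln (1 + u)"
    using pos u1 by (intro ln_mult_pos) auto
  also have "ln (det ?E) / 2 - (?n + 1) / 2 * (ln (\<sigma> / b) + ln (1 + u)) = vpot a x - (?n + 1) / 2 * ln (1 + u)"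
  proof -
    define X where "X = \<sigma> ^ (CARD('n) + 1)"
    have X: "X > 0" "ln X = (?n + 1) * ln \<sigma>"
      using pos ln_realpow[of \<sigma> "CARD('n) + 1"] by (simp_all add: X_def del: power_Suc)
    have dG: "det G > 0" by (rule pos_def_det_pos[OF G])
    have lE: "ln (det ?E) = (?n + 1) * ln \<sigma> - (ln b + ln (det G))"
      using X pos dG by (simp add: E(2)[folded defs, folded X_def] ln_div ln_mult)
    have v: "vpot a x = - (ln (det G) - ?n * ln b) / 2"
      using pos dG by (simp add: vpot_eq[OF bd x, folded defs] ln_div ln_realpow)
    have lsb: "ln (\<sigma> / b) = ln \<sigma> - ln b" using pos by (simp add: ln_div)
    show ?thesis unfolding lE v lsb by (simp add: field_simps)
  qed
  also have "\<dots> \<le> vpot a x - (?n + 1) / 2 * (u - 2 * u\<^sup>2)"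
  proof -
    have "u - 2 * u\<^sup>2 \<le> ln (1 + u)" using abs_ln_one_plus_x_minus_x_bound[OF u2] by linarith
    then show ?thesis by (intro diff_left_mono mult_left_mono) simp_all
  qed
  finally have "vpot a (x + d) \<le> vpot a x - (?n + 1) / 2 * (u - 2 * u\<^sup>2)" .
  moreover have "(?n + 1) / 2 * (2 * u\<^sup>2 - u) = - ((?n + 1) / 2 * (u - 2 * u\<^sup>2))"
    by (simp only: mult_minus_right[symmetric] minus_diff_eq)
  ultimately have "vpot a (x + d) - vpot a x \<le> (?n + 1) / 2 * (2 * u\<^sup>2 - u)" by linarith
  also have "\<dots> = - (?n + 1) * (w \<bullet> d) + (?n + 1) / 2 * (q + 2 * u\<^sup>2)" by (simp add: u_def algebra_simps)
  also have "\<dots> \<le> - (?n + 1) * (w \<bullet> d) + (?n + 1) / 2 * ((norm d)\<^sup>2 / \<mu> + 2 * (?C * norm d)\<^sup>2)"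
    using q power_mono[OF u, of 2] by (intro add_left_mono mult_left_mono) auto
  also have "(norm d)\<^sup>2 / \<mu> + 2 * (?C * norm d)\<^sup>2 = (1 / \<mu> + 2 * ?C\<^sup>2) * (norm d)\<^sup>2"
    unfolding power_mult_distrib by (simp add: distrib_right)
  finally show ?thesis by (simp only: w_def mult.assoc)
qed

text \<open>The upper bounds from \<open>x\<close> to \<open>y\<close> and from \<open>y\<close>
  back to \<open>x\<close> enclose the increment. Their linear parts differ by an inner product with
  \<open>polar_shift y - polar_shift x\<close>, which tends to 0, so the error is of lower
  order.\<close>

lemma GDERIV_vpot:
  assumes x: "x \<in> interior (hpoly a)"
  shows "GDERIV (vpot a) x :> - (real CARD('n) + 1) *\<^sub>R polar_shift x"
proof -
  let ?n = "real CARD('n) + 1"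
  obtain \<mu> where \<mu>: "\<mu> > 0" "\<And>v. \<mu> * (norm v)\<^sup>2 \<le> v \<bullet> (blk_G (lifted_opt a x) *v v)"
    and ev: "eventually (\<lambda>y. \<forall>v. \<mu> * (norm v)\<^sup>2 \<le> v \<bullet> (blk_G (lifted_opt a y) *v v)) (at x)"
    using eventually_blk_G_ge[OF x] by blast
  \<comment> \<open>The margin 1 lets \<open>M\<close> bound the shifts at nearby points
    too.\<close>
  define M where "M = norm (polar_shift x) + 1"
  define C where "C = 2 * M + 1 / \<mu>"
  have C: "C > 0" using \<mu> by (auto simp: C_def M_def intro!: add_pos_pos add_nonneg_pos)
  define D where "D = ?n / 2 * (1 / \<mu> + 2 * C\<^sup>2)"
  have ev_int: "eventually (\<lambda>y. y \<in> interior (hpoly a)) (at x)"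
    using x by (intro eventually_at_in_open') auto
  have ev_M: "eventually (\<lambda>y. norm (polar_shift y) \<le> M) (at x)"
  proof (rule eventually_mono[OF tendstoD[OF tendsto_shift[OF x], of 1]])
    show "norm (polar_shift y) \<le> M" if "dist (polar_shift y) (polar_shift x) < 1" for y
      using norm_triangle_sub[of "polar_shift y" "polar_shift x"] that by (simp add: M_def dist_norm)
  qed simp
  have ev_d: "eventually (\<lambda>y. dist y x < min 1 (1 / (2 * C))) (at x)"
    by (rule tendstoD[OF tendsto_ident_at]) (use C in simp)
  have bound: "norm (vpot a y - vpot a x - (y - x) \<bullet> (- ?n *\<^sub>R polar_shift x))
      \<le> norm (y - x) * (?n * norm (polar_shift y - polar_shift x) + D * norm (y - x))"
    if y: "y \<in> interior (hpoly a)" and yM: "norm (polar_shift y) \<le> M" and yd: "dist y x < min 1 (1 / (2 * C))"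
      and y\<mu>: "\<forall>v. \<mu> * (norm v)\<^sup>2 \<le> v \<bullet> (blk_G (lifted_opt a y) *v v)" for y
  proof -
    define d where "d = y - x"
    have d: "norm d \<le> 1" "C * norm d \<le> 1 / 2"
      using yd C by (auto simp: d_def dist_norm field_simps)
    have xd: "x + d \<in> interior (hpoly a)" and ydm: "y + (- d) \<in> interior (hpoly a)"
      using x y by (simp_all add: d_def)
    have up: "vpot a y - vpot a x \<le> - ?n * (polar_shift x \<bullet> d) + D * (norm d)\<^sup>2"
      using vpot_upper_bound[OF x xd \<mu>, of M] d by (simp add: M_def C_def D_def) (simp add: d_def)
    have lo: "vpot a x - vpot a y \<le> ?n * (polar_shift y \<bullet> d) + D * (norm d)\<^sup>2"
    proof -
      have "vpot a (y + - d) - vpot a y \<le> - ?n * (polar_shift y \<bullet> (- d))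
          + ?n / 2 * (1 / \<mu> + 2 * (2 * M + 1 / \<mu>)\<^sup>2) * (norm (- d))\<^sup>2"
        by (rule vpot_upper_bound[OF y ydm \<mu>(1) _ yM]) (use y\<mu> d in \<open>auto simp: C_def\<close>)
      moreover have "y + - d = x" by (simp add: d_def)
      ultimately show ?thesis
        by (simp only: D_def C_def inner_minus_right norm_minus_cancel minus_mult_minus)
    qed
    have "polar_shift y \<bullet> d - polar_shift x \<bullet> d \<le> norm (polar_shift y - polar_shift x) * norm d"
      using norm_cauchy_schwarz[of "polar_shift y - polar_shift x" d] by (simp add: inner_diff_left)
    then have "?n * (polar_shift y \<bullet> d) - ?n * (polar_shift x \<bullet> d) \<le> ?n * (norm (polar_shift y - polar_shift x) * norm d)"
      by (subst right_diff_distrib[symmetric]) (rule mult_left_mono, auto)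
    moreover have "0 \<le> ?n * (norm (polar_shift y - polar_shift x) * norm d)" by simp
    ultimately have "\<bar>vpot a y - vpot a x + ?n * (polar_shift x \<bullet> d)\<bar>
        \<le> ?n * (norm (polar_shift y - polar_shift x) * norm d) + D * (norm d)\<^sup>2"
      using up lo by linarith
    then show ?thesis
      by (simp add: d_def inner_commute power2_eq_square algebra_simps)
  qed
  let ?g = "\<lambda>h. ?n * norm (polar_shift (x + h) - polar_shift x) + D * norm h"
  have "((\<lambda>h. polar_shift (x + h)) \<longlongrightarrow> polar_shift x) (at 0)"
    using tendsto_shift[OF x] by (simp add: LIM_offset_zero_iff)
  then have "(?g \<longlongrightarrow> ?n * norm (polar_shift x - polar_shift x) + D * norm (0 :: real ^ 'n)) (at 0)"
    by (intro tendsto_intros)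
  then have g: "(?g \<longlongrightarrow> 0) (at 0)" by simp
  have "eventually (\<lambda>y. norm (vpot a y - vpot a x - (y - x) \<bullet> (- ?n *\<^sub>R polar_shift x))
      \<le> norm (y - x) * (?n * norm (polar_shift y - polar_shift x) + D * norm (y - x))) (at x)"
    using ev_int ev_M ev_d ev by eventually_elim (rule bound)
  then have "eventually (\<lambda>h. norm (vpot a (x + h) - vpot a x - h \<bullet> (- ?n *\<^sub>R polar_shift x)) \<le> norm h * ?g h) (at 0)"
    unfolding eventually_at_to_0[of _ x] by (simp only: add_diff_cancel_left' add.commute[of _ x])
  then have "eventually (\<lambda>h. norm (norm (vpot a (x + h) - vpot a x - h \<bullet> (- ?n *\<^sub>R polar_shift x)) / norm h) \<le> ?g h) (at 0)"
    using eventually_neq_at_within[of 0 0 UNIV]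
    by eventually_elim (simp add: pos_divide_le_eq mult.commute)
  then show ?thesis unfolding gderiv_def has_derivative_at
    by (intro conjI bounded_linear_inner_left Lim_null_comparison[OF _ g])
qed

lemma gradient_delta_v:
  assumes x: "x \<in> interior (hpoly a)"
  shows "GDERIV (delta_v a) x :> gradient (delta_v a) x"
    and "gradient (delta_v a) x = - (real CARD('n) + 1) *\<^sub>R polar_shift x"
proof -
  have "((\<lambda>x. vpot a x - vpot a (ell_center (MaxIE (hpoly a)))) has_derivative
      (\<lambda>h. h \<bullet> (- (real CARD('n) + 1) *\<^sub>R polar_shift x) - 0)) (at x)"
    using GDERIV_vpot[OF x] unfolding gderiv_def by (intro has_derivative_diff has_derivative_const)
  then have D: "GDERIV (delta_v a) x :> - (real CARD('n) + 1) *\<^sub>R polar_shift x"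
    by (simp add: gderiv_def delta_v_def[abs_def])
  show eq: "gradient (delta_v a) x = - (real CARD('n) + 1) *\<^sub>R polar_shift x"
    unfolding gradient_def
  proof (rule the_equality)
    show "GDERIV (delta_v a) x :> - (real CARD('n) + 1) *\<^sub>R polar_shift x" by (rule D)
  next
    fix g assume "GDERIV (delta_v a) x :> g"
    with D have "(\<lambda>h. h \<bullet> g) = (\<lambda>h. h \<bullet> (- (real CARD('n) + 1) *\<^sub>R polar_shift x))"
      unfolding gderiv_def by (intro has_derivative_unique)
    then have "\<And>h. h \<bullet> g = h \<bullet> (- (real CARD('n) + 1) *\<^sub>R polar_shift x)" by meson
    then show "g = - (real CARD('n) + 1) *\<^sub>R polar_shift x" using vector_eq_ldot by blast
  qed
  show "GDERIV (delta_v a) x :> gradient (delta_v a) x" unfolding eq by (rule D)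
qed

lemma continuous_on_gradient_delta_v: "continuous_on (interior (hpoly a)) (gradient (delta_v a))"
proof -
  have "continuous_on (interior (hpoly a)) polar_shift"
    using tendsto_shift by (simp add: continuous_on_eq_continuous_at isCont_def)
  then have "continuous_on (interior (hpoly a)) (\<lambda>x. - (real CARD('n) + 1) *\<^sub>R polar_shift x)"
    by (intro continuous_intros)
  then show ?thesis by (rule continuous_on_eq) (simp add: gradient_delta_v(2))
qed

end

section \<open>The inexact process\<close>

text \<open>A segment from the interior to a point outside crosses the frontier; so the distance to
  the frontier, as in \<open>r0\<close>, controls the distance to all points that are not
  interior.\<close>

lemma interior_frontier_dist:
  assumes k: "k \<in> interior S" and y: "y \<notin> interior S"
  obtains f where "f \<in> frontier S" "dist k f \<le> dist k (y :: 'a::euclidean_space)"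
proof (cases "y \<in> S")
  case True
  then have "y \<in> frontier S" using y closure_subset by (auto simp: frontier_def)
  then show thesis using that by blast
next
  case False
  have "closed_segment k y \<inter> frontier S \<noteq> {}"
    using k False interior_subset by (intro connected_Int_frontier) auto
  then obtain f where "f \<in> closed_segment k y" "f \<in> frontier S" by blast
  then show thesis using that dist_in_closed_segment by (metis dist_commute)
qed

context
  fixes a :: "'m::finite \<Rightarrow> real ^ 'n"
  assumes bd: "bounded (hpoly a)"
begin

lemma K_exact_interior: "x \<in> interior (hpoly a) \<Longrightarrow> K_exact a x \<in> interior (hpoly a)"
  unfolding K_exact_def using lifted_opt_is_opt[OF bd]
  by (intro K_upd_interior[OF bd]) (auto simp: is_lifted_opt_def)

context
  fixes x0 :: "real ^ 'n"
  assumes x0: "x0 \<in> interior (hpoly a)"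
begin

lemma x0_in_Lset: "x0 \<in> Lset a x0"
  using x0 by (simp add: Lset_def)

lemma r0_le_dist:
  assumes k: "k \<in> K_exact a ` Lset a x0" and y: "y \<notin> interior (hpoly a)"
  shows "r0 a x0 \<le> dist k y"
proof -
  have "k \<in> interior (hpoly a)" using k K_exact_interior by (auto simp: Lset_def)
  then obtain f where f: "f \<in> frontier (hpoly a)" "dist k f \<le> dist k y"
    using interior_frontier_dist y by blast
  have "r0 a x0 \<le> dist k f" unfolding r0_def using k f(1) by (rule setdist_le_dist)
  with f show ?thesis by linarith
qed

text \<open>Points that are not interior have distance at least \<open>r0\<close> from the image,
  more than \<open>r0 / 2\<close>. The theorem obtains \<open>r0 > 0\<close> from
  \<open>\<epsilon> > 0\<close>.\<close>

lemma V0_subset_interior: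
  assumes r: "r0 a x0 > 0"
  shows "V0 a x0 \<subseteq> interior (hpoly a)"
proof (rule subsetI, rule ccontr)
  fix y assume y: "y \<in> V0 a x0" "y \<notin> interior (hpoly a)"
  have ne: "K_exact a ` Lset a x0 \<noteq> {}" using x0_in_Lset by blast
  have "r0 a x0 \<le> infdist y (K_exact a ` Lset a x0)"
    unfolding infdist_notempty[OF ne] using r0_le_dist[OF _ y(2)]
    by (intro cINF_greatest ne) (metis dist_commute)
  with y r show False by (simp add: V0_def)
qed

text \<open>A real \<open>SUP\<close> dominates its members only if they are bounded above;
  continuity of the gradient on the compact \<open>V0\<close> ensures this.\<close>

lemma gradient_le_L0:
  assumes r: "r0 a x0 > 0" and y: "y \<in> V0 a x0"
  shows "norm (gradient (delta_v a) y) \<le> L0 a x0"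
proof -
  have "closed (V0 a x0)" unfolding V0_def by (intro closed_Collect_le continuous_intros)
  moreover have "bounded (V0 a x0)"
    using bounded_subset[OF bd] V0_subset_interior[OF r] interior_subset by blast
  ultimately have "compact (V0 a x0)" by (simp add: compact_eq_bounded_closed)
  then have "compact ((\<lambda>y. norm (gradient (delta_v a) y)) ` V0 a x0)"
    by (intro compact_continuous_image continuous_on_norm
        continuous_on_subset[OF continuous_on_gradient_delta_v[OF bd] V0_subset_interior[OF r]])
  then have "bdd_above ((\<lambda>y. norm (gradient (delta_v a) y)) ` V0 a x0)"
    by (intro bounded_imp_bdd_above compact_imp_bounded)
  then show ?thesis unfolding L0_def by (rule cSUP_upper[OF y])
qed

text \<open>The mean value estimate runs on the ball around \<open>K_exact a x\<close>, which is
  convex and contained in \<open>V0\<close>; \<open>V0\<close> itself may fail to be convex.\<close>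

lemma delta_v_lipschitz:
  assumes r: "r0 a x0 > 0" and x: "x \<in> Lset a x0" and y: "norm (y - K_exact a x) \<le> r0 a x0 / 2"
  shows "delta_v a y \<le> delta_v a (K_exact a x) + L0 a x0 * norm (y - K_exact a x)"
proof -
  let ?S = "cball (K_exact a x) (r0 a x0 / 2)"
  have S: "?S \<subseteq> V0 a x0"
  proof
    fix z assume "z \<in> ?S"
    then show "z \<in> V0 a x0"
      unfolding V0_def using infdist_le[of "K_exact a x" "K_exact a ` Lset a x0" z] x
      by (auto simp: dist_commute)
  qed
  have "norm (delta_v a y - delta_v a (K_exact a x)) \<le> L0 a x0 * norm (y - K_exact a x)"
  proof (rule differentiable_bound[of ?S _ "\<lambda>z h. h \<bullet> gradient (delta_v a) z"])
    fix z assume z: "z \<in> ?S"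
    then have "z \<in> interior (hpoly a)" using S V0_subset_interior[OF r] by blast
    from gradient_delta_v(1)[OF bd this]
    show "(delta_v a has_derivative (\<lambda>h. h \<bullet> gradient (delta_v a) z)) (at z within ?S)"
      unfolding gderiv_def by (rule has_derivative_at_withinI)
    show "onorm (\<lambda>h. h \<bullet> gradient (delta_v a) z) \<le> L0 a x0"
    proof (rule onorm_le)
      fix h
      have "norm (h \<bullet> gradient (delta_v a) z) \<le> norm h * norm (gradient (delta_v a) z)"
        by (simp add: Cauchy_Schwarz_ineq2)
      also have "\<dots> \<le> norm h * L0 a x0"
        using gradient_le_L0[OF r] S z by (intro mult_left_mono) auto
      finally show "norm (h \<bullet> gradient (delta_v a) z) \<le> L0 a x0 * norm h" by (simp add: mult.commute)
    qed
  qed (use y r in \<open>auto simp: dist_norm norm_minus_commute\<close>)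
  then show ?thesis by simp
qed

lemma L0_nonneg:
  assumes r: "r0 a x0 > 0"
  shows "L0 a x0 \<ge> 0"
proof -
  have "K_exact a x0 \<in> V0 a x0"
    unfolding V0_def using x0_in_Lset r by (simp add: infdist_zero)
  from gradient_le_L0[OF r this] show ?thesis using norm_ge_zero order_trans by blast
qed

section \<open>From oracle tolerance to distance\<close>

lemma lambda0_nonneg: "lambda0 a x0 \<ge> 0"
  unfolding lambda0_def using x0_in_Lset by (intro cINF_greatest gram_lambda_min(2)) auto

lemma lambda0_le:
  assumes x: "x \<in> Lset a x0"
  shows "lambda0 a x0 * (norm v)\<^sup>2 \<le> (\<Sum>i\<in>UNIV. (hvec a x i \<bullet> v)\<^sup>2)"
proof -
  have "lambda0 a x0 \<le> lambda_min (\<Sum>i\<in>UNIV. outer (hvec a x i) (hvec a x i))"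
    unfolding lambda0_def
    by (intro cINF_lower x bdd_belowI2[of _ 0] gram_lambda_min(2))
  then have "lambda0 a x0 * (norm v)\<^sup>2 \<le> lambda_min (\<Sum>i\<in>UNIV. outer (hvec a x i) (hvec a x i)) * (norm v)\<^sup>2"
    by (rule mult_right_mono) simp
  with gram_lambda_min(1)[of "hvec a x" v] show ?thesis by linarith
qed

lemma oracle_answer_zero:
  assumes x: "x \<in> interior (hpoly a)" and Q: "oracle_answer a 0 x Q"
  shows "Q = lifted_opt a x"
proof -
  note opt = lifted_opt_is_opt[OF bd x]
  have "is_lifted_opt a x Q"
    using Q opt unfolding oracle_answer_def is_lifted_opt_def by fastforce
  then show ?thesis by (rule lifted_opt_eqI[OF bd x])
qed

text \<open>Every term in the formula for \<open>\<epsilon>\<close> has the shape of the bound on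
  \<open>\<epsilon>\<close> here; \<open>T\<close> is the distance to the exact optimizer that the
  term guarantees.\<close>

lemma oracle_answer_dist:
  assumes x: "x \<in> Lset a x0" and Q: "oracle_answer a \<epsilon> x Q" and l: "lambda0 a x0 > 0"
    and T: "T \<ge> 0" "\<epsilon> \<le> (lambda0 a x0)\<^sup>2 * T\<^sup>2 / (2 * (real CARD('m))\<^sup>2)"
  shows "norm (Q - lifted_opt a x) \<le> T"
proof -
  have "x \<in> interior (hpoly a)" using x by (simp add: Lset_def)
  then have "(lambda0 a x0)\<^sup>2 * (norm (Q - lifted_opt a x))\<^sup>2 \<le> 2 * (real CARD('m))\<^sup>2 * \<epsilon>"
    using Q unfolding oracle_answer_def
    by (intro is_lifted_opt_gap[OF bd l lambda0_le[OF x]] lifted_opt_is_opt[OF bd]) auto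
  also have "\<dots> \<le> 2 * (real CARD('m))\<^sup>2 * ((lambda0 a x0)\<^sup>2 * T\<^sup>2 / (2 * (real CARD('m))\<^sup>2))"
    using T by (intro mult_left_mono) auto
  also have "\<dots> = (lambda0 a x0)\<^sup>2 * T\<^sup>2" by simp
  finally have "(norm (Q - lifted_opt a x))\<^sup>2 \<le> T\<^sup>2" using l by simp
  then show ?thesis using T(1) by (rule power2_le_imp_le)
qed

section \<open>Runs of the process\<close>

lemma inexact_process_exists:
  assumes "\<epsilon> \<ge> 0"
  shows "\<exists>Qh x E. inexact_process a \<epsilon> x0 Qh x E"
proof -
  define x where "x = rec_nat x0 (\<lambda>_ y. K_upd y (lifted_opt a y))"
  have "inexact_process a \<epsilon> x0 (\<lambda>k. lifted_opt a (x k)) x (\<lambda>k. E_upd (lifted_opt a (x (k - 1))))"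
    using assms lifted_opt_is_opt[OF bd]
    by (auto simp: inexact_process_def x_def oracle_answer_def is_lifted_opt_def)
  then show ?thesis by blast
qed

text \<open>The oracle is constrained only at interior points, so interiority and validity of the
  answers advance together: a feasible answer makes the next iterate the center of an inscribed
  ellipsoid.\<close>

lemma inexact_process_interior:
  assumes run: "inexact_process a \<epsilon> x0 Qh x E"
  shows "x k \<in> interior (hpoly a)" "oracle_answer a \<epsilon> (x k) (Qh k)"
proof -
  have *: "x k \<in> interior (hpoly a) \<Longrightarrow> oracle_answer a \<epsilon> (x k) (Qh k)" for k
    using run by (simp add: inexact_process_def)
  show 1: "x k \<in> interior (hpoly a)"
  proof (induction k)
    case 0
    then show ?case using run x0 by (simp add: inexact_process_def)
  next
    case (Suc k)
    then have "K_upd (x k) (Qh k) \<in> interior (hpoly a)"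
      using * by (intro K_upd_interior[OF bd]) (auto simp: oracle_answer_def)
    then show ?case using run by (simp add: inexact_process_def)
  qed
  show "oracle_answer a \<epsilon> (x k) (Qh k)" using * 1 .
qed

lemma process_well_definedI:
  assumes "\<epsilon> \<ge> 0"
  shows "process_well_defined a \<epsilon> x0"
  unfolding process_well_defined_def
proof (intro conjI allI impI inexact_process_exists assms)
  fix Qh x E k assume run: "inexact_process a \<epsilon> x0 Qh x E"
  show int: "x k \<in> interior (hpoly a)" by (rule inexact_process_interior[OF run])
  have feas: "lifted_feasible a (x k) (Qh k)"
    using inexact_process_interior(2)[OF run] by (simp add: oracle_answer_def)
  show "\<exists>!Q. is_lifted_opt a (x k) Q" by (rule lifted_opt_unique[OF bd int])
  show "invertible (blk_G (Qh k))"
    using feas by (intro pos_def_invertible pos_def_lmat) (simp add: lifted_feasible_def)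
  show "1 - blk_s (Qh k) \<noteq> 0" "beta (Qh k) \<noteq> 0"
    using lifted_feasible_beta_pos[OF bd int feas] by auto
  show "pos_def (E (Suc k))"
    using run E_upd_eq(1)[OF bd int feas] by (simp add: inexact_process_def)
qed

end

end

lemma power_ceiling_log_plus:
  fixes q \<delta> l :: real
  assumes q: "0 < q" "q < 1" and \<delta>: "\<delta> \<ge> 0" and l: "l > 0"
    and N: "N = nat \<lceil>log_plus (2 * \<delta> / l) / ln (1 / q)\<rceil>"
  shows "q ^ N * \<delta> \<le> l / 2"
\<comment> \<open>In the first case, which includes \<open>\<delta> = 0\<close> and its convention
  in \<open>log_plus\<close>, no decrease is required and \<open>q ^ N \<le> 1\<close>
  suffices.\<close>
proof (cases "2 * \<delta> \<le> l")
  case True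
  have "q ^ N * \<delta> \<le> 1 * \<delta>" using q \<delta> by (intro mult_right_mono power_le_one) auto
  with True show ?thesis by simp
next
  case False
  define t where "t = 2 * \<delta> / l"
  have t: "t > 1" using False l by (simp add: t_def)
  have lq: "ln (1 / q) > 0" using q by simp
  have "ln t / ln (1 / q) \<le> real N"
    using t real_nat_ceiling_ge[of "ln t / ln (1 / q)"] by (simp add: N t_def[symmetric] log_plus_def)
  then have "ln t \<le> real N * ln (1 / q)" using lq by (simp add: pos_divide_le_eq)
  also have "\<dots> = ln ((1 / q) ^ N)" using q by (simp add: ln_realpow)
  finally have "t \<le> (1 / q) ^ N" using t q by simp
  then have "t * q ^ N \<le> (1 / q) ^ N * q ^ N" using q by (intro mult_right_mono) auto
  also have "\<dots> = 1" using q by (simp add: power_mult_distrib[symmetric])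
  finally show ?thesis using l by (simp add: t_def field_simps)
qed

theorem theorem2:
  fixes a :: "'m::finite \<Rightarrow> real ^ 'n"
    and x0 :: "real ^ 'n"
    and \<gamma> q0 \<rho>0 Lctr Lvol \<epsilon> :: real
    and N :: nat
  assumes P_polytope: "polytope (hpoly a)"
    and x0: "x0 \<in> interior (hpoly a)"
    and \<gamma>: "0 < \<gamma>" "\<gamma> < 1"
    and q0: "0 < q0" "q0 < 1"
    and q0_contr: "\<And>x. x \<in> Lset a x0 \<Longrightarrow> delta_v a (K_exact a x) \<le> q0 * delta_v a x"
    and \<rho>0: "\<rho>0 > 0"
    and \<rho>0_stable: "\<And>x Q. x \<in> Lset a x0 \<Longrightarrow> near_opt a \<rho>0 x Q \<Longrightarrow>
          lambda_min Q \<ge> theta0 a x0 / 2 \<and> lambda_min (blk_G Q) \<ge> mu0 a x0 / 2 \<and>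
          1 - blk_s Q \<ge> sigma0 a x0 / 2 \<and> beta Q \<ge> beta0 a x0 / 2"
    and Lctr: "Lctr > 0"
    and Lctr_lipschitz: "\<And>x Q. x \<in> Lset a x0 \<Longrightarrow> near_opt a \<rho>0 x Q \<Longrightarrow>
          norm (K_upd x Q - K_exact a x) \<le> Lctr * norm (Q - lifted_opt a x)"
    and Lvol: "Lvol > 0"
    and Lvol_lipschitz: "\<And>x Q. x \<in> Lset a x0 \<Longrightarrow> near_opt a \<rho>0 x Q \<Longrightarrow>
          \<bar>ln (Vol (ellipsoid (K_upd x Q) (E_upd Q)))
             - ln (Vol (ellipsoid (K_exact a x) (E_exact a x)))\<bar>
          \<le> Lvol * norm (Q - lifted_opt a x)"
    and \<epsilon>: "\<epsilon> = Min {
          (lambda0 a x0)^2 * \<rho>0^2 / (2 * (real CARD('m))^2),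
          (lambda0 a x0)^2 * (r0 a x0)^2 / (8 * (real CARD('m))^2 * Lctr^2),
          (lambda0 a x0)^2 * (1 - q0)^2 / (2 * (real CARD('m))^2 * (L0 a x0)^2 * Lctr^2),
          (lambda0 a x0)^2 * (1 - q0)^2 * (ln (1 / \<gamma>))^2
             / (32 * (real CARD('m))^2 * (L0 a x0)^2 * Lctr^2),
          (lambda0 a x0)^2 * (ln (1 / \<gamma>))^2 / (32 * (real CARD('m))^2 * Lvol^2)}"
    and N: "N = nat \<lceil>log_plus (2 * delta_v a x0 / ln (1 / \<gamma>)) / ln (1 / q0)\<rceil>"
  shows "process_well_defined a \<epsilon> x0 \<and>
    (\<forall>Qh x E. inexact_process a \<epsilon> x0 Qh x E \<longrightarrow>
       gamma_maximal (hpoly a) \<gamma> (ellipsoid (x (N + 1)) (E (N + 1))))"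
proof -
  let ?m = "real CARD('m)" and ?lam = "lambda0 a x0" and ?l = "ln (1 / \<gamma>)"
  let ?r = "r0 a x0" and ?L = "L0 a x0"
  have bd: "bounded (hpoly a)" using P_polytope by (rule polytope_imp_bounded)
  have l: "?l > 0" using \<gamma> by simp
  have \<epsilon>0: "\<epsilon> \<ge> 0" unfolding \<epsilon> by simp
  have \<epsilon>_le: "\<epsilon> \<le> ?lam\<^sup>2 * \<rho>0\<^sup>2 / (2 * ?m\<^sup>2)"
    "\<epsilon> \<le> ?lam\<^sup>2 * ?r\<^sup>2 / (8 * ?m\<^sup>2 * Lctr\<^sup>2)"
    "\<epsilon> \<le> ?lam\<^sup>2 * (1 - q0)\<^sup>2 / (2 * ?m\<^sup>2 * ?L\<^sup>2 * Lctr\<^sup>2)"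
    "\<epsilon> \<le> ?lam\<^sup>2 * (1 - q0)\<^sup>2 * ?l\<^sup>2 / (32 * ?m\<^sup>2 * ?L\<^sup>2 * Lctr\<^sup>2)"
    "\<epsilon> \<le> ?lam\<^sup>2 * ?l\<^sup>2 / (32 * ?m\<^sup>2 * Lvol\<^sup>2)"
    unfolding \<epsilon> by (intro Min_le; simp)+
  \<comment> \<open>The recursion
    \<open>\<delta> \<mapsto> q0 * \<delta> + (1 - q0) * \<eta>\<close> has the fixed point
    \<open>\<eta>\<close>: at most 1 for the iterates to remain in \<open>Lset\<close>, at most
    \<open>?l / 4\<close> for the final accuracy.\<close>
  define \<eta> where "\<eta> = min 1 (?l / 4)"
  have step: "delta_v a (K_upd x Q) \<le> q0 * delta_v a x + (1 - q0) * \<eta>"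
      "ln (Vol (ellipsoid (K_exact a x) (E_exact a x))) - ?l / 4 \<le> ln (Vol (ellipsoid (K_upd x Q) (E_upd Q)))"
    if x: "x \<in> Lset a x0" and Q: "oracle_answer a \<epsilon> x Q" for x Q
  proof -
    let ?d = "norm (Q - lifted_opt a x)"
    have xint: "x \<in> interior (hpoly a)" using x by (simp add: Lset_def)
    have "delta_v a (K_upd x Q) \<le> q0 * delta_v a x + (1 - q0) * \<eta> \<and>
      ln (Vol (ellipsoid (K_exact a x) (E_exact a x))) - ?l / 4 \<le> ln (Vol (ellipsoid (K_upd x Q) (E_upd Q)))"
    proof (cases "\<epsilon> = 0")
      case True
      then have "Q = lifted_opt a x" using oracle_answer_zero[OF bd x0 xint] Q by simp
      moreover have "(1 - q0) * \<eta> \<ge> 0" using q0 l by (simp add: \<eta>_def)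
      ultimately show ?thesis using q0_contr[OF x] l by (simp add: K_exact_def E_exact_def)
    next
      case False
      then have pos: "\<epsilon> > 0" using \<epsilon>0 by simp
      have lam: "?lam > 0" using lambda0_nonneg[OF bd x0] \<epsilon>_le(1) pos by (cases "?lam = 0") auto
      have "?r \<ge> 0" by (simp add: r0_def setdist_pos_le)
      then have r: "?r > 0" using \<epsilon>_le(2) pos by (cases "?r = 0") auto
      have L: "?L > 0" using L0_nonneg[OF bd x0 r] \<epsilon>_le(3) pos by (cases "?L = 0") auto
      note dist = oracle_answer_dist[OF bd x0 x Q lam]
      \<comment> \<open>The five terms of \<open>\<epsilon>\<close> become five radii: validity of
        the Lipschitz constants, the ball in which \<open>L0\<close> applies, the two parts of
        \<open>\<eta>\<close>, and the volume error.\<close>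
      have d_\<rho>: "?d \<le> \<rho>0" using \<rho>0 \<epsilon>_le(1) by (intro dist) auto
      have d_r: "?d \<le> ?r / (2 * Lctr)"
        using r Lctr \<epsilon>_le(2) by (intro dist) (auto simp: power_divide power_mult_distrib mult_ac)
      have d_1: "?d \<le> (1 - q0) / (?L * Lctr)"
        using L Lctr q0 \<epsilon>_le(3) by (intro dist) (auto simp: power_divide power_mult_distrib mult_ac)
      have d_l: "?d \<le> (1 - q0) * ?l / (4 * ?L * Lctr)"
        using L Lctr q0 l \<epsilon>_le(4)
        by (intro dist) (auto simp: power_divide power_mult_distrib mult_ac simp del: ln_div)
      have d_v: "?d \<le> ?l / (4 * Lvol)"
        using Lvol l \<epsilon>_le(5) by (intro dist) (auto simp: power_divide power_mult_distrib mult_ac)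
      have near: "near_opt a \<rho>0 x Q" using Q d_\<rho> by (simp add: near_opt_def oracle_answer_def)
      have ctr: "norm (K_upd x Q - K_exact a x) \<le> Lctr * ?d" by (rule Lctr_lipschitz[OF x near])
      also have "\<dots> \<le> ?r / 2" using d_r Lctr by (simp add: field_simps)
      finally have "delta_v a (K_upd x Q) \<le> delta_v a (K_exact a x) + ?L * norm (K_upd x Q - K_exact a x)"
        by (rule delta_v_lipschitz[OF bd x0 r x])
      also have "\<dots> \<le> q0 * delta_v a x + ?L * (Lctr * ?d)"
        using ctr L by (intro add_mono q0_contr x mult_left_mono) auto
      also have "?L * (Lctr * ?d) \<le> (1 - q0) * \<eta>"
      proof -
        have LL: "?L * Lctr > 0" using L Lctr by simp
        have "?d * (?L * Lctr) \<le> (1 - q0)" using d_1 LL by (simp only: pos_le_divide_eq)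
        moreover have "?d * (?L * Lctr) \<le> (1 - q0) * (?l / 4)"
        proof -
          have "?d \<le> (1 - q0) * (?l / 4) / (?L * Lctr)" using d_l by (simp add: mult_ac)
          then show ?thesis using LL by (simp only: pos_le_divide_eq)
        qed
        ultimately show ?thesis by (simp add: \<eta>_def min_def mult_ac)
      qed
      finally have 1: "delta_v a (K_upd x Q) \<le> q0 * delta_v a x + (1 - q0) * \<eta>" by simp
      have "Lvol * ?d \<le> ?l / 4" using d_v Lvol by (simp add: field_simps)
      with Lvol_lipschitz[OF x near] 1 show ?thesis by linarith
    qed
    then show "delta_v a (K_upd x Q) \<le> q0 * delta_v a x + (1 - q0) * \<eta>"
      "ln (Vol (ellipsoid (K_exact a x) (E_exact a x))) - ?l / 4 \<le> ln (Vol (ellipsoid (K_upd x Q) (E_upd Q)))"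
      by auto
  qed
  have \<delta>0: "delta_v a x0 \<ge> 0" by (rule delta_v_nonneg[OF bd x0])
  have "gamma_maximal (hpoly a) \<gamma> (ellipsoid (x (N + 1)) (E (N + 1)))"
    if run: "inexact_process a \<epsilon> x0 Qh x E" for Qh x E
  proof -
    note int = inexact_process_interior[OF bd x0 run]
    have upd: "x (Suc k) = K_upd (x k) (Qh k)" "E (Suc k) = E_upd (Qh k)" for k
      using run by (auto simp: inexact_process_def)
    \<comment> \<open>The bound at step \<open>k\<close> gives membership in \<open>Lset\<close>,
      where the constants are valid, and membership gives the bound at step
      \<open>k + 1\<close>.\<close>
    have L: "x k \<in> Lset a x0" if "delta_v a (x k) \<le> q0 ^ k * delta_v a x0 + (1 - q0 ^ k) * \<eta>" for k
    proof -
      have qk: "0 \<le> q0 ^ k" "q0 ^ k \<le> 1" using q0 by (auto simp: power_le_one)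
      have "q0 ^ k * delta_v a x0 \<le> 1 * delta_v a x0" using qk \<delta>0 by (intro mult_right_mono)
      moreover have "(1 - q0 ^ k) * \<eta> \<le> 1 * 1" using qk l by (intro mult_mono) (auto simp: \<eta>_def)
      ultimately have "delta_v a (x k) \<le> delta_v a x0 + 1" using that by linarith
      then show ?thesis using int(1) by (simp add: Lset_def delta_v_def)
    qed
    have \<delta>: "delta_v a (x k) \<le> q0 ^ k * delta_v a x0 + (1 - q0 ^ k) * \<eta>" for k
    proof (induction k)
      case 0
      then show ?case using run by (simp add: inexact_process_def)
    next
      case (Suc k)
      have "delta_v a (x (Suc k)) \<le> q0 * delta_v a (x k) + (1 - q0) * \<eta>"
        unfolding upd(1) by (rule step(1)[OF L[OF Suc] int(2)])
      also have "\<dots> \<le> q0 * (q0 ^ k * delta_v a x0 + (1 - q0 ^ k) * \<eta>) + (1 - q0) * \<eta>"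
        using Suc q0 by (intro add_right_mono mult_left_mono) auto
      also have "\<dots> = q0 ^ Suc k * delta_v a x0 + (1 - q0 ^ Suc k) * \<eta>" by (simp add: algebra_simps)
      finally show ?case .
    qed
    have feas: "lifted_feasible a (x N) (Qh N)" using int(2) by (simp add: oracle_answer_def)
    have pd: "pos_def (E_upd (Qh N))" by (rule E_upd_eq(1)[OF bd int(1) feas])
    let ?S = "ellipsoid (K_upd (x N) (Qh N)) (E_upd (Qh N))"
    have "(1 - q0 ^ N) * \<eta> \<le> 1 * (?l / 4)" using q0 l by (intro mult_mono) (auto simp: \<eta>_def power_le_one)
    \<comment> \<open>The loss \<open>?l\<close> is made up of \<open>?l / 2\<close> after the
      contraction, \<open>?l / 4\<close> of accumulated center errors and \<open>?l / 4\<close> of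
      volume error. The ellipsoid is generated from \<open>x N\<close>, hence the index
      \<open>N + 1\<close>.\<close>
    with \<delta>[of N] power_ceiling_log_plus[OF q0 \<delta>0 l N] have "delta_v a (x N) \<le> ?l / 2 + ?l / 4" by linarith
    with step(2)[OF L[OF \<delta>] int(2), of N] update_ellipsoid_volume_delta[OF bd int(1), of N]
    have "ln (Vol (MaxIE (hpoly a))) - ?l \<le> ln (Vol ?S)" by linarith
    then have "ln (\<gamma> * Vol (MaxIE (hpoly a))) \<le> ln (Vol ?S)"
      using \<gamma> Vol_MaxIE_pos[OF bd] by (simp add: ln_mult ln_div)
    moreover have "Vol ?S > 0" using pos_def_det_pos[OF pd] by (simp add: Vol_ellipsoid[OF pd])
    ultimately have "\<gamma> * Vol (MaxIE (hpoly a)) \<le> Vol ?S"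
      using \<gamma> Vol_MaxIE_pos[OF bd] by (subst (asm) ln_le_cancel_iff) auto
    then show ?thesis
      using pd update_ellipsoid_subset[OF bd int(1) feas]
      by (auto simp: gamma_maximal_def is_ellipsoid_def upd)
  qed
  then show ?thesis using process_well_definedI[OF bd x0 \<epsilon>0] by blast
qed

end
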